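(* Let $k\ge2$, let $f$ be a nonnegative nondegenerate $k$-regular sequence with minimal nondegenerate linear representation $(\mathbf u,\mathcal A,\mathbf v)$, and let $\mu_h$ ($h\in G$) be a ghost measure of $f$. Assume further that $\mathbf R$ commutes with $\mathbf A_i$ for all $0\le i\le k-1$. Then there exists a nonnegative $k$-regular sequence $g_h$ with a reduced representation $(\mathbf w,\mathcal B,\mathbf x)$ such that $\mu_h$ is the unique ghost measure of $g_h$.
   Context: Regular sequences. Fix an integer $k\ge2$. For $n\ge1$ let $(n)_k=i_s\cdots i_0$ be the base-$k$ expansion ($i_s\ne0$), and for $d\times d$ matrices $\mathbf A_0,\dots,\mathbf A_{k-1}$ put $\mathbf A_{(n)_k}=\mathbf A_{i_s}\cdots\mathbf A_{i_0}$, with $\mathbf A_{(0)_k}$ the identity. A real sequence $f=(f(n))_{n\ge0}$ is $k$-regular if its $k$-kernel $\{(f(k^\ell n+r))_{n\ge 0}:\ell\ge0,\ 0\le r<k^\ell\}$ spans a finite-dimensional real vector space $V_k(f)$. A linear representation of $f$ of degree $d$ is a tuple $(\mathbf u,\mathcal A,\mathbf v)$ with $\mathbf u,\mathbf v\in\mathbb R^{d}$, $\mathcal A=\{\mathbf A_0,\dots,\mathbf A_{k-1}\}\subset\mathbb R^{d\times d}$ and $f(n)=\mathbf u^T\mathbf A_{(n)_k}\mathbf v$ for all $n\ge 0$; it is minimal if $d=\dim V_k(f)$. Put $\mathbf A=\sum_{j=0}^{k-1}\mathbf A_j$. Ghost measures. For nonnegative $f$ put $\Sigma_f(N)=\sum_{m=k^N}^{k^{N+1}-1}f(m)$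 and, when $\Sigma_f(N)\neq0$, $\mu_N=\frac1{\Sigma_f(N)}\sum_{m=0}^{k^{N+1}-k^N-1}f(k^N+m)\,\delta_{m/(k^N(k-1))}$, a probability measure on $\mathbb T=[0,1)$ with addition mod $1$. Ghost measures of $f$ are the weak accumulation points of $(\mu_N)_N$. Group and nondegeneracy. Let $V\subset\mathbb R^d$ be the subspace with $V^T=\mathrm{span}\{\mathbf u^T\mathbf A_{(n)_k}:n\ge1\}$, $\mathbf P_V$ the orthogonal projection onto $V$, $\widetilde{\mathbf A}=\mathbf P_V\mathbf A\mathbf P_V$, $\rho=\rho(\widetilde{\mathbf A})$ the spectral radius, $\{g_1\rho,\dots,g_s\rho\}$ ($|g_i|=1$) the eigenvalues of $\widetilde{\mathbf A}$ of modulus $\rho$, $g=(g_1,\dots,g_s)$ and $G=\overline{\{g^n:n\in\mathbb N\}}$ (closure in the $s$-fold product of the complex unit circle). For $h\in G$ let $\mathbf R_h$ be multiplication by $h_m$ on the generalised eigenspace in $V$ (complexified) of $\widetilde{\mathbf A}$ for $g_m\rho$, and the identity on the other generalised eigenspaces in $V$ and on $V^\perp$; $\mathbf R=\mathbf R_{g^{-1}}$ (a real matrix). Let $r$ be the maximal size of a Jordan block of $\widetilde{\mathbf A}$ for an eigenvalue of modulus $\rho$, $c_n=\frac{(r-1)!}{n^{r-1}\rho^{n-r+1}}$, $\mathbf P=\lim_{n\to\infty}c_n\mathbf R^n\widetilde{\mathbf A}^n$ (the limit exists). The representation is nondegenerate if $\rho>0$ and $\mathbf u^T(\mathbf A-\mathbf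 A_0)\mathbf R_h\mathbf P\mathbf v>0$ for all $h\in G$; $f$ is nondegenerate if it has a minimal nondegenerate linear representation. In that case, for each $h\in G$ the measures $\mu_{n_j}$ converge weakly to one and the same measure $\mu_h$ along every sequence $n_j\to\infty$ with $g^{n_j}\to h$, and the ghost measures of $f$ are exactly the $\mu_h$, $h\in G$. Reduced representation. A linear representation $(\mathbf w,\mathcal B,\mathbf x)$, $\mathcal B=\{\mathbf B_0,\dots,\mathbf B_{k-1}\}$, of a nonnegative $k$-regular sequence $g$ is reduced if, with $\mathbf B=\sum_i\mathbf B_i$, $W$ the subspace with $W^T=\mathrm{span}\{\mathbf w^T\mathbf B_{(n)_k}:n\ge1\}$ and $\widetilde{\mathbf B}=\mathbf P_W\mathbf B\mathbf P_W$ ($\mathbf P_W$ orthogonal projection): (i) the spectral radius $\rho(\widetilde{\mathbf B})$ is an eigenvalue of $\widetilde{\mathbf B}$ and the only one of maximal modulus; (ii) $\mathbf x$ is a $\rho(\widetilde{\mathbf B})$-eigenvector of $\widetilde{\mathbf B}$; (iii) $\Sigma_g(n)=\rho(\widetilde{\mathbf B})^n$ for all $n\in\mathbb N$; (iv) $g$ has a unique ghost measure. *)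

theory Defs
  imports
    "HOL-Probability.Probability"
    "HOL-Library.Function_Algebras"
    "Jordan_Normal_Form.Jordan_Normal_Form_Uniqueness"
    "Jordan_Normal_Form.Spectral_Radius"
begin

section \<open>Regular sequences and linear representations\<close>

interpretation seq: vector_space "\<lambda>(c :: real) (f :: nat \<Rightarrow> real) n. c * f n"
  by unfold_locales (auto simp: fun_eq_iff algebra_simps)

definition k_kernel :: "nat \<Rightarrow> (nat \<Rightarrow> real) \<Rightarrow> (nat \<Rightarrow> real) set" where
  "k_kernel k f = {(\<lambda>n. f (k ^ l * n + r)) | l r. r < k ^ l}"

definition kernel_space :: "nat \<Rightarrow> (nat \<Rightarrow> real) \<Rightarrow> (nat \<Rightarrow> real) set" where
  "kernel_space k f = seq.span (k_kernel k f)"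

definition k_regular :: "nat \<Rightarrow> (nat \<Rightarrow> real) \<Rightarrow> bool" where
  "k_regular k f \<longleftrightarrow> (\<exists>S. finite S \<and> kernel_space k f = seq.span S)"

text \<open>For \<open>n \<ge> 1\<close> with base-\<open>k\<close> expansion \<open>i\<^sub>s \<dots> i\<^sub>0\<close> this is \<open>A i\<^sub>s * \<dots> * A i\<^sub>0\<close>: the most
  significant digit stands on the left, and leading zeros contribute no factor. The guard
  \<open>k < 2\<close> only serves termination.\<close>

fun digit_prod :: "nat \<Rightarrow> nat \<Rightarrow> (nat \<Rightarrow> real mat) \<Rightarrow> nat \<Rightarrow> real mat" where
  "digit_prod k d A n =
     (if n = 0 \<or> k < 2 then 1\<^sub>m d else digit_prod k d A (n div k) * A (n mod k))"

declare digit_prod.simps [simp del]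

definition linear_rep ::
  "nat \<Rightarrow> (nat \<Rightarrow> real) \<Rightarrow> nat \<Rightarrow> real vec \<Rightarrow> (nat \<Rightarrow> real mat) \<Rightarrow> real vec \<Rightarrow> bool" where
  "linear_rep k f d u A v \<longleftrightarrow>
     u \<in> carrier_vec d \<and> v \<in> carrier_vec d \<and> (\<forall>j<k. A j \<in> carrier_mat d d) \<and>
     (\<forall>n. f n = scalar_prod u (digit_prod k d A n *\<^sub>v v))"

definition minimal_rep ::
  "nat \<Rightarrow> (nat \<Rightarrow> real) \<Rightarrow> nat \<Rightarrow> real vec \<Rightarrow> (nat \<Rightarrow> real mat) \<Rightarrow> real vec \<Rightarrow> bool" where
  "minimal_rep k f d u A v \<longleftrightarrow> linear_rep k f d u A v \<and> d = seq.dim (kernel_space k f)"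

definition mat_total :: "nat \<Rightarrow> nat \<Rightarrow> (nat \<Rightarrow> real mat) \<Rightarrow> real mat" where
  "mat_total k d A = mat d d (\<lambda>(i, j). \<Sum>l<k. A l $$ (i, j))"


section \<open>Ghost measures\<close>

definition block_sum :: "nat \<Rightarrow> (nat \<Rightarrow> real) \<Rightarrow> nat \<Rightarrow> real" where
  "block_sum k f N = (\<Sum>m = k ^ N..<k ^ (N + 1). f m)"

text \<open>The torus is \<open>[0,1)\<close> as a measurable space. Its circle topology enters only through weak
  convergence below, where the test functions are the continuous functions of period one.\<close>

definition torus :: "real measure" where
  "torus = restrict_space borel {0..<1}"

text \<open>The weighted sum of Dirac measures, written as the image of a weighted counting measure.\<close>

definition block_measure :: "nat \<Rightarrow> (nat \<Rightarrow> real) \<Rightarrow> nat \<Rightarrow> real measure" where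
  "block_measure k f N =
     distr (point_measure {..<k ^ (N + 1) - k ^ N}
              (\<lambda>m. ennreal (f (k ^ N + m) / block_sum k f N)))
       torus (\<lambda>m. real m / (real k ^ N * (real k - 1)))"

definition weak_conv_torus :: "(nat \<Rightarrow> real measure) \<Rightarrow> real measure \<Rightarrow> bool" where
  "weak_conv_torus M \<mu> \<longleftrightarrow>
     prob_space \<mu> \<and> sets \<mu> = sets torus \<and>
     (\<forall>\<phi> :: real \<Rightarrow> real. continuous_on UNIV \<phi> \<and> (\<forall>x. \<phi> (x + 1) = \<phi> x) \<longrightarrow>
        (\<lambda>j. lebesgue_integral (M j) \<phi>) \<longlonglongrightarrow> lebesgue_integral \<mu> \<phi>)"

text \<open>The weak topology on probability measures on the torus is metrizable, so accumulation
  points are limits of subsequences.\<close>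

definition ghost_measure :: "nat \<Rightarrow> (nat \<Rightarrow> real) \<Rightarrow> real measure \<Rightarrow> bool" where
  "ghost_measure k f \<mu> \<longleftrightarrow>
     (\<exists>s :: nat \<Rightarrow> nat. strict_mono s \<and> (\<forall>j. block_sum k f (s j) \<noteq> 0) \<and>
        weak_conv_torus (\<lambda>j. block_measure k f (s j)) \<mu>)"


section \<open>The compressed matrix and its peripheral spectrum\<close>

abbreviation cmat :: "real mat \<Rightarrow> complex mat" where
  "cmat \<equiv> map_mat complex_of_real"

text \<open>The vector \<open>transpose_mat M *\<^sub>v u\<close> is the row vector \<open>u\<^sup>T M\<close>, written as a column.\<close>

definition row_orbit_space :: "nat \<Rightarrow> nat \<Rightarrow> real vec \<Rightarrow> (nat \<Rightarrow> real mat) \<Rightarrow> real vec set" where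
  "row_orbit_space k d u A =
     LinearCombinations.module.span class_ring (module_vec TYPE(real) d)
       {transpose_mat (digit_prod k d A n) *\<^sub>v u | n. n \<ge> 1}"

definition orth_proj :: "nat \<Rightarrow> real vec set \<Rightarrow> real mat" where
  "orth_proj d V = (THE P. P \<in> carrier_mat d d \<and>
     (\<forall>x\<in>carrier_vec d. P *\<^sub>v x \<in> V \<and> x - P *\<^sub>v x \<in> vec_module.orthogonal_complement d V))"

definition compressed :: "nat \<Rightarrow> nat \<Rightarrow> real vec \<Rightarrow> (nat \<Rightarrow> real mat) \<Rightarrow> real mat" where
  "compressed k d u A =
     (let P = orth_proj d (row_orbit_space k d u A) in P * mat_total k d A * P)"

definition rho :: "nat \<Rightarrow> nat \<Rightarrow> real vec \<Rightarrow> (nat \<Rightarrow> real mat) \<Rightarrow> real" where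
  "rho k d u A = spectral_radius (cmat (compressed k d u A))"

text \<open>The tuple \<open>(g\<^sub>1, \<dots>, g\<^sub>s)\<close> is indexed by the eigenvalues \<open>z = g\<^sub>m \<rho>\<close> of maximal modulus
  instead of by \<open>1, \<dots>, s\<close>, and extended by \<open>1\<close> to all other complex numbers. Elements of the
  group are likewise functions on the complex numbers that are constantly \<open>1\<close> away from these
  eigenvalues, and the closure is taken in the topology of pointwise convergence.\<close>

definition phase :: "nat \<Rightarrow> nat \<Rightarrow> real vec \<Rightarrow> (nat \<Rightarrow> real mat) \<Rightarrow> complex \<Rightarrow> complex" where
  "phase k d u A z =
     (if eigenvalue (cmat (compressed k d u A)) z \<and> cmod z = rho k d u A
      then z / complex_of_real (rho k d u A) else 1)"

definition phase_group ::
  "nat \<Rightarrow> nat \<Rightarrow> real vec \<Rightarrow> (nat \<Rightarrow> real mat) \<Rightarrow> (complex \<Rightarrow> complex) set" where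
  "phase_group k d u A = closure (range (\<lambda>n :: nat. \<lambda>z. phase k d u A z ^ n))"

text \<open>The generalised eigenspace for \<open>z\<close> inside the complexification of \<open>V\<close>; it is zero if \<open>z\<close>
  is not an eigenvalue.\<close>

definition gen_eigenspace ::
  "nat \<Rightarrow> nat \<Rightarrow> real vec \<Rightarrow> (nat \<Rightarrow> real mat) \<Rightarrow> complex \<Rightarrow> complex vec set" where
  "gen_eigenspace k d u A z =
     {x \<in> mat_kernel (char_matrix (cmat (compressed k d u A)) z ^\<^sub>m d).
        map_vec Re x \<in> row_orbit_space k d u A \<and> map_vec Im x \<in> row_orbit_space k d u A}"

text \<open>Elements \<open>h\<close> of the group satisfy \<open>h (cnj z) = cnj (h z)\<close>, so the matrix below is real. It
  is unique because the generalised eigenspaces in \<open>V\<close> and the orthogonal complement of \<open>V\<close>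
  together span the whole space. As \<open>h\<close> is \<open>1\<close> off the eigenvalues of maximal modulus, the first
  condition also says that the matrix is the identity on the other generalised eigenspaces.\<close>

definition rotation ::
  "nat \<Rightarrow> nat \<Rightarrow> real vec \<Rightarrow> (nat \<Rightarrow> real mat) \<Rightarrow> (complex \<Rightarrow> complex) \<Rightarrow> real mat" where
  "rotation k d u A h = (THE M. M \<in> carrier_mat d d \<and>
     (\<forall>z. \<forall>x\<in>gen_eigenspace k d u A z. cmat M *\<^sub>v x = h z \<cdot>\<^sub>v x) \<and>
     (\<forall>x\<in>vec_module.orthogonal_complement d (row_orbit_space k d u A). M *\<^sub>v x = x))"

definition inv_rotation :: "nat \<Rightarrow> nat \<Rightarrow> real vec \<Rightarrow> (nat \<Rightarrow> real mat) \<Rightarrow> real mat" where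
  "inv_rotation k d u A = rotation k d u A (\<lambda>z. inverse (phase k d u A z))"

definition max_block :: "nat \<Rightarrow> nat \<Rightarrow> real vec \<Rightarrow> (nat \<Rightarrow> real mat) \<Rightarrow> nat" where
  "max_block k d u A =
     Max {m. \<exists>n_as z. jordan_nf (cmat (compressed k d u A)) n_as \<and> (m, z) \<in> set n_as \<and>
                      cmod z = rho k d u A}"

definition growth_coeff :: "nat \<Rightarrow> nat \<Rightarrow> real vec \<Rightarrow> (nat \<Rightarrow> real mat) \<Rightarrow> nat \<Rightarrow> real" where
  "growth_coeff k d u A n =
     (let r = max_block k d u A
      in fact (r - 1) / (real n ^ (r - 1) * rho k d u A powi (int n - int r + 1)))"

definition limit_mat :: "nat \<Rightarrow> nat \<Rightarrow> real vec \<Rightarrow> (nat \<Rightarrow> real mat) \<Rightarrow> real mat" where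
  "limit_mat k d u A = mat d d (\<lambda>(i, j).
     lim (\<lambda>n. growth_coeff k d u A n *
                ((inv_rotation k d u A ^\<^sub>m n * compressed k d u A ^\<^sub>m n) $$ (i, j))))"

definition nondegenerate_rep ::
  "nat \<Rightarrow> nat \<Rightarrow> real vec \<Rightarrow> (nat \<Rightarrow> real mat) \<Rightarrow> real vec \<Rightarrow> bool" where
  "nondegenerate_rep k d u A v \<longleftrightarrow>
     rho k d u A > 0 \<and>
     (\<forall>h\<in>phase_group k d u A.
        scalar_prod u
          (((mat_total k d A - A 0) * rotation k d u A h * limit_mat k d u A) *\<^sub>v v) > 0)"

text \<open>The measure \<open>\<mu>\<close> is the common weak limit attached to the group element \<open>h\<close>.\<close>

definition ghost_measure_at ::
  "nat \<Rightarrow> (nat \<Rightarrow> real) \<Rightarrow> nat \<Rightarrow> real vec \<Rightarrow> (nat \<Rightarrow> real mat) \<Rightarrow> (complex \<Rightarrow> complex) \<Rightarrow>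
     real measure \<Rightarrow> bool" where
  "ghost_measure_at k f d u A h \<mu> \<longleftrightarrow>
     (\<forall>s :: nat \<Rightarrow> nat.
        filterlim s at_top sequentially \<and> (\<forall>j. block_sum k f (s j) \<noteq> 0) \<and>
        (\<lambda>j. (\<lambda>z. phase k d u A z ^ s j)) \<longlonglongrightarrow> h \<longrightarrow>
        weak_conv_torus (\<lambda>j. block_measure k f (s j)) \<mu>)"

definition reduced_rep ::
  "nat \<Rightarrow> (nat \<Rightarrow> real) \<Rightarrow> nat \<Rightarrow> real vec \<Rightarrow> (nat \<Rightarrow> real mat) \<Rightarrow> real vec \<Rightarrow> bool" where
  "reduced_rep k g d w B x \<longleftrightarrow>
     linear_rep k g d w B x \<and>
     eigenvalue (cmat (compressed k d w B)) (complex_of_real (rho k d w B)) \<and>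
     (\<forall>z. eigenvalue (cmat (compressed k d w B)) z \<and> cmod z = rho k d w B \<longrightarrow>
          z = complex_of_real (rho k d w B)) \<and>
     eigenvector (compressed k d w B) x (rho k d w B) \<and>
     (\<forall>n. block_sum k g n = rho k d w B ^ n) \<and>
     (\<exists>!\<nu>. ghost_measure k g \<nu>)"

end

(*
For N large, f(m) restricted to the words that begin with a fixed word n of length l+1 has total
mass u^T A_(n) A^(N-l) v, and after scaling by c_N this behaves like u^T A_(n) R_h R^l P v along
any sequence N with g^N -> h. So mu_h gives the k-adic cell of n the mass
rho^(-l) u^T A_(n) R^l y, where y is a multiple of R_h P v with R A~ y = rho y.
Since R commutes with the digit matrices, u^T A_(n) R^l y is itself a regular sequence g, read off
from the matrices R A_i. Its block sums are exactly rho^l, its block measures are discretisations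
of mu_h, and the factor R cancels the phases of the peripheral spectrum, so that only rho remains.
Replacing the right vector by its projection to the row orbit space makes it an eigenvector.
*)
theory Submission
  imports Defs
begin

text \<open>A word n with l + 1 digits needs exactly l factors \<open>R\<close>, whereas the
  matrices \<open>R * A i\<close> supply l + 1. Correcting the left vector by the inverse of
  \<open>R\<close> would repair this but leave the sign of g(0) open, because no cell belongs to 0.
  Therefore d coordinates are added for an initial state that is left with the first digit; the left
  vector lives there, and g(0) = 0.

  The spectral statements rest on one device: a function on the spectrum is applied to the
  semisimple part of the compressed matrix C through a Jordan basis. Rotations and powers of
  \<open>R\<close> are of this kind and commute with C. The orthogonal complement of V lies in the
  kernel of C, and rho > 0 makes the phase at 0 equal to 1, so the prescriptions on V and on its
  complement agree.

  An element h of the group may be a single power of g; recurrence of numbers of modulus 1 supplies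
  exponents that tend to infinity. Nondegeneracy at h makes the limit K of the scaled block sums
  positive. This permits division by the block sums, and dividing by K normalises y so that the cell
  masses of each level add up to 1.\<close>

section \<open>Orthogonal projections\<close>

no_notation inner (infix "\<bullet>" 70)
no_notation vec_nth (infixl "$" 90)

text \<open>Pad the vectors with zeros to the rows of a square matrix \<open>M\<close> of size m.
  Then \<open>M * transpose_mat M\<close> is diagonal without zeros on the diagonal, whereas for m >
  d the column d of \<open>M\<close> vanishes and \<open>M\<close> is singular. The bound ends the
  search for a maximal orthogonal family.\<close>

lemma orthogonal_family_length:
  fixes bs :: "real vec list"
  assumes carr: "set bs \<subseteq> carrier_vec d"
    and orth: "\<And>i j. i < length bs \<Longrightarrow> j < length bs \<Longrightarrow> bs ! i \<bullet> bs ! j = 0 \<longleftrightarrow> i \<noteq> j"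
  shows "length bs \<le> d"
proof (rule ccontr)
  assume "\<not> length bs \<le> d"
  define m where "m = length bs"
  have dm: "d < m" using \<open>\<not> length bs \<le> d\<close> by (simp add: m_def)
  define M where "M = mat m m (\<lambda>(i,j). if j < d then bs ! i $ j else 0)"
  have M: "M \<in> carrier_mat m m" by (simp add: M_def)
  have b: "bs ! i \<in> carrier_vec d" if "i < m" for i
    using carr that by (auto simp: m_def)
  have prod: "(M * transpose_mat M) $$ (i,j) = bs ! i \<bullet> bs ! j" if "i < m" "j < m" for i j
  proof -
    have "(M * transpose_mat M) $$ (i,j) =
        (\<Sum>l = 0..<m. (if l < d then bs ! i $ l else 0) * (if l < d then bs ! j $ l else 0))"
      using that by (simp add: M_def scalar_prod_def)
    also have "\<dots> = (\<Sum>l = 0..<d. bs ! i $ l * bs ! j $ l)"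
      using dm by (intro sum.mono_neutral_cong_right) auto
    also have "\<dots> = bs ! i \<bullet> bs ! j"
      using b[OF that(2)] by (simp add: scalar_prod_def)
    finally show ?thesis .
  qed
  have MM: "M * transpose_mat M \<in> carrier_mat m m" using M by simp
  have "upper_triangular (M * transpose_mat M)"
    using MM prod orth by (auto simp: upper_triangular_def m_def)
  then have "det (M * transpose_mat M) = prod_list (diag_mat (M * transpose_mat M))"
    using MM by (rule det_upper_triangular)
  also have "\<dots> \<noteq> 0"
    using MM prod orth
    by (auto simp: prod_list_zero_iff diag_mat_def m_def)
  finally have "det M \<noteq> 0"
    using det_mult[OF M, of "transpose_mat M"] M by auto
  moreover have "M *\<^sub>v unit_vec m d = 0\<^sub>v m"
    using dm by (intro eq_vecI) (auto simp: M_def)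
  then have "det M = 0"
    using det_0_iff_vec_prod_zero[OF M] dm by (metis unit_vec_carrier unit_vec_nonzero)
  ultimately show False by simp
qed

lemma self_scalar_prod_zero:
  fixes x :: "real vec"
  assumes "x \<in> carrier_vec d" "x \<bullet> x = 0"
  shows "x = 0\<^sub>v d"
proof (rule eq_vecI)
  fix i assume "i < dim_vec (0\<^sub>v d :: real vec)"
  then have "i < d" by simp
  moreover have "(\<Sum>j=0..<d. x $ j * x $ j) = 0"
    using assms by (simp add: scalar_prod_def)
  ultimately show "x $ i = 0\<^sub>v d $ i"
    by (subst (asm) sum_nonneg_eq_0_iff) auto
qed (use assms in auto)

lemma scalar_prod_mult_mat_vec:
  fixes M :: "'a :: comm_semiring_1 mat"
  assumes "M \<in> carrier_mat n m" "x \<in> carrier_vec n" "y \<in> carrier_vec m"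
  shows "x \<bullet> (M *\<^sub>v y) = (transpose_mat M *\<^sub>v x) \<bullet> y"
  using transpose_vec_mult_scalar[OF assms(1,3,2)] assms
  by (simp add: comm_scalar_prod[of _ m] comm_scalar_prod[of _ n])

lemma eq_mat_vecI:
  fixes M N :: "'a :: comm_semiring_1 mat"
  assumes "M \<in> carrier_mat n m" "N \<in> carrier_mat n m"
    and "\<And>x. x \<in> carrier_vec m \<Longrightarrow> M *\<^sub>v x = N *\<^sub>v x"
  shows "M = N"
proof (rule eq_matI)
  fix i j assume "i < dim_row N" "j < dim_col N"
  then have ij: "i < n" "j < m" using assms by auto
  have "M $$ (i,j) = (M *\<^sub>v unit_vec m j) $ i" using ij assms(1) by auto
  also have "\<dots> = (N *\<^sub>v unit_vec m j) $ i" using assms(3) by simp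
  also have "\<dots> = N $$ (i,j)" using ij assms(2) by auto
  finally show "M $$ (i,j) = N $$ (i,j)" .
qed (use assms in auto)

lemma mat_commute_pow:
  fixes X Y :: "'a :: semiring_1 mat"
  assumes "X \<in> carrier_mat d d" "Y \<in> carrier_mat d d" "X * Y = Y * X"
  shows "X * Y ^\<^sub>m n = Y ^\<^sub>m n * X"
proof (induction n)
  case 0
  then show ?case using assms by simp
next
  case (Suc n)
  have c: "Y ^\<^sub>m n \<in> carrier_mat d d" using assms(2) by (rule pow_carrier_mat)
  have "X * Y ^\<^sub>m Suc n = X * Y ^\<^sub>m n * Y"
    using assms c by (simp add: assoc_mult_mat[of _ d d _ d _ d])
  also have "\<dots> = Y ^\<^sub>m n * (Y * X)"
    unfolding Suc using assms c by (simp add: assoc_mult_mat[of _ d d _ d _ d])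
  also have "\<dots> = Y ^\<^sub>m Suc n * X" using assms(1,2) c by (simp add: assoc_mult_mat[of _ d d _ d _ d])
  finally show ?case .
qed

text \<open>Only closure properties are assumed, so that the projection applies to the row orbit
  space of the given matrices and to that of the enlarged family in dimension d + d.\<close>

locale vec_subspace =
  fixes d :: nat and V :: "real vec set"
  assumes carr: "V \<subseteq> carrier_vec d"
    and zero_mem: "0\<^sub>v d \<in> V"
    and add_mem: "x \<in> V \<Longrightarrow> y \<in> V \<Longrightarrow> x + y \<in> V"
    and smult_mem: "x \<in> V \<Longrightarrow> c \<cdot>\<^sub>v x \<in> V"
begin

lemma diff_mem: "x \<in> V \<Longrightarrow> y \<in> V \<Longrightarrow> x - y \<in> V"
  using add_mem[of x "-1 \<cdot>\<^sub>v y"] smult_mem[of y "-1"] carr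
  by (subgoal_tac "x - y = x + (-1) \<cdot>\<^sub>v y") (auto intro!: eq_vecI)

abbreviation orth_compl :: "real vec set" where
  "orth_compl \<equiv> vec_module.orthogonal_complement d V"

lemma orth_compl_iff: "x \<in> orth_compl \<longleftrightarrow> x \<in> carrier_vec d \<and> (\<forall>y\<in>V. x \<bullet> y = 0)"
  by (simp add: vec_module.orthogonal_complement_def)

text \<open>Take an orthogonal family of non-null vectors of V of maximal length and let
  \<open>P\<close> be the sum of the rank one projections onto its members, without normalising
  them. For x in V the residual x - P x could be appended to the family if it were nonzero, so
  \<open>P\<close> fixes V.\<close>

lemma ex_orth_proj:
  "\<exists>P \<in> carrier_mat d d. \<forall>x\<in>carrier_vec d. P *\<^sub>v x \<in> V \<and> x - P *\<^sub>v x \<in> orth_compl"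
proof -
  define Q where "Q bs \<longleftrightarrow> set bs \<subseteq> V \<and>
    (\<forall>i<length bs. \<forall>j<length bs. bs ! i \<bullet> bs ! j = 0 \<longleftrightarrow> i \<noteq> j)" for bs
  have bound: "length bs \<le> d" if "Q bs" for bs
    using that carr by (intro orthogonal_family_length) (auto simp: Q_def)
  have "Q []" by (simp add: Q_def)
  then obtain bs where bs: "Q bs" and max: "\<And>cs. Q cs \<Longrightarrow> length cs \<le> length bs"
    using ex_has_greatest_nat[of Q "[]" length "Suc d"] bound by (metis less_Suc_eq_le)
  define m where "m = length bs"
  have bV: "bs ! i \<in> V" if "i < m" for i using bs that by (auto simp: Q_def m_def)
  have bc: "bs ! i \<in> carrier_vec d" if "i < m" for i using bV[OF that] carr by auto
  have bnz: "bs ! i \<bullet> bs ! i \<noteq> 0" if "i < m" for i using bs that by (auto simp: Q_def m_def)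
  have bo: "bs ! i \<bullet> bs ! j = 0" if "i < m" "j < m" "i \<noteq> j" for i j
    using bs that by (auto simp: Q_def m_def)
  define P where "P = mat d d (\<lambda>(i,j). \<Sum>l<m. bs ! l $ i * bs ! l $ j / (bs ! l \<bullet> bs ! l))"
  have P: "P \<in> carrier_mat d d" by (simp add: P_def)
  have Px: "P *\<^sub>v x = vec d (\<lambda>i. \<Sum>l<m. (bs ! l \<bullet> x / (bs ! l \<bullet> bs ! l)) * bs ! l $ i)"
    if "x \<in> carrier_vec d" for x
  proof (intro eq_vecI)
    fix i assume i: "i < dim_vec (vec d (\<lambda>i. \<Sum>l<m. (bs ! l \<bullet> x / (bs ! l \<bullet> bs ! l)) * bs ! l $ i))"
    then have "(P *\<^sub>v x) $ i = (\<Sum>j=0..<d. (\<Sum>l<m. bs ! l $ i * bs ! l $ j / (bs ! l \<bullet> bs ! l)) * x $ j)"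
      using that by (simp add: P_def scalar_prod_def)
    also have "\<dots> = (\<Sum>l<m. \<Sum>j=0..<d. bs ! l $ i * bs ! l $ j / (bs ! l \<bullet> bs ! l) * x $ j)"
      unfolding sum_distrib_right by (rule sum.swap)
    also have "\<dots> = (\<Sum>l<m. (bs ! l \<bullet> x / (bs ! l \<bullet> bs ! l)) * bs ! l $ i)"
    proof (intro sum.cong refl)
      fix l assume "l \<in> {..<m}"
      have "bs ! l \<bullet> x = (\<Sum>j=0..<d. bs ! l $ j * x $ j)"
        using that by (simp add: scalar_prod_def)
      then show "(\<Sum>j=0..<d. bs ! l $ i * bs ! l $ j / (bs ! l \<bullet> bs ! l) * x $ j) =
          (bs ! l \<bullet> x / (bs ! l \<bullet> bs ! l)) * bs ! l $ i"
        by (simp add: sum_distrib_left sum_distrib_right sum_divide_distrib mult_ac)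
    qed
    finally show "(P *\<^sub>v x) $ i = vec d (\<lambda>i. \<Sum>l<m. (bs ! l \<bullet> x / (bs ! l \<bullet> bs ! l)) * bs ! l $ i) $ i"
      using i by simp
  qed (simp add: P_def)
  have comb: "vec d (\<lambda>i. \<Sum>l<n. c l * bs ! l $ i) \<in> V" if "n \<le> m" for c n
    using that
  proof (induction n)
    case 0
    have "vec d (\<lambda>i. 0 :: real) = 0\<^sub>v d" by auto
    then show ?case using zero_mem by simp
  next
    case (Suc n)
    have "vec d (\<lambda>i. \<Sum>l<Suc n. c l * bs ! l $ i) =
        vec d (\<lambda>i. \<Sum>l<n. c l * bs ! l $ i) + c n \<cdot>\<^sub>v (bs ! n)"
      using bc[of n] Suc.prems by (intro eq_vecI) auto
    then show ?case using Suc add_mem smult_mem bV[of n] by simp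
  qed
  have PV: "P *\<^sub>v x \<in> V" if "x \<in> carrier_vec d" for x
    unfolding Px[OF that] by (rule comb) simp
  have Pc: "P *\<^sub>v x \<in> carrier_vec d" if "x \<in> carrier_vec d" for x
    using PV[OF that] carr by blast
  have comb_dot: "vec d (\<lambda>i. \<Sum>l<m. c l * bs ! l $ i) \<bullet> z = (\<Sum>l<m. c l * (bs ! l \<bullet> z))"
    if "z \<in> carrier_vec d" for c z
  proof -
    have "vec d (\<lambda>i. \<Sum>l<m. c l * bs ! l $ i) \<bullet> z = (\<Sum>i=0..<d. \<Sum>l<m. c l * bs ! l $ i * z $ i)"
      using that by (simp add: scalar_prod_def sum_distrib_right)
    also have "\<dots> = (\<Sum>l<m. \<Sum>i=0..<d. c l * bs ! l $ i * z $ i)" by (rule sum.swap)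
    also have "\<dots> = (\<Sum>l<m. c l * (bs ! l \<bullet> z))"
      using that by (simp add: scalar_prod_def sum_distrib_left mult_ac)
    finally show ?thesis .
  qed
  have res: "(x - P *\<^sub>v x) \<bullet> bs ! i = 0" if x: "x \<in> carrier_vec d" and i: "i < m" for x i
  proof -
    have "(P *\<^sub>v x) \<bullet> bs ! i = (\<Sum>l<m. (bs ! l \<bullet> x / (bs ! l \<bullet> bs ! l)) * (bs ! l \<bullet> bs ! i))"
      unfolding Px[OF x] using bc[OF i] by (rule comb_dot)
    also have "\<dots> = (\<Sum>l<m. if l = i then bs ! i \<bullet> x else 0)"
      using i bo bnz by (intro sum.cong) auto
    also have "\<dots> = bs ! i \<bullet> x" using i by simp
    finally show ?thesis
      using minus_scalar_prod_distrib[OF x Pc[OF x] bc[OF i]] comm_scalar_prod[OF x bc[OF i]] by simp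
  qed
  have fix_V: "P *\<^sub>v x = x" if x: "x \<in> V" for x
  proof (rule ccontr)
    assume ne: "P *\<^sub>v x \<noteq> x"
    have xc: "x \<in> carrier_vec d" using x carr by auto
    define z where "z = x - P *\<^sub>v x"
    have zc: "z \<in> carrier_vec d" unfolding z_def using xc P by auto
    have zV: "z \<in> V" using diff_mem[OF x PV[OF xc]] by (simp add: z_def)
    have "z \<noteq> 0\<^sub>v d"
    proof
      assume "z = 0\<^sub>v d"
      then have "\<And>i. i < d \<Longrightarrow> x $ i = (P *\<^sub>v x) $ i" 
        unfolding z_def using xc Pc[OF xc] 
        by (metis carrier_vecD eq_iff_diff_eq_0 index_minus_vec(1) index_zero_vec(1))
      then show False using ne xc Pc[OF xc] by (metis carrier_vecD eq_vecI)
    qed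
    then have zz: "z \<bullet> z \<noteq> 0"
      using zc self_scalar_prod_zero by blast
    have zb: "z \<bullet> bs ! i = 0" "bs ! i \<bullet> z = 0" if "i < m" for i
      using res[OF xc that] comm_scalar_prod[OF zc bc[OF that]] by (simp_all add: z_def)
    have "Q (bs @ [z])"
      unfolding Q_def
      using zb zz bo bnz bs zV by (auto simp: nth_append m_def less_Suc_eq Q_def)
    from max[OF this] show False by simp
  qed
  have "x - P *\<^sub>v x \<in> orth_compl" if x: "x \<in> carrier_vec d" for x
    unfolding orth_compl_iff
  proof (intro conjI ballI)
    show c: "x - P *\<^sub>v x \<in> carrier_vec d" using x Pc[OF x] by auto
    fix y assume y: "y \<in> V"
    then have yc: "y \<in> carrier_vec d" using carr by auto
    have "(x - P *\<^sub>v x) \<bullet> y = y \<bullet> (x - P *\<^sub>v x)" by (rule comm_scalar_prod[OF c yc])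
    \<comment> \<open>Replacing y by P y turns it into a combination of the family, and the residual
      of x is already known to be orthogonal to each member.\<close>
    also have "\<dots> = (P *\<^sub>v y) \<bullet> (x - P *\<^sub>v x)" using fix_V[OF y] by simp
    also have "\<dots> = (\<Sum>l<m. (bs ! l \<bullet> y / (bs ! l \<bullet> bs ! l)) * (bs ! l \<bullet> (x - P *\<^sub>v x)))"
      unfolding Px[OF yc] using c by (rule comb_dot)
    also have "\<dots> = 0"
      using res[OF x] comm_scalar_prod[OF c bc] by (intro sum.neutral) auto
    finally show "(x - P *\<^sub>v x) \<bullet> y = 0" .
  qed
  then show ?thesis using P PV by blast
qed


text \<open>The difference z of two candidate values lies in V. It is also a difference of two
  residuals, hence orthogonal to V, and so z is orthogonal to itself. Uniqueness is what unlocks the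
  definite description in \<open>orth_proj\<close>.\<close>

lemma orth_proj_unique:
  assumes P: "P \<in> carrier_mat d d"
      "\<And>x. x \<in> carrier_vec d \<Longrightarrow> P *\<^sub>v x \<in> V \<and> x - P *\<^sub>v x \<in> orth_compl"
    and Q: "Q \<in> carrier_mat d d"
      "\<And>x. x \<in> carrier_vec d \<Longrightarrow> Q *\<^sub>v x \<in> V \<and> x - Q *\<^sub>v x \<in> orth_compl"
  shows "P = Q"
proof -
  have "P *\<^sub>v x = Q *\<^sub>v x" if x: "x \<in> carrier_vec d" for x
  proof -
    have c: "P *\<^sub>v x \<in> carrier_vec d" "Q *\<^sub>v x \<in> carrier_vec d"
      using P(2)[OF x] Q(2)[OF x] carr by auto
    define z where "z = P *\<^sub>v x - Q *\<^sub>v x"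
    have zV: "z \<in> V" unfolding z_def using P(2)[OF x] Q(2)[OF x] by (simp add: diff_mem)
    then have zc: "z \<in> carrier_vec d" using carr by auto
    have telescope: "p - q = (x - q) - (x - p)"
      if "x \<in> carrier_vec d" "p \<in> carrier_vec d" "q \<in> carrier_vec d" for x p q :: "real vec"
      using that by (intro eq_vecI) auto
    have "z \<bullet> z = ((x - Q *\<^sub>v x) - (x - P *\<^sub>v x)) \<bullet> z"
      unfolding z_def by (rule arg_cong[where f = "\<lambda>y. y \<bullet> _"])
        (rule telescope[OF x c])
    also have "\<dots> = (x - Q *\<^sub>v x) \<bullet> z - (x - P *\<^sub>v x) \<bullet> z"
      using c x zc by (intro minus_scalar_prod_distrib) auto
    also have "\<dots> = 0" using P(2)[OF x] Q(2)[OF x] zV by (simp add: orth_compl_iff)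
    finally have "z = 0\<^sub>v d" using self_scalar_prod_zero[OF zc] by simp
    then have "\<And>i. i < d \<Longrightarrow> (P *\<^sub>v x) $ i = (Q *\<^sub>v x) $ i"
      unfolding z_def using c
      by (metis carrier_vecD eq_iff_diff_eq_0 index_minus_vec(1) index_zero_vec(1))
    then show ?thesis using c by (metis carrier_vecD eq_vecI)
  qed
  with P(1) Q(1) show ?thesis by (rule eq_mat_vecI)
qed

abbreviation P :: "real mat" where "P \<equiv> orth_proj d V"

lemma orth_proj:
  "P \<in> carrier_mat d d" "x \<in> carrier_vec d \<Longrightarrow> P *\<^sub>v x \<in> V"
  "x \<in> carrier_vec d \<Longrightarrow> x - P *\<^sub>v x \<in> orth_compl"
proof -
  have "\<exists>!Q. Q \<in> carrier_mat d d \<and>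
      (\<forall>x\<in>carrier_vec d. Q *\<^sub>v x \<in> V \<and> x - Q *\<^sub>v x \<in> orth_compl)"
    using ex_orth_proj orth_proj_unique by (auto intro!: ex_ex1I)
  from theI'[OF this, folded orth_proj_def]
  show "P \<in> carrier_mat d d" "x \<in> carrier_vec d \<Longrightarrow> P *\<^sub>v x \<in> V"
    "x \<in> carrier_vec d \<Longrightarrow> x - P *\<^sub>v x \<in> orth_compl" by auto
qed

lemma orth_proj_orth:
  assumes x: "x \<in> carrier_vec d" and y: "y \<in> V"
  shows "(P *\<^sub>v x) \<bullet> y = x \<bullet> y"
proof -
  have yc: "y \<in> carrier_vec d" using y carr by auto
  have "(x - P *\<^sub>v x) \<bullet> y = x \<bullet> y - (P *\<^sub>v x) \<bullet> y"
    using x yc orth_proj(1) by (intro minus_scalar_prod_distrib) auto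
  then show ?thesis using orth_proj(3)[OF x] y by (simp add: orth_compl_iff)
qed

lemma orth_proj_self_adjoint:
  assumes "x \<in> carrier_vec d" "y \<in> carrier_vec d"
  shows "(P *\<^sub>v x) \<bullet> y = x \<bullet> (P *\<^sub>v y)"
proof -
  have c: "P *\<^sub>v x \<in> carrier_vec d" "P *\<^sub>v y \<in> carrier_vec d" using orth_proj(1) assms by auto
  have "(P *\<^sub>v x) \<bullet> y = y \<bullet> (P *\<^sub>v x)" using comm_scalar_prod c assms by metis
  also have "\<dots> = (P *\<^sub>v y) \<bullet> (P *\<^sub>v x)" using orth_proj_orth assms orth_proj(2) by metis
  also have "\<dots> = (P *\<^sub>v x) \<bullet> (P *\<^sub>v y)" using comm_scalar_prod c by metis
  also have "\<dots> = x \<bullet> (P *\<^sub>v y)" using orth_proj_orth assms orth_proj(2) by metis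
  finally show ?thesis .
qed

lemma orth_proj_symmetric: "transpose_mat P = P"
proof (rule eq_matI)
  fix i j assume "i < dim_row P" "j < dim_col P"
  then have ij: "i < d" "j < d" using orth_proj(1) by auto
  have *: "P $$ (a,b) = unit_vec d a \<bullet> (P *\<^sub>v unit_vec d b)" if "a < d" "b < d" for a b
    using that orth_proj(1) by simp
  have "P $$ (j,i) = (P *\<^sub>v unit_vec d j) \<bullet> unit_vec d i"
    using *[of j i] orth_proj_self_adjoint[of "unit_vec d j" "unit_vec d i"] ij by simp
  also have "\<dots> = unit_vec d i \<bullet> (P *\<^sub>v unit_vec d j)"
    using orth_proj(1) by (intro comm_scalar_prod[of _ d]) auto
  also have "\<dots> = P $$ (i,j)" using *[of i j] ij by simp
  finally show "transpose_mat P $$ (i, j) = P $$ (i, j)"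
    using ij orth_proj(1) by simp
qed (use orth_proj(1) in auto)

lemma orth_proj_on_orth_compl:
  assumes "x \<in> orth_compl"
  shows "P *\<^sub>v x = 0\<^sub>v d"
proof -
  have x: "x \<in> carrier_vec d" using assms by (simp add: orth_compl_iff)
  have "(P *\<^sub>v x) \<bullet> (P *\<^sub>v x) = 0"
    using orth_proj_orth[OF x orth_proj(2)[OF x]] assms orth_proj(2)[OF x] by (simp add: orth_compl_iff)
  then show ?thesis using self_scalar_prod_zero orth_proj(1) x by (metis mult_mat_vec_carrier)
qed

lemma orth_proj_fixes:
  assumes "x \<in> V"
  shows "P *\<^sub>v x = x"
proof -
  have x: "x \<in> carrier_vec d" using assms carr by auto
  have c: "P *\<^sub>v x \<in> carrier_vec d" using orth_proj(1) x by auto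
  have "x - P *\<^sub>v x \<in> V" using diff_mem[OF assms orth_proj(2)[OF x]] .
  then have "x - P *\<^sub>v x = 0\<^sub>v d"
    using orth_proj(3)[OF x] self_scalar_prod_zero[of "x - P *\<^sub>v x" d] by (auto simp: orth_compl_iff)
  then have "\<And>i. i < d \<Longrightarrow> (P *\<^sub>v x) $ i = x $ i"
    using c x by (metis carrier_vecD eq_iff_diff_eq_0 index_minus_vec(1) index_zero_vec(1))
  then show ?thesis using c x by (metis carrier_vecD eq_vecI)
qed

lemma orth_proj_idem: "P * P = P"
proof (rule eq_mat_vecI[of _ d d])
  fix x :: "real vec" assume x: "x \<in> carrier_vec d"
  show "(P * P) *\<^sub>v x = P *\<^sub>v x"
    using orth_proj(1) x orth_proj_fixes[OF orth_proj(2)[OF x]]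
    by (simp add: assoc_mult_mat_vec[of _ d d _ d])
qed (use orth_proj(1) in auto)

lemma mem_if_orth_proj_fixes: "x \<in> carrier_vec d \<Longrightarrow> P *\<^sub>v x = x \<Longrightarrow> x \<in> V"
  using orth_proj(2) by metis

end

section \<open>Digit products and the row orbit space\<close>

text \<open>Grouping by prefixes: with c a power of k, the number c * n + m is the word n followed
  by the digits of m, padded with zeros.\<close>

lemma sum_blocks:
  fixes f :: "nat \<Rightarrow> 'a :: comm_monoid_add"
  assumes "a \<le> b"
  shows "(\<Sum>m = a * c..<b * c. f m) = (\<Sum>n = a..<b. \<Sum>m<c. f (c * n + m))"
  using assms
proof (induction b rule: dec_induct)
  case (step b)
  have "(\<Sum>m = a * c..<Suc b * c. f m) = (\<Sum>m = a * c..<b * c. f m) + (\<Sum>m = b * c..<Suc b * c. f m)"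
    using step by (intro sum.atLeastLessThan_concat[symmetric]) auto
  also have "(\<Sum>m = b * c..<Suc b * c. f m) = (\<Sum>m<c. f (c * b + m))"
    using sum.shift_bounds_nat_ivl[of f 0 "b * c" c] by (simp add: add_ac mult_ac atLeast0LessThan)
  finally show ?case using step by simp
qed simp

text \<open>No right vector is fixed: the same left data are paired with several right vectors. The
  locale is used for the given representation and again for the enlarged one.\<close>

locale matrix_family =
  fixes k d :: nat and u :: "real vec" and A :: "nat \<Rightarrow> real mat"
  assumes k2: "k \<ge> 2" and u: "u \<in> carrier_vec d"
    and A: "j < k \<Longrightarrow> A j \<in> carrier_mat d d"
begin

abbreviation "D \<equiv> digit_prod k d A"
abbreviation "V \<equiv> row_orbit_space k d u A"
abbreviation "T \<equiv> mat_total k d A"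
abbreviation "C \<equiv> compressed k d u A"

lemmas assoc_mat = assoc_mult_mat[of _ d d _ d _ d]
lemmas assoc_mat_vec = assoc_mult_mat_vec[of _ d d _ d]

lemma digit_prod_carrier [simp]: "D n \<in> carrier_mat d d"
proof (induction n rule: less_induct)
  case (less n)
  show ?case
  proof (cases "n = 0")
    case False
    then have "D (n div k) \<in> carrier_mat d d" using less k2 by simp
    then show ?thesis
      using A[of "n mod k"] k2 by (subst digit_prod.simps) auto
  qed (simp add: digit_prod.simps)
qed

lemma digit_prod_digit:
  assumes "0 < j" "j < k"
  shows "D j = A j"
  using assms k2 A[of j] by (subst digit_prod.simps) (simp add: digit_prod.simps[of _ _ _ 0])

lemma digit_prod_append:
  assumes "n \<ge> 1" "j < k"
  shows "D (k * n + j) = D n * A j"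
  using assms k2 by (subst digit_prod.simps) auto

lemma total_carrier [simp]: "T \<in> carrier_mat d d"
  by (simp add: mat_total_def)

lemma scalar_prod_total:
  assumes z: "z \<in> carrier_vec d" and x: "x \<in> carrier_vec d"
  shows "z \<bullet> (T *\<^sub>v x) = (\<Sum>j<k. z \<bullet> (A j *\<^sub>v x))"
proof -
  have 1: "(T *\<^sub>v x) $ i = (\<Sum>j<k. (A j *\<^sub>v x) $ i)" if i: "i < d" for i
  proof -
    have "(T *\<^sub>v x) $ i = (\<Sum>l=0..<d. \<Sum>j<k. A j $$ (i, l) * x $ l)"
      using i x by (simp add: mat_total_def scalar_prod_def sum_distrib_right)
    also have "\<dots> = (\<Sum>j<k. \<Sum>l=0..<d. A j $$ (i, l) * x $ l)" by (rule sum.swap)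
    also have "\<dots> = (\<Sum>j<k. (A j *\<^sub>v x) $ i)"
    proof (intro sum.cong refl)
      fix j assume "j \<in> {..<k}"
      then have "A j \<in> carrier_mat d d" using A by simp
      then show "(\<Sum>l=0..<d. A j $$ (i, l) * x $ l) = (A j *\<^sub>v x) $ i"
        using i x by (simp add: scalar_prod_def)
    qed
    finally show ?thesis .
  qed
  have "z \<bullet> (T *\<^sub>v x) = (\<Sum>i=0..<d. \<Sum>j<k. z $ i * (A j *\<^sub>v x) $ i)"
    using 1 by (simp add: scalar_prod_def[of z] sum_distrib_left mat_total_def del: index_mult_mat_vec)
  also have "\<dots> = (\<Sum>j<k. \<Sum>i=0..<d. z $ i * (A j *\<^sub>v x) $ i)" by (rule sum.swap)
  also have "\<dots> = (\<Sum>j<k. z \<bullet> (A j *\<^sub>v x))"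
  proof (intro sum.cong refl)
    fix j assume "j \<in> {..<k}"
    then have "A j \<in> carrier_mat d d" using A by simp
    then show "(\<Sum>i=0..<d. z $ i * (A j *\<^sub>v x) $ i) = z \<bullet> (A j *\<^sub>v x)"
      by (simp add: scalar_prod_def[of z] del: index_mult_mat_vec)
  qed
  finally show ?thesis .
qed

text \<open>A leading digit is never 0, so this difference is the sum over all possible leading
  digits; it explains the matrix in the nondegeneracy condition.\<close>

lemma scalar_prod_total_minus:
  assumes z: "z \<in> carrier_vec d" and x: "x \<in> carrier_vec d"
  shows "z \<bullet> ((T - A 0) *\<^sub>v x) = (\<Sum>j = 1..<k. z \<bullet> (A j *\<^sub>v x))"
proof -
  have A0: "A 0 \<in> carrier_mat d d" using A k2 by auto
  have "z \<bullet> ((T - A 0) *\<^sub>v x) = z \<bullet> (T *\<^sub>v x) - z \<bullet> (A 0 *\<^sub>v x)"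
    using A0 x z by (simp add: minus_mult_distrib_mat_vec[of _ d d] scalar_prod_minus_distrib[of _ d]
        mult_mat_vec_carrier[of _ d d])
  also have "\<dots> = (\<Sum>j = 1..<k. z \<bullet> (A j *\<^sub>v x))"
    unfolding scalar_prod_total[OF z x] lessThan_atLeast0
    using k2 by (subst sum.atLeast_Suc_lessThan) auto
  finally show ?thesis .
qed

lemma scalar_prod_digit_prod_append:
  assumes "n \<ge> 1" "j < k" "z \<in> carrier_vec d" "x \<in> carrier_vec d"
  shows "z \<bullet> (D (k * n + j) *\<^sub>v x) = z \<bullet> (D n *\<^sub>v (A j *\<^sub>v x))"
  using assms A by (simp add: digit_prod_append assoc_mat_vec)

text \<open>Summing over the last digit replaces its matrix by \<open>T\<close>. The induction
  removes the last digit and moves \<open>T\<close> onto the right vector, which is why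
  \<open>x\<close> is arbitrary.\<close>

lemma sum_digit_prod_block:
  assumes "n \<ge> 1" "x \<in> carrier_vec d"
  shows "(\<Sum>m<k ^ N. u \<bullet> (D (k ^ N * n + m) *\<^sub>v x)) = u \<bullet> (D n *\<^sub>v ((T ^\<^sub>m N) *\<^sub>v x))"
  using assms(2)
proof (induction N arbitrary: x)
  case (Suc N)
  have uD: "u \<bullet> (D l *\<^sub>v y) = (transpose_mat (D l) *\<^sub>v u) \<bullet> y" if "y \<in> carrier_vec d" for l y
    using scalar_prod_mult_mat_vec[of "D l" d d u y] u that by simp
  have "{..<k ^ Suc N} = {0 * k..<k ^ N * k}" by (auto simp: mult.commute)
  then have "(\<Sum>m<k ^ Suc N. u \<bullet> (D (k ^ Suc N * n + m) *\<^sub>v x)) =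
      (\<Sum>m = 0..<k ^ N. \<Sum>j<k. u \<bullet> (D (k ^ Suc N * n + (k * m + j)) *\<^sub>v x))"
    by (simp only: sum_blocks[OF le0])
  also have "\<dots> = (\<Sum>m = 0..<k ^ N. \<Sum>j<k. u \<bullet> (D (k ^ N * n + m) *\<^sub>v (A j *\<^sub>v x)))"
  proof (intro sum.cong refl)
    fix m j assume "j \<in> {..<k}"
    moreover have "1 \<le> k ^ N * n + m" using k2 assms(1) by (simp add: Suc_le_eq)
    ultimately have "u \<bullet> (D (k * (k ^ N * n + m) + j) *\<^sub>v x) = u \<bullet> (D (k ^ N * n + m) *\<^sub>v (A j *\<^sub>v x))"
      using Suc.prems u by (intro scalar_prod_digit_prod_append) auto
    then show "u \<bullet> (D (k ^ Suc N * n + (k * m + j)) *\<^sub>v x) = u \<bullet> (D (k ^ N * n + m) *\<^sub>v (A j *\<^sub>v x))"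
      by (simp add: algebra_simps)
  qed
  also have "\<dots> = (\<Sum>m = 0..<k ^ N. u \<bullet> (D (k ^ N * n + m) *\<^sub>v (T *\<^sub>v x)))"
  proof (intro sum.cong refl)
    fix m
    have "(\<Sum>j<k. u \<bullet> (D (k ^ N * n + m) *\<^sub>v (A j *\<^sub>v x))) =
        (\<Sum>j<k. (transpose_mat (D (k ^ N * n + m)) *\<^sub>v u) \<bullet> (A j *\<^sub>v x))"
      using uD A Suc.prems by (intro sum.cong) (auto intro!: uD mult_mat_vec_carrier)
    also have "\<dots> = (transpose_mat (D (k ^ N * n + m)) *\<^sub>v u) \<bullet> (T *\<^sub>v x)"
      using Suc.prems u
      by (intro scalar_prod_total[symmetric]) (auto intro!: mult_mat_vec_carrier[of _ d d])
    also have "\<dots> = u \<bullet> (D (k ^ N * n + m) *\<^sub>v (T *\<^sub>v x))"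
      using Suc.prems by (intro uD[symmetric]) (auto intro!: mult_mat_vec_carrier[of _ d d])
    finally show "(\<Sum>j<k. u \<bullet> (D (k ^ N * n + m) *\<^sub>v (A j *\<^sub>v x))) =
      u \<bullet> (D (k ^ N * n + m) *\<^sub>v (T *\<^sub>v x))" .
  qed
  also have "\<dots> = u \<bullet> (D n *\<^sub>v ((T ^\<^sub>m N) *\<^sub>v (T *\<^sub>v x)))"
    using Suc.IH[of "T *\<^sub>v x"] Suc.prems mult_mat_vec_carrier[of T d d x]
    by (simp add: atLeast0LessThan)
  also have "(T ^\<^sub>m N) *\<^sub>v (T *\<^sub>v x) = (T ^\<^sub>m Suc N) *\<^sub>v x"
    using Suc.prems by (simp add: assoc_mat_vec)
  finally show ?case .
qed (use u in \<open>simp add: mat_total_def\<close>)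

lemma orbit_generators:
  "{transpose_mat (D n) *\<^sub>v u | n. n \<ge> 1} \<subseteq> carrier_vec d"
  using u by (auto intro!: mult_mat_vec_carrier[of _ d d])

lemma row_orbit_mem: "n \<ge> 1 \<Longrightarrow> transpose_mat (D n) *\<^sub>v u \<in> V"
proof -
  interpret vs: vec_space "TYPE(real)" d .
  show "n \<ge> 1 \<Longrightarrow> transpose_mat (D n) *\<^sub>v u \<in> V"
    unfolding row_orbit_space_def using vs.in_own_span[OF orbit_generators] by auto
qed

lemma vec_subspace_row_orbit: "vec_subspace d V"
proof -
  interpret vs: vec_space "TYPE(real)" d .
  note G = orbit_generators
  show ?thesis
    unfolding row_orbit_space_def
  proof
    show "vs.span {transpose_mat (D n) *\<^sub>v u |n. 1 \<le> n} \<subseteq> carrier_vec d"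
      using vs.span_is_subset2[OF G] by simp
    show "0\<^sub>v d \<in> vs.span {transpose_mat (D n) *\<^sub>v u |n. 1 \<le> n}"
      using vs.span_zero by simp
  qed (use vs.span_add1[OF G] vs.smult_in_span[OF G] in auto)
qed

sublocale V: vec_subspace d V by (rule vec_subspace_row_orbit)

lemma row_orbit_subset:
  assumes "vec_subspace d S" and "\<And>n. n \<ge> 1 \<Longrightarrow> transpose_mat (D n) *\<^sub>v u \<in> S"
  shows "V \<subseteq> S"
proof -
  interpret vs: vec_space "TYPE(real)" d .
  interpret S: vec_subspace d S by fact
  have "submodule class_ring S (module_vec TYPE(real) d)"
    using S.carr S.zero_mem S.add_mem S.smult_mem vs.module_axioms
    by (auto simp: submodule_def module_vec_simps)
  then show ?thesis
    unfolding row_orbit_space_def using assms(2) by (intro vs.span_is_subset) auto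
qed

text \<open>Appending the digit j to n >= 1 leads from one generator to another, so the generators,
  and with them their span, are stable.\<close>

lemma row_orbit_invariant:
  assumes j: "j < k" and x: "x \<in> V"
  shows "transpose_mat (A j) *\<^sub>v x \<in> V"
proof -
  have Aj: "transpose_mat (A j) \<in> carrier_mat d d" using A[OF j] by simp
  have Aj0: "transpose_mat (A j) *\<^sub>v 0\<^sub>v d = 0\<^sub>v d" using A[OF j] by (intro eq_vecI) auto
  have "vec_subspace d {x \<in> carrier_vec d. transpose_mat (A j) *\<^sub>v x \<in> V}"
    using Aj Aj0 V.zero_mem V.add_mem V.smult_mem
    by unfold_locales (auto simp: mult_add_distrib_mat_vec[of _ d d] mult_mat_vec[of _ d d])
  moreover have "transpose_mat (D n) *\<^sub>v u \<in> {x \<in> carrier_vec d. transpose_mat (A j) *\<^sub>v x \<in> V}"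
    if "n \<ge> 1" for n
  proof -
    have "transpose_mat (A j) *\<^sub>v (transpose_mat (D n) *\<^sub>v u) = transpose_mat (D (k * n + j)) *\<^sub>v u"
      using that j A[OF j] u
      by (simp add: digit_prod_append transpose_mult[of _ d d _ d] assoc_mat_vec)
    moreover have "1 \<le> k * n + j" using that k2 by (simp add: Suc_le_eq)
    ultimately show ?thesis
      using row_orbit_mem[of "k * n + j"] row_orbit_mem[of n] V.carr that k2 by auto
  qed
  ultimately show ?thesis using row_orbit_subset x by blast
qed

lemma scalar_prod_digit_orth_proj:
  assumes "j < k" "z \<in> V" "x \<in> carrier_vec d"
  shows "z \<bullet> (A j *\<^sub>v (V.P *\<^sub>v x)) = z \<bullet> (A j *\<^sub>v x)"
proof -
  note c = V.orth_proj(1) A[OF assms(1)]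
  have zc: "z \<in> carrier_vec d" using assms V.carr by auto
  have "z \<bullet> (A j *\<^sub>v (V.P *\<^sub>v x)) = (transpose_mat (A j) *\<^sub>v z) \<bullet> (V.P *\<^sub>v x)"
    using c assms zc by (intro scalar_prod_mult_mat_vec) (auto intro!: mult_mat_vec_carrier[of _ d d])
  also have "\<dots> = (V.P *\<^sub>v (transpose_mat (A j) *\<^sub>v z)) \<bullet> x"
    using c assms zc
    by (intro V.orth_proj_self_adjoint[symmetric]) (auto intro!: mult_mat_vec_carrier[of _ d d])
  also have "\<dots> = (transpose_mat (A j) *\<^sub>v z) \<bullet> x"
    using V.orth_proj_fixes[OF row_orbit_invariant[OF assms(1,2)]] by simp
  also have "\<dots> = z \<bullet> (A j *\<^sub>v x)"
    using c assms zc by (intro scalar_prod_mult_mat_vec[symmetric]) auto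
  finally show ?thesis .
qed

text \<open>Row vectors of V remain in V after multiplication by \<open>T\<close>, so a projection
  to the right of \<open>T\<close> changes nothing once there is one on its left. The compressed
  matrix is therefore just \<open>V.P * T\<close>.\<close>

lemma orth_proj_absorb_total: "V.P * T * V.P = V.P * T"
proof (rule eq_matI)
  note c = V.orth_proj(1) total_carrier
  fix i l assume "i < dim_row (V.P * T)" "l < dim_col (V.P * T)"
  then have il: "i < d" "l < d" using c by auto
  define z where "z = V.P *\<^sub>v unit_vec d i"
  define x where "x = (unit_vec d l :: real vec)"
  have z: "z \<in> V" "z \<in> carrier_vec d" using V.orth_proj(2) V.carr by (auto simp: z_def)
  have x: "x \<in> carrier_vec d" by (simp add: x_def)
  have entry: "N $$ (i,l) = unit_vec d i \<bullet> (N *\<^sub>v x)" if "N \<in> carrier_mat d d" for N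
    using that il by (simp add: x_def)
  have *: "(V.P * M) $$ (i,l) = z \<bullet> (M *\<^sub>v x)" if "M \<in> carrier_mat d d" for M
  proof -
    have "(V.P * M) $$ (i,l) = unit_vec d i \<bullet> ((V.P * M) *\<^sub>v x)"
      using that c by (intro entry) auto
    also have "\<dots> = z \<bullet> (M *\<^sub>v x)"
      unfolding z_def using that c x
      by (simp add: V.orth_proj_self_adjoint assoc_mat_vec mult_mat_vec_carrier[of _ d d])
    finally show ?thesis .
  qed
  have "(V.P * T * V.P) $$ (i,l) = z \<bullet> (T *\<^sub>v (V.P *\<^sub>v x))"
    using *[of "T * V.P"] c x by (simp add: assoc_mat assoc_mat_vec)
  also have "\<dots> = z \<bullet> (T *\<^sub>v x)"
    using scalar_prod_total[OF z(2)] x z c scalar_prod_digit_orth_proj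
    by (simp add: mult_mat_vec_carrier[of _ d d])
  also have "\<dots> = (V.P * T) $$ (i,l)" using *[of T] by simp
  finally show "(V.P * T * V.P) $$ (i, l) = (V.P * T) $$ (i, l)" .
qed (use V.orth_proj(1) in \<open>auto simp: mat_total_def\<close>)

lemma compressed_eq: "C = V.P * T"
  by (simp add: compressed_def Let_def orth_proj_absorb_total)

lemma compressed_carrier [simp]: "C \<in> carrier_mat d d"
  using V.orth_proj(1) by (simp add: compressed_eq)

lemma orth_proj_compressed: "V.P * C = C"
  using V.orth_proj(1)
  by (simp add: compressed_eq V.orth_proj_idem flip: assoc_mat)

lemma compressed_orth_proj: "C * V.P = C"
  by (simp add: compressed_eq orth_proj_absorb_total)

text \<open>The exponent is positive because at 0 the left side is the projection and the right side
  the identity. This identity replaces powers of \<open>T\<close> by powers of \<open>C\<close>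
  behind row vectors of V.\<close>

lemma orth_proj_total_pow: "V.P * T ^\<^sub>m Suc N = C ^\<^sub>m Suc N"
proof (induction N)
  case 0
  show ?case using V.orth_proj(1) by (simp add: compressed_eq mat_total_def)
next
  case (Suc N)
  have Tp: "T ^\<^sub>m n \<in> carrier_mat d d" "C ^\<^sub>m n \<in> carrier_mat d d" for n by auto
  note c = V.orth_proj(1) Tp[of "Suc N"] Tp[of N] total_carrier compressed_carrier
  have "V.P * T ^\<^sub>m Suc (Suc N) = (V.P * T ^\<^sub>m Suc N) * T"
    using c by (simp add: assoc_mat del: pow_mat.simps(2) add: pow_mat.simps(2)[of _ "Suc N"])
  also have "\<dots> = C ^\<^sub>m N * (C * V.P) * T"
    unfolding Suc compressed_orth_proj by simp
  also have "\<dots> = C ^\<^sub>m N * (C * V.P * T)"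
    by (rule assoc_mat) (use c in \<open>auto intro!: mult_carrier_mat[of _ d d]\<close>)
  also have "C * V.P * T = C * (V.P * T)"
    by (rule assoc_mat) (use c in \<open>auto intro!: mult_carrier_mat[of _ d d]\<close>)
  also have "C ^\<^sub>m N * (C * (V.P * T)) = C ^\<^sub>m N * C * (V.P * T)"
    by (rule assoc_mat[symmetric]) (use c in \<open>auto intro!: mult_carrier_mat[of _ d d]\<close>)
  also have "\<dots> = C ^\<^sub>m Suc (Suc N)"
    unfolding compressed_eq[symmetric] by simp
  finally show ?case .
qed

lemma scalar_prod_total_pow:
  assumes "z \<in> V" "x \<in> carrier_vec d" "N \<ge> 1"
  shows "z \<bullet> ((T ^\<^sub>m N) *\<^sub>v x) = z \<bullet> ((C ^\<^sub>m N) *\<^sub>v x)"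
proof -
  obtain M where N: "N = Suc M" using assms(3) by (cases N) auto
  have zc: "z \<in> carrier_vec d" using assms V.carr by auto
  have Tp: "T ^\<^sub>m N \<in> carrier_mat d d" "C ^\<^sub>m N \<in> carrier_mat d d" by auto
  have "z \<bullet> ((T ^\<^sub>m N) *\<^sub>v x) = (V.P *\<^sub>v z) \<bullet> ((T ^\<^sub>m N) *\<^sub>v x)"
    using V.orth_proj_fixes assms(1) by simp
  also have "\<dots> = z \<bullet> (V.P *\<^sub>v ((T ^\<^sub>m N) *\<^sub>v x))"
    using zc assms(2) Tp by (intro V.orth_proj_self_adjoint) (auto intro!: mult_mat_vec_carrier[of _ d d])
  also have "V.P *\<^sub>v ((T ^\<^sub>m N) *\<^sub>v x) = (V.P * (T ^\<^sub>m N)) *\<^sub>v x"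
    using V.orth_proj(1) assms(2) Tp by (simp add: assoc_mat_vec)
  finally show ?thesis unfolding N orth_proj_total_pow .
qed

end

section \<open>Functions of a matrix in Jordan normal form\<close>

lemma jordan_matrix_pow_Cons:
  "jordan_matrix ((n, a) # n_as) ^\<^sub>m m = four_block_mat
     (jordan_block n a ^\<^sub>m m) (0\<^sub>m n (sum_list (map fst n_as)))
     (0\<^sub>m (sum_list (map fst n_as)) n) (jordan_matrix n_as ^\<^sub>m m)"
proof -
  have "dim_row (jordan_matrix n_as ^\<^sub>m m) = sum_list (map fst n_as)"
    "dim_col (jordan_matrix n_as ^\<^sub>m m) = sum_list (map fst n_as)"
    using carrier_matD[OF pow_carrier_mat[OF jordan_matrix_carrier[of n_as], of m]] by blast+
  then show ?thesis
    by (simp add: jordan_matrix_pow Let_def)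
qed

text \<open>The witnesses do not depend on the exponent, so each entry is one explicit function of
  \<open>m\<close> whose asymptotics can be read off. The bound \<open>t < N\<close> ties its
  polynomial growth to the size of a block.\<close>

lemma jordan_matrix_pow_entry:
  fixes n_as :: "(nat \<times> 'a :: comm_ring_1) list"
  assumes "i < sum_list (map fst n_as)" "j < sum_list (map fst n_as)"
  shows "(\<exists>N z t. (N, z) \<in> set n_as \<and> t < N \<and> jordan_matrix n_as $$ (i,i) = z \<and> jordan_matrix n_as $$ (j,j) = z \<and>
      (\<forall>m. (jordan_matrix n_as ^\<^sub>m m) $$ (i,j) = of_nat (m choose t) * z ^ (m - t))) \<or>
    (\<forall>m. (jordan_matrix n_as ^\<^sub>m m) $$ (i,j) = 0)"
  using assms
proof (induction n_as arbitrary: i j)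
  case (Cons na n_as)
  obtain n a where na: "na = (n, a)" by force
  let ?s = "sum_list (map fst n_as)"
  let ?J = "jordan_matrix (na # n_as)" and ?J' = "jordan_matrix n_as"
  note dims = carrier_matD[OF pow_carrier_mat[OF jordan_matrix_carrier[of n_as]]]
  have entry: "(?J ^\<^sub>m m) $$ (p, q) =
      (if p < n then if q < n then (jordan_block n a ^\<^sub>m m) $$ (p, q) else 0
       else if q < n then 0 else (?J' ^\<^sub>m m) $$ (p - n, q - n))"
    if "p < n + ?s" "q < n + ?s" for p q m
    unfolding na jordan_matrix_pow_Cons using that dims by auto
  have entry1: "?J $$ (p, p) = (if p < n then a else ?J' $$ (p - n, p - n))" if "p < n + ?s" for p
    using entry[OF that that, of 1] that by auto
  have ij: "i < n + ?s" "j < n + ?s" using Cons.prems by (auto simp: na)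
  consider "i < n" "j < n" | "i < n" "\<not> j < n" | "\<not> i < n" "j < n" | "\<not> i < n" "\<not> j < n" by blast
  then show ?case
  proof cases
    case 1
    show ?thesis
    proof (cases "i \<le> j")
      case True
      have "m + i - j = m - (j - i)" for m using True by auto
      then have "\<forall>m. (?J ^\<^sub>m m) $$ (i,j) = of_nat (m choose (j - i)) * a ^ (m - (j - i))"
        using 1 entry[OF ij] True by (simp add: jordan_block_pow)
      moreover have "j - i < n" using 1 by auto
      moreover have "?J $$ (i,i) = a" "?J $$ (j,j) = a" using entry1 ij 1 by auto
      moreover have "(n, a) \<in> set (na # n_as)" by (simp add: na)
      ultimately show ?thesis by blast
    next
      case False
      then have "(?J ^\<^sub>m m) $$ (i,j) = 0" for m using 1 entry[OF ij] by (simp add: jordan_block_pow)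
      then show ?thesis by blast
    qed
  next
    case 4
    then have "i - n < ?s" "j - n < ?s" using ij by auto
    note IH = Cons.IH[OF this]
    have e: "(?J ^\<^sub>m m) $$ (i, j) = (?J' ^\<^sub>m m) $$ (i - n, j - n)"
      "?J $$ (i,i) = ?J' $$ (i - n, i - n)" "?J $$ (j,j) = ?J' $$ (j - n, j - n)" for m
      using entry[OF ij] entry1[OF ij(1)] entry1[OF ij(2)] 4 by auto
    have "set n_as \<subseteq> set (na # n_as)" by auto
    then show ?thesis unfolding e using IH by blast
  next
    case 2
    then have "(?J ^\<^sub>m m) $$ (i,j) = 0" for m using entry[OF ij] by simp
    then show ?thesis by blast
  next
    case 3
    then have "(?J ^\<^sub>m m) $$ (i,j) = 0" for m using entry[OF ij] by simp
    then show ?thesis by blast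
  qed
qed simp

text \<open>The case of exponent 1. It says that J only links positions with equal diagonal entries,
  which makes every function of the diagonal commute with J.\<close>

lemma jordan_matrix_nonzero_entry:
  fixes n_as :: "(nat \<times> 'a :: comm_ring_1) list"
  assumes "i < sum_list (map fst n_as)" "j < sum_list (map fst n_as)"
    and "jordan_matrix n_as $$ (i,j) \<noteq> 0"
  shows "jordan_matrix n_as $$ (i,i) = jordan_matrix n_as $$ (j,j)"
proof -
  have nz: "(jordan_matrix n_as ^\<^sub>m 1) $$ (i,j) \<noteq> 0" using assms(3) by simp
  from jordan_matrix_pow_entry[OF assms(1,2)] show ?thesis
  proof (elim disjE exE conjE)
    fix z assume "jordan_matrix n_as $$ (i,i) = z" "jordan_matrix n_as $$ (j,j) = z"
    then show ?thesis by (simp only:)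
  next
    assume "\<forall>m. (jordan_matrix n_as ^\<^sub>m m) $$ (i,j) = 0"
    then show ?thesis using nz by blast
  qed
qed

text \<open>Subtracting z shifts the eigenvalue of each block and keeps the block sizes, so the
  formula for powers of Jordan matrices also describes powers of J - z.\<close>

lemma char_matrix_jordan_matrix:
  fixes n_as :: "(nat \<times> 'a :: field) list"
  shows "char_matrix (jordan_matrix n_as) z = jordan_matrix (map (\<lambda>(n, a). (n, a - z)) n_as)"
proof (induction n_as)
  case Nil
  show ?case by (rule eq_matI) (auto simp: char_matrix_def)
next
  case (Cons na n_as)
  obtain n a where na: "na = (n, a)" by force
  have s: "sum_list (map fst (map (\<lambda>(n, a). (n, a - z)) n_as)) = sum_list (map fst n_as)"
    by (intro arg_cong[where f = sum_list]) auto
  let ?s = "sum_list (map fst n_as)"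
  have dims: "dim_row (jordan_matrix (map (\<lambda>(n, a). (n, a - z)) n_as)) = ?s"
    "dim_col (jordan_matrix (map (\<lambda>(n, a). (n, a - z)) n_as)) = ?s" using s by simp_all
  show ?case
  proof (rule eq_matI)
    fix i j assume "i < dim_row (jordan_matrix (map (\<lambda>(n, a). (n, a - z)) (na # n_as)))"
      "j < dim_col (jordan_matrix (map (\<lambda>(n, a). (n, a - z)) (na # n_as)))"
    then have ij: "i < n + ?s" "j < n + ?s" using s by (auto simp: na)
    have IH: "jordan_matrix (map (\<lambda>(n, a). (n, a - z)) n_as) $$ (p,q) =
        jordan_matrix n_as $$ (p,q) + (if p = q then - z else 0)" if "p < ?s" "q < ?s" for p q
      unfolding Cons.IH[symmetric] using that by (simp add: char_matrix_def)
    have 1: "jordan_matrix (map (\<lambda>(n, a). (n, a - z)) (na # n_as)) =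
      four_block_mat (jordan_block n (a - z)) (0\<^sub>m n ?s) (0\<^sub>m ?s n)
        (jordan_matrix (map (\<lambda>(n, a). (n, a - z)) n_as))"
      using jordan_matrix_Cons[of n "a - z" "map (\<lambda>(n, a). (n, a - z)) n_as"] s
      by (simp add: na)
    have "i - n < ?s" if "\<not> i < n" using ij that by auto
    moreover have "j - n < ?s" if "\<not> j < n" using ij that by auto
    ultimately show "char_matrix (jordan_matrix (na # n_as)) z $$ (i, j) =
        jordan_matrix (map (\<lambda>(n, a). (n, a - z)) (na # n_as)) $$ (i, j)"
      unfolding 1 unfolding char_matrix_def na jordan_matrix_Cons
      using ij dims by (auto simp: IH)
  qed (use s in \<open>auto simp: na char_matrix_def\<close>)
qed

section \<open>Functions of the semisimple part of a matrix\<close>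

locale jordan_witness =
  fixes d :: nat and M S S' :: "complex mat" and n_as :: "(nat \<times> complex) list"
  assumes M: "M \<in> carrier_mat d d"
    and wit: "similar_mat_wit M (jordan_matrix n_as) S S'"
begin

abbreviation "J \<equiv> jordan_matrix n_as"

lemmas carriers [simp] = similar_mat_witD2(5-7)[OF M wit] M
lemmas inverse_mat = similar_mat_witD2(1,2)[OF M wit]

lemma sum_blocks_eq: "sum_list (map fst n_as) = d"
  by (metis carriers(1) carrier_matD(1) jordan_matrix_dim(1))

lemmas dims [simp] = carriers[THEN carrier_matD(1)] carriers[THEN carrier_matD(2)]

definition diag_fun :: "(complex \<Rightarrow> complex) \<Rightarrow> complex mat" where
  "diag_fun h = mat d d (\<lambda>(i,j). if i = j then h (J $$ (i,i)) else 0)"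

text \<open>The function is applied to the eigenvalues alone and the nilpotent part is dropped. Thus
  this is not the holomorphic functional calculus but the matrix that acts on the generalised
  eigenspace for z as the scalar \<open>h z\<close>; a rotation is exactly of this type.\<close>

definition spectral_fun :: "(complex \<Rightarrow> complex) \<Rightarrow> complex mat" where
  "spectral_fun h = S * diag_fun h * S'"

lemma diag_fun_carrier [simp]: "diag_fun h \<in> carrier_mat d d"
  by (simp add: diag_fun_def)

lemma spectral_fun_carrier [simp]: "spectral_fun h \<in> carrier_mat d d"
  unfolding spectral_fun_def by (auto intro!: mult_carrier_mat[of _ d d])

lemma diag_fun_mult_entry:
  assumes "X \<in> carrier_mat d d" "i < d" "j < d"
  shows "(diag_fun h * X) $$ (i,j) = h (J $$ (i,i)) * X $$ (i,j)"
    and "(X * diag_fun h) $$ (i,j) = X $$ (i,j) * h (J $$ (j,j))"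
proof -
  have "(diag_fun h * X) $$ (i,j) = (\<Sum>l=0..<d. (if i = l then h (J $$ (i,i)) else 0) * X $$ (l,j))"
    using assms by (simp add: scalar_prod_def diag_fun_def)
  also have "\<dots> = (\<Sum>l=0..<d. if i = l then h (J $$ (i,i)) * X $$ (l,j) else 0)"
    by (intro sum.cong) auto
  finally show "(diag_fun h * X) $$ (i,j) = h (J $$ (i,i)) * X $$ (i,j)" using assms by simp
  have "(X * diag_fun h) $$ (i,j) = (\<Sum>l=0..<d. X $$ (i,l) * (if l = j then h (J $$ (l,l)) else 0))"
    using assms by (simp add: scalar_prod_def diag_fun_def)
  also have "\<dots> = (\<Sum>l=0..<d. if l = j then X $$ (i,l) * h (J $$ (l,l)) else 0)"
    by (intro sum.cong) auto
  finally show "(X * diag_fun h) $$ (i,j) = X $$ (i,j) * h (J $$ (j,j))" using assms by simp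
qed

lemma diag_fun_mult: "diag_fun f * diag_fun h = diag_fun (\<lambda>z. f z * h z)"
proof (rule eq_matI)
  fix i j assume "i < dim_row (diag_fun (\<lambda>z. f z * h z))" "j < dim_col (diag_fun (\<lambda>z. f z * h z))"
  then have "i < d" "j < d" by (auto simp: diag_fun_def)
  then show "(diag_fun f * diag_fun h) $$ (i, j) = diag_fun (\<lambda>z. f z * h z) $$ (i, j)"
    by (subst diag_fun_mult_entry(1)) (auto simp: diag_fun_def)
qed (auto simp: diag_fun_def)

lemma diag_fun_commute: "diag_fun h * J = J * diag_fun h"
proof (rule eq_matI)
  fix i j assume "i < dim_row (J * diag_fun h)" "j < dim_col (J * diag_fun h)"
  then have "i < d" "j < d" using sum_blocks_eq by (auto simp: diag_fun_def)
  then show "(diag_fun h * J) $$ (i, j) = (J * diag_fun h) $$ (i, j)"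
    using jordan_matrix_nonzero_entry[of i n_as j] sum_blocks_eq
    by (cases "J $$ (i,j) = 0") (simp_all add: diag_fun_mult_entry)
qed (use sum_blocks_eq in \<open>auto simp: diag_fun_def\<close>)

lemma conj_mult:
  assumes "X \<in> carrier_mat d d" "Y \<in> carrier_mat d d"
  shows "S * X * S' * (S * Y * S') = S * (X * Y) * S'"
proof -
  have "S * X * S' * (S * Y * S') = S * X * (S' * S) * (Y * S')"
    using assms by (simp add: assoc_mult_mat[of _ d d _ d _ d] mult_carrier_mat[of _ d d])
  also have "\<dots> = S * (X * Y) * S'"
    using assms by (simp add: inverse_mat assoc_mult_mat[of _ d d _ d _ d] mult_carrier_mat[of _ d d])
  finally show ?thesis .
qed

lemma M_eq: "M = S * J * S'" by (rule similar_mat_witD2(3)[OF M wit])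

lemma spectral_fun_mult: "spectral_fun f * spectral_fun h = spectral_fun (\<lambda>z. f z * h z)"
  unfolding spectral_fun_def by (simp add: conj_mult diag_fun_mult)

lemma spectral_fun_commute: "spectral_fun h * M = M * spectral_fun h"
  unfolding spectral_fun_def by (subst (1 2) M_eq) (simp add: conj_mult diag_fun_commute)

lemma spectral_fun_one: "spectral_fun (\<lambda>z. 1) = 1\<^sub>m d"
proof -
  have "diag_fun (\<lambda>z. 1) = 1\<^sub>m d" by (rule eq_matI) (auto simp: diag_fun_def)
  then show ?thesis by (simp add: spectral_fun_def inverse_mat right_mult_one_mat[of _ d d])
qed

lemma spectral_fun_pow: "spectral_fun h ^\<^sub>m n = spectral_fun (\<lambda>z. h z ^ n)"
proof (induction n)
  case 0
  have "dim_row (spectral_fun h) = d" by (rule carrier_matD(1)[OF spectral_fun_carrier])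
  then show ?case by (simp add: spectral_fun_one)
next
  case (Suc n)
  then show ?case by (simp add: spectral_fun_mult mult.commute)
qed

lemma spectral_fun_pow_mult_pow:
  "spectral_fun h ^\<^sub>m n * M ^\<^sub>m n = S * (diag_fun (\<lambda>z. h z ^ n) * J ^\<^sub>m n) * S'"
  unfolding spectral_fun_pow similar_mat_wit_pow_id[OF wit]
  by (simp add: spectral_fun_def conj_mult)

text \<open>The generalised eigenspace in the whole complex space, with the exponent of
  \<open>gen_eigenspace\<close> but without the restriction to V.\<close>

definition gen_kernel :: "complex \<Rightarrow> complex vec set" where
  "gen_kernel z = mat_kernel (char_matrix M z ^\<^sub>m d)"

lemma char_matrix_pow_eq: "char_matrix M z ^\<^sub>m n = S * char_matrix J z ^\<^sub>m n * S'"
  by (rule similar_mat_wit_pow_id[OF similar_mat_wit_char_matrix[OF wit]])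

text \<open>In the Jordan basis, an entry of column i of the d-th power of J - z is 0 or a binomial
  coefficient times \<open>z' ^ (d - t)\<close> with z' = 0. Here t is smaller than a block size,
  hence smaller than d, and the exponent is positive.\<close>

lemma col_gen_kernel:
  assumes i: "i < d"
  shows "S *\<^sub>v unit_vec d i \<in> gen_kernel (J $$ (i,i))"
proof -
  let ?z = "J $$ (i,i)" and ?e = "unit_vec d i :: complex vec"
  let ?K = "char_matrix J ?z ^\<^sub>m d"
  have Kc: "?K \<in> carrier_mat d d" by auto
  have s: "sum_list (map fst (map (\<lambda>(n, a). (n, a - ?z)) n_as)) = d"
    unfolding sum_blocks_eq[symmetric] by (intro arg_cong[where f = sum_list]) auto
  have Jz: "jordan_matrix (map (\<lambda>(n, a). (n, a - ?z)) n_as) $$ (j,j) = J $$ (j,j) - ?z" if "j < d" for j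
    unfolding char_matrix_jordan_matrix[symmetric] using that sum_blocks_eq by (simp add: char_matrix_def)
  have "?K $$ (j,i) = 0" if j: "j < d" for j
  proof -
    note e = jordan_matrix_pow_entry[of j "map (\<lambda>(n, a). (n, a - ?z)) n_as" i, unfolded s, OF j i]
    show ?thesis
    proof (cases "\<forall>m. (jordan_matrix (map (\<lambda>(n, a). (n, a - ?z)) n_as) ^\<^sub>m m) $$ (j,i) = 0")
      case False
      with e obtain N z' t where N: "(N, z') \<in> set (map (\<lambda>(n, a). (n, a - ?z)) n_as)"
        "t < N" "J $$ (i,i) - ?z = z'"
        "(jordan_matrix (map (\<lambda>(n, a). (n, a - ?z)) n_as) ^\<^sub>m d) $$ (j,i) =
           of_nat (d choose t) * z' ^ (d - t)"
        unfolding Jz[OF i] by blast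
      have "N \<le> d"
        using N(1) member_le_sum_list[of N "map fst (map (\<lambda>(n, a). (n, a - ?z)) n_as)"] s
        by force
      then have "z' ^ (d - t) = 0" using N(2,3) by auto
      then show ?thesis using N(4) unfolding char_matrix_jordan_matrix by simp
    qed (simp add: char_matrix_jordan_matrix)
  qed
  then have Ke: "?K *\<^sub>v ?e = 0\<^sub>v d"
    using i carrier_matD[OF char_matrix_closed[OF carriers(1)]] by (intro eq_vecI) auto
  have "char_matrix M ?z ^\<^sub>m d *\<^sub>v (S *\<^sub>v ?e) = S *\<^sub>v (?K *\<^sub>v ((S' * S) *\<^sub>v ?e))"
    unfolding char_matrix_pow_eq using Kc i
    by (simp add: assoc_mult_mat_vec[of _ d d _ d] mult_mat_vec_carrier[of _ d d] mult_carrier_mat[of _ d d])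
  also have "\<dots> = 0\<^sub>v d" using Ke by (auto simp: inverse_mat)
  finally show ?thesis
    unfolding gen_kernel_def by (intro mat_kernelI[of _ d d]) (auto intro!: mult_mat_vec_carrier[of _ d d])
qed

text \<open>The columns of \<open>S\<close> form a basis of generalised eigenvectors, so the scalars
  by which a matrix acts on the generalised eigenspaces determine it.\<close>

lemma spectral_fun_eqI:
  assumes X: "X \<in> carrier_mat d d"
    and eig: "\<And>z x. x \<in> gen_kernel z \<Longrightarrow> X *\<^sub>v x = h z \<cdot>\<^sub>v x"
  shows "X = spectral_fun h"
proof -
  have "X * S = S * diag_fun h"
  proof (rule eq_matI)
    fix i j assume "i < dim_row (S * diag_fun h)" "j < dim_col (S * diag_fun h)"
    then have ij: "i < d" "j < d" by (auto simp: diag_fun_def)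
    have "(X * S) $$ (i,j) = (X *\<^sub>v (S *\<^sub>v unit_vec d j)) $ i"
      using ij X by (subst assoc_mult_mat_vec[of _ d d _ d, symmetric]) auto
    also have "\<dots> = h (J $$ (j,j)) * S $$ (i,j)"
      unfolding eig[OF col_gen_kernel[OF ij(2)]] using ij by simp
    also have "\<dots> = (S * diag_fun h) $$ (i,j)" using ij by (simp add: diag_fun_mult_entry)
    finally show "(X * S) $$ (i, j) = (S * diag_fun h) $$ (i, j)" .
  qed (use X in \<open>auto simp: diag_fun_def\<close>)
  then have "X * S * S' = spectral_fun h" by (simp add: spectral_fun_def)
  moreover have "X * S * S' = X" using X by (simp add: assoc_mult_mat[of _ d d _ d _ d] inverse_mat)
  ultimately show ?thesis by simp
qed

end

section \<open>Rotations\<close>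

context jordan_witness
begin

declare sum_blocks_eq [simp]

lemma mult_vec_conj:
  assumes "X \<in> carrier_mat d d" "x \<in> carrier_vec d"
  shows "S * X * S' *\<^sub>v x = S *\<^sub>v (X *\<^sub>v (S' *\<^sub>v x))"
  using assms
  by (simp add: assoc_mult_mat_vec[of _ d d _ d] mult_mat_vec_carrier[of _ d d] mult_carrier_mat[of _ d d])

lemma inverse_mult_vec:
  assumes "x \<in> carrier_vec d"
  shows "S *\<^sub>v (S' *\<^sub>v x) = x" "S' *\<^sub>v (S *\<^sub>v x) = x"
  using assms by (simp_all flip: assoc_mult_mat_vec[of _ d d _ d] add: inverse_mat)

lemma diag_fun_mult_vec:
  assumes "x \<in> carrier_vec d"
  shows "diag_fun h *\<^sub>v x = vec d (\<lambda>i. h (J $$ (i,i)) * x $ i)"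
proof (rule eq_vecI)
  fix i assume "i < dim_vec (vec d (\<lambda>i. h (J $$ (i,i)) * x $ i))"
  then have i: "i < d" by simp
  then have "(diag_fun h *\<^sub>v x) $ i = (\<Sum>l=0..<d. (if i = l then h (J $$ (i,i)) else 0) * x $ l)"
    using assms by (simp add: diag_fun_def scalar_prod_def)
  also have "\<dots> = (\<Sum>l=0..<d. if i = l then h (J $$ (i,i)) * x $ l else 0)"
    by (intro sum.cong) auto
  finally show "(diag_fun h *\<^sub>v x) $ i = vec d (\<lambda>i. h (J $$ (i,i)) * x $ i) $ i" using i by simp
qed (simp add: diag_fun_def)

lemma diag_fun_commute_char_matrix:
  "diag_fun h * char_matrix J z = char_matrix J z * diag_fun h"
proof (rule eq_matI)
  fix i j assume "i < dim_row (char_matrix J z * diag_fun h)" "j < dim_col (char_matrix J z * diag_fun h)"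
  then have ij: "i < d" "j < d" by (auto simp: diag_fun_def char_matrix_def)
  have c: "char_matrix J z \<in> carrier_mat d d" by simp
  show "(diag_fun h * char_matrix J z) $$ (i, j) = (char_matrix J z * diag_fun h) $$ (i, j)"
  proof (cases "char_matrix J z $$ (i,j) = 0")
    case False
    then have "i = j \<or> J $$ (i,j) \<noteq> 0" using ij by (auto simp: char_matrix_def)
    then have "J $$ (i,i) = J $$ (j,j)"
      using jordan_matrix_nonzero_entry[of i n_as j] ij sum_blocks_eq by auto
    then show ?thesis unfolding diag_fun_mult_entry[OF c ij] by simp
  qed (unfold diag_fun_mult_entry[OF c ij], simp)
qed (auto simp: diag_fun_def char_matrix_def)

lemma diag_fun_commute_char_matrix_pow:
  "diag_fun h * char_matrix J z ^\<^sub>m n = char_matrix J z ^\<^sub>m n * diag_fun h"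
  by (rule mat_commute_pow[of _ d, OF _ _ diag_fun_commute_char_matrix]) auto

text \<open>Off the eigenvalue \<open>z\<close> the matrix \<open>J - z\<close> is invertible; \<open>K\<close> is the triangular matrix that
  agrees with it there and is the identity on the blocks for \<open>z\<close>.\<close>

lemma off_eigenvalue_trivial:
  assumes "x \<in> carrier_vec d" and "diag_fun (\<lambda>w. if w = z then 0 else 1) *\<^sub>v x = x"
    and "char_matrix J z ^\<^sub>m n *\<^sub>v x = 0\<^sub>v d"
  shows "x = 0\<^sub>v d"
  using assms
proof (induction n arbitrary: x)
  case 0
  then show ?case by (simp add: char_matrix_def)
next
  case (Suc n)
  let ?E = "diag_fun (\<lambda>w. if w = z then 0 else 1)" and ?Z = "char_matrix J z"
  have c: "?Z ^\<^sub>m n \<in> carrier_mat d d" "?Z \<in> carrier_mat d d" by auto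
  have w: "?Z *\<^sub>v x \<in> carrier_vec d" using Suc.prems by (simp add: mult_mat_vec_carrier[of _ d d])
  \<comment> \<open>\<open>?E\<close> commutes with J - z, so the hypotheses pass from x to (J - z)
    x with one power less, and induction gives (J - z) x = 0.\<close>
  have "?E *\<^sub>v (?Z *\<^sub>v x) = (?E * ?Z) *\<^sub>v x"
    using Suc.prems c by (simp add: assoc_mult_mat_vec[of _ d d _ d])
  also have "\<dots> = ?Z *\<^sub>v (?E *\<^sub>v x)"
    unfolding diag_fun_commute_char_matrix using Suc.prems(1) c by (simp add: assoc_mult_mat_vec[of _ d d _ d])
  finally have "?E *\<^sub>v (?Z *\<^sub>v x) = ?Z *\<^sub>v x" using Suc.prems by simp
  moreover have "?Z ^\<^sub>m n *\<^sub>v (?Z *\<^sub>v x) = 0\<^sub>v d"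
    using Suc.prems c by (simp add: assoc_mult_mat_vec[of _ d d _ d])
  ultimately have Zx: "?Z *\<^sub>v x = 0\<^sub>v d" using Suc.IH[OF w] by simp
  define K where "K = mat d d (\<lambda>(i,j). if J $$ (i,i) = z then (if i = j then 1 else 0) else ?Z $$ (i,j))"
  have K: "K \<in> carrier_mat d d" by (simp add: K_def)
  have ut: "upper_triangular K"
    using jordan_matrix_upper_triangular[of _ n_as] sum_blocks_eq
    by (auto simp: upper_triangular_def K_def char_matrix_def)
  have "det K = prod_list (diag_mat K)" by (rule det_upper_triangular[OF ut K])
  also have "\<dots> \<noteq> 0"
    unfolding prod_list_zero_iff by (auto simp: diag_mat_def K_def char_matrix_def)
  finally have "det K \<noteq> 0" .
  moreover have "K *\<^sub>v x = 0\<^sub>v d"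
  proof (rule eq_vecI)
    fix i assume "i < dim_vec (0\<^sub>v d :: complex vec)"
    then have i: "i < d" by simp
    show "(K *\<^sub>v x) $ i = 0\<^sub>v d $ i"
    proof (cases "J $$ (i,i) = z")
      case True
      have "x $ i = 0"
        using arg_cong[OF Suc.prems(2), of "\<lambda>y. y $ i"] i True Suc.prems(1) by (simp add: diag_fun_mult_vec)
      moreover have "(K *\<^sub>v x) $ i = (\<Sum>l=0..<d. (if i = l then 1 else 0) * x $ l)"
        using i True Suc.prems(1) by (simp add: K_def scalar_prod_def)
      moreover have "\<dots> = (\<Sum>l=0..<d. if i = l then x $ l else 0)" by (intro sum.cong) auto
      ultimately show ?thesis using i by simp
    next
      case False
      then have "(K *\<^sub>v x) $ i = (?Z *\<^sub>v x) $ i"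
        using i Suc.prems(1) by (auto simp: K_def scalar_prod_def char_matrix_def intro!: sum.cong)
      then show ?thesis using Zx i by simp
    qed
  qed (simp add: K_def)
  ultimately show ?case using det_0_iff_vec_prod_zero[OF K] Suc.prems(1) by blast
qed

lemma gen_kernelD:
  assumes "x \<in> gen_kernel z"
  shows "x \<in> carrier_vec d" "char_matrix M z ^\<^sub>m d *\<^sub>v x = 0\<^sub>v d"
  using assms mat_kernelD[of "char_matrix M z ^\<^sub>m d" d d x] by (auto simp: gen_kernel_def)

lemma gen_kernelI:
  assumes "x \<in> carrier_vec d" "char_matrix M z ^\<^sub>m d *\<^sub>v x = 0\<^sub>v d"
  shows "x \<in> gen_kernel z"
  unfolding gen_kernel_def using assms by (intro mat_kernelI[of _ d d]) auto

text \<open>In the Jordan coordinates \<open>y\<close>, the part of the vector on positions with an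
  eigenvalue other than z is still annihilated by a power of J - z, hence zero. On the remaining
  positions \<open>diag_fun h\<close> is the scalar \<open>h z\<close>.\<close>

lemma spectral_fun_gen_kernel:
  assumes x: "x \<in> gen_kernel z"
  shows "spectral_fun h *\<^sub>v x = h z \<cdot>\<^sub>v x"
proof -
  note xc = gen_kernelD(1)[OF x]
  let ?Z = "char_matrix J z ^\<^sub>m d" and ?E = "diag_fun (\<lambda>w. if w = z then 0 else 1)"
  define y where "y = S' *\<^sub>v x"
  have Zc: "?Z \<in> carrier_mat d d" by auto
  have y: "y \<in> carrier_vec d" using xc by (simp add: y_def mult_mat_vec_carrier[of _ d d])
  have "S *\<^sub>v (?Z *\<^sub>v y) = 0\<^sub>v d"
    using gen_kernelD(2)[OF x] xc Zc by (simp add: char_matrix_pow_eq mult_vec_conj y_def)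
  then have "S' *\<^sub>v (S *\<^sub>v (?Z *\<^sub>v y)) = S' *\<^sub>v 0\<^sub>v d" by simp
  also have "S' *\<^sub>v 0\<^sub>v d = 0\<^sub>v d" by (intro eq_vecI) auto
  finally have "S' *\<^sub>v (S *\<^sub>v (?Z *\<^sub>v y)) = 0\<^sub>v d" .
  then have Zy: "?Z *\<^sub>v y = 0\<^sub>v d" using y Zc by (simp add: inverse_mult_vec mult_mat_vec_carrier[of _ d d])
  have Ey: "?E *\<^sub>v y \<in> carrier_vec d" using y by (simp add: mult_mat_vec_carrier[of _ d d])
  have "?E *\<^sub>v (?E *\<^sub>v y) = (?E * ?E) *\<^sub>v y"
    using y by (simp add: assoc_mult_mat_vec[of _ d d _ d])
  also have "?E * ?E = ?E" unfolding diag_fun_mult by (rule arg_cong[where f = diag_fun]) auto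
  finally have EE: "?E *\<^sub>v (?E *\<^sub>v y) = ?E *\<^sub>v y" .
  have "?Z *\<^sub>v (?E *\<^sub>v y) = (?E * ?Z) *\<^sub>v y"
    unfolding diag_fun_commute_char_matrix_pow using y Zc by (simp add: assoc_mult_mat_vec[of _ d d _ d])
  also have "\<dots> = ?E *\<^sub>v (?Z *\<^sub>v y)" using y Zc by (simp add: assoc_mult_mat_vec[of _ d d _ d])
  also have "\<dots> = 0\<^sub>v d" unfolding Zy by (auto simp: diag_fun_mult_vec)
  finally have "?E *\<^sub>v y = 0\<^sub>v d" by (rule off_eigenvalue_trivial[OF Ey EE])
  then have off: "y $ i = 0" if "i < d" "J $$ (i,i) \<noteq> z" for i
  proof -
    have "(?E *\<^sub>v y) $ i = 0" unfolding \<open>?E *\<^sub>v y = 0\<^sub>v d\<close> using that by simp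
    then show ?thesis using that by (simp add: diag_fun_mult_vec[OF y])
  qed
  have "diag_fun h *\<^sub>v y = h z \<cdot>\<^sub>v y"
    unfolding diag_fun_mult_vec[OF y]
  proof (rule eq_vecI)
    fix i assume "i < dim_vec (h z \<cdot>\<^sub>v y)"
    then have i: "i < d" using y by simp
    then show "vec d (\<lambda>i. h (J $$ (i, i)) * y $ i) $ i = (h z \<cdot>\<^sub>v y) $ i"
      using off[OF i] y by (cases "J $$ (i,i) = z") auto
  qed (use y in auto)
  then have "spectral_fun h *\<^sub>v x = S *\<^sub>v (h z \<cdot>\<^sub>v y)"
    unfolding spectral_fun_def using xc by (simp add: mult_vec_conj y_def)
  also have "\<dots> = h z \<cdot>\<^sub>v (S *\<^sub>v y)" using y by (simp add: mult_mat_vec[of _ d d])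
  finally show ?thesis using xc by (simp add: y_def inverse_mult_vec)
qed

end

interpretation cnj_hom: comm_ring_hom cnj by unfold_locales auto

lemma Re_Im_mult_cmat:
  assumes "N \<in> carrier_mat n m" "x \<in> carrier_vec m"
  shows "map_vec Re (cmat N *\<^sub>v x) = N *\<^sub>v map_vec Re x"
    and "map_vec Im (cmat N *\<^sub>v x) = N *\<^sub>v map_vec Im x"
  using assms by (auto intro!: eq_vecI simp: scalar_prod_def)

lemma cvec_eqI:
  assumes "map_vec Re x = map_vec Re y" "map_vec Im x = map_vec Im y"
  shows "x = y"
proof (rule eq_vecI)
  show d: "dim_vec x = dim_vec y" using arg_cong[OF assms(1), of dim_vec] by simp
  fix i assume i: "i < dim_vec y"
  then show "x $ i = y $ i"
    using arg_cong[OF assms(1), of "\<lambda>v. v $ i"] arg_cong[OF assms(2), of "\<lambda>v. v $ i"] d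
    by (simp add: complex_eq_iff)
qed

section \<open>Jordan data of the compressed matrix and the splitting by the row orbit space\<close>

locale spectral_family =
  matrix_family k d u A + jordan_witness d "cmat (compressed k d u A)" S S' n_as
  for k d u A S S' n_as +
  assumes d_pos: "d > 0"
begin

declare V.orth_proj(1) [simp] V.orth_proj(1)[THEN carrier_matD(1), simp] V.orth_proj(1)[THEN carrier_matD(2), simp]
  compressed_carrier[THEN carrier_matD(1), simp] compressed_carrier[THEN carrier_matD(2), simp]

abbreviation "Cc \<equiv> cmat C"
abbreviation "Pc \<equiv> cmat V.P"

lemma gen_eigenspace_eq:
  "gen_eigenspace k d u A z = {x \<in> gen_kernel z. map_vec Re x \<in> V \<and> map_vec Im x \<in> V}"
  by (simp add: gen_eigenspace_def gen_kernel_def)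

lemma Pc_Cc: "Pc * Cc = Cc" "Cc * Pc = Cc"
  using V.orth_proj(1) orth_proj_compressed compressed_orth_proj
  by (simp_all flip: of_real_hom.mat_hom_mult[of _ d d _ d])

lemma char_matrix_mult_vec:
  assumes "x \<in> carrier_vec d"
  shows "char_matrix Cc z *\<^sub>v x = Cc *\<^sub>v x - z \<cdot>\<^sub>v x"
proof -
  have "char_matrix Cc z *\<^sub>v x = Cc *\<^sub>v x + ((- z) \<cdot>\<^sub>m 1\<^sub>m d) *\<^sub>v x"
    unfolding char_matrix_def using assms by (subst add_mult_distrib_mat_vec[of _ d d]) auto
  also have "((- z) \<cdot>\<^sub>m 1\<^sub>m d) *\<^sub>v x = (- z) \<cdot>\<^sub>v x"
    using assms by (intro eq_vecI) auto
  finally show ?thesis using assms by (intro eq_vecI) auto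
qed

lemma Pc_commute_char_matrix: "Pc * char_matrix Cc z = char_matrix Cc z * Pc"
proof -
  have "Pc * char_matrix Cc z = Pc * Cc + Pc * ((- z) \<cdot>\<^sub>m 1\<^sub>m d)"
    unfolding char_matrix_def by (subst mult_add_distrib_mat[of _ d d]) auto
  also have "Pc * ((- z) \<cdot>\<^sub>m 1\<^sub>m d) = ((- z) \<cdot>\<^sub>m 1\<^sub>m d) * Pc"
    using mult_smult_distrib[of Pc d d "1\<^sub>m d" d "- z"] mult_smult_assoc_mat[of "1\<^sub>m d" d d Pc d "- z"] by simp
  also have "Pc * Cc + ((- z) \<cdot>\<^sub>m 1\<^sub>m d) * Pc = char_matrix Cc z * Pc"
    unfolding char_matrix_def Pc_Cc by (subst add_mult_distrib_mat[of _ d d]) (auto simp: Pc_Cc)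
  finally show ?thesis .
qed

lemma Pc_commute_char_matrix_pow: "Pc * char_matrix Cc z ^\<^sub>m n = char_matrix Cc z ^\<^sub>m n * Pc"
  by (rule mat_commute_pow[of _ d, OF _ _ Pc_commute_char_matrix]) auto

lemma Pc_gen_eigenspace:
  assumes x: "x \<in> gen_kernel z"
  shows "Pc *\<^sub>v x \<in> gen_eigenspace k d u A z"
proof -
  note xc = gen_kernelD(1)[OF x]
  have Kc: "char_matrix Cc z ^\<^sub>m d \<in> carrier_mat d d" by auto
  have "char_matrix Cc z ^\<^sub>m d *\<^sub>v (Pc *\<^sub>v x) = (Pc * char_matrix Cc z ^\<^sub>m d) *\<^sub>v x"
    unfolding Pc_commute_char_matrix_pow using xc Kc by (simp add: assoc_mat_vec)
  also have "\<dots> = Pc *\<^sub>v 0\<^sub>v d"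
    using gen_kernelD(2)[OF x] xc Kc by (simp add: assoc_mat_vec)
  also have "\<dots> = 0\<^sub>v d" by (intro eq_vecI) auto
  finally have "Pc *\<^sub>v x \<in> gen_kernel z"
    using xc by (intro gen_kernelI) (auto intro!: mult_mat_vec_carrier[of _ d d])
  moreover have "map_vec Re (Pc *\<^sub>v x) \<in> V" "map_vec Im (Pc *\<^sub>v x) \<in> V"
    using V.orth_proj xc by (simp_all add: Re_Im_mult_cmat[of _ d d])
  ultimately show ?thesis by (simp add: gen_eigenspace_eq)
qed

text \<open>C annihilates the residual q = x - P x, so C - z acts on q as the scalar -z. A power of
  C - z annihilates q as well, and z is nonzero, so q = 0: generalised eigenspaces for nonzero
  eigenvalues lie inside the complexification of V.\<close>

lemma gen_kernel_complement:
  assumes x: "x \<in> gen_kernel z" and z: "z \<noteq> 0"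
  shows "Pc *\<^sub>v x = x"
proof -
  note xc = gen_kernelD(1)[OF x]
  let ?K = "char_matrix Cc z"
  have Pxc: "Pc *\<^sub>v x \<in> carrier_vec d" using xc by (simp add: mult_mat_vec_carrier[of _ d d])
  define q where "q = x - Pc *\<^sub>v x"
  have qc: "q \<in> carrier_vec d" using xc Pxc by (simp add: q_def)
  have "Cc *\<^sub>v q = Cc *\<^sub>v x - Cc *\<^sub>v (Pc *\<^sub>v x)"
    unfolding q_def using xc Pxc by (simp add: mult_minus_distrib_mat_vec[of _ d d])
  also have "Cc *\<^sub>v (Pc *\<^sub>v x) = Cc *\<^sub>v x"
    using xc Pc_Cc by (simp flip: assoc_mat_vec)
  finally have "Cc *\<^sub>v q = 0\<^sub>v d" using xc by (auto intro!: eq_vecI)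
  then have Kq: "?K *\<^sub>v q = (- z) \<cdot>\<^sub>v q"
    using qc by (auto simp: char_matrix_mult_vec intro!: eq_vecI)
  have Kn: "?K ^\<^sub>m n *\<^sub>v q = (- z) ^ n \<cdot>\<^sub>v q" for n
  proof (induction n)
    case 0
    have "dim_row ?K = d" by (simp add: char_matrix_def)
    then show ?case using qc by simp
  next
    case (Suc n)
    have c: "?K ^\<^sub>m n \<in> carrier_mat d d" "?K \<in> carrier_mat d d" by auto
    have "?K ^\<^sub>m Suc n *\<^sub>v q = ?K ^\<^sub>m n *\<^sub>v (?K *\<^sub>v q)"
      using c qc by (simp add: assoc_mat_vec)
    also have "\<dots> = (- z) \<cdot>\<^sub>v (?K ^\<^sub>m n *\<^sub>v q)" unfolding Kq using c qc by (simp add: mult_mat_vec[of _ d d])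
    finally show ?case unfolding Suc by (simp add: smult_smult_assoc)
  qed
  have "(- z) ^ d \<cdot>\<^sub>v q = ?K ^\<^sub>m d *\<^sub>v x - ?K ^\<^sub>m d *\<^sub>v (Pc *\<^sub>v x)"
    unfolding Kn[symmetric] unfolding q_def using xc Pxc by (intro mult_minus_distrib_mat_vec[of _ d d]) auto
  also have "\<dots> = 0\<^sub>v d"
    using gen_kernelD(2)[OF x] gen_kernelD(2)[of "Pc *\<^sub>v x" z] Pc_gen_eigenspace[OF x]
    by (simp add: gen_eigenspace_eq)
  finally have z0: "(- z) ^ d \<cdot>\<^sub>v q = 0\<^sub>v d" .
  show ?thesis
  proof (rule eq_vecI)
    fix i assume "i < dim_vec x"
    then have i: "i < d" using xc by simp
    have "(- z) ^ d * q $ i = 0" using arg_cong[OF z0, of "\<lambda>v. v $ i"] i qc by simp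
    then have "q $ i = 0" using z by simp
    then show "(Pc *\<^sub>v x) $ i = x $ i"
      unfolding q_def using i xc Pxc by (simp del: index_mult_mat_vec)
  qed (use xc in simp)
qed

text \<open>Off 0 the generalised eigenvectors lie in V. At 0 they split into a part in V and a
  residual whose real and imaginary parts are orthogonal to V; there the matrix is the identity, in
  agreement with \<open>h 0 = 1\<close>. This is the uniqueness behind the definite description of
  \<open>rotation\<close>.\<close>

lemma rotation_condition_imp_spectral_fun:
  assumes X: "X \<in> carrier_mat d d"
    and eig: "\<And>z x. x \<in> gen_eigenspace k d u A z \<Longrightarrow> cmat X *\<^sub>v x = h z \<cdot>\<^sub>v x"
    and compl: "\<And>x. x \<in> V.orth_compl \<Longrightarrow> X *\<^sub>v x = x"
    and h0: "h 0 = 1"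
  shows "cmat X = spectral_fun h"
proof (rule spectral_fun_eqI)
  show "cmat X \<in> carrier_mat d d" using X by simp
  fix z x assume x: "x \<in> gen_kernel z"
  note xc = gen_kernelD(1)[OF x]
  have Xc: "cmat X \<in> carrier_mat d d" using X by simp
  show "cmat X *\<^sub>v x = h z \<cdot>\<^sub>v x"
  proof (cases "z = 0")
    case False
    then show ?thesis using eig[OF Pc_gen_eigenspace[OF x]] gen_kernel_complement[OF x] by simp
  next
    case True
    define q where "q = x - Pc *\<^sub>v x"
    have Pxc: "Pc *\<^sub>v x \<in> carrier_vec d" using xc by (simp add: mult_mat_vec_carrier[of _ d d])
    have qc: "q \<in> carrier_vec d" using xc Pxc by (simp add: q_def)
    have "map_vec Re q = map_vec Re x - V.P *\<^sub>v map_vec Re x"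
      "map_vec Im q = map_vec Im x - V.P *\<^sub>v map_vec Im x"
      unfolding q_def using xc Pxc V.orth_proj(1)
      by (auto intro!: eq_vecI simp: scalar_prod_def simp flip: Re_Im_mult_cmat[of _ d d])
    then have "X *\<^sub>v map_vec Re q = map_vec Re q" "X *\<^sub>v map_vec Im q = map_vec Im q"
      using V.orth_proj(3) xc by (auto intro!: compl)
    then have "cmat X *\<^sub>v q = q"
      using qc X by (intro cvec_eqI) (simp_all add: Re_Im_mult_cmat[of _ d d])
    moreover have "x = Pc *\<^sub>v x + q" using xc Pxc by (intro eq_vecI) (auto simp: q_def simp del: index_mult_mat_vec)
    ultimately have "cmat X *\<^sub>v x = h z \<cdot>\<^sub>v (Pc *\<^sub>v x) + h z \<cdot>\<^sub>v q"
      using mult_add_distrib_mat_vec[OF Xc Pxc qc] eig[OF Pc_gen_eigenspace[OF x]] True h0 qc by simp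
    also have "\<dots> = h z \<cdot>\<^sub>v (Pc *\<^sub>v x + q)" using Pxc qc by (simp add: smult_add_distrib_vec[of _ d])
    finally show ?thesis using \<open>x = Pc *\<^sub>v x + q\<close> by simp
  qed
qed

lemma cnj_char_matrix_pow: "map_mat cnj (char_matrix Cc z ^\<^sub>m n) = char_matrix Cc (cnj z) ^\<^sub>m n"
proof -
  have "map_mat cnj (char_matrix Cc z) = char_matrix Cc (cnj z)"
    by (rule eq_matI) (auto simp: char_matrix_def)
  then show ?thesis by (simp add: cnj_hom.mat_hom_pow[of _ d])
qed

lemma cnj_gen_kernel:
  assumes "x \<in> gen_kernel z"
  shows "map_vec cnj x \<in> gen_kernel (cnj z)"
proof (rule gen_kernelI)
  note xD = gen_kernelD[OF assms]
  show "map_vec cnj x \<in> carrier_vec d" using xD by simp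
  have "char_matrix Cc (cnj z) ^\<^sub>m d *\<^sub>v map_vec cnj x = map_vec cnj (char_matrix Cc z ^\<^sub>m d *\<^sub>v x)"
    unfolding cnj_char_matrix_pow[symmetric] using xD by (intro cnj_hom.mult_mat_vec_hom[of _ d d, symmetric]) auto
  also have "\<dots> = 0\<^sub>v d" unfolding xD(2) by auto
  finally show "char_matrix Cc (cnj z) ^\<^sub>m d *\<^sub>v map_vec cnj x = 0\<^sub>v d" .
qed

text \<open>The conjugate matrix acts on the generalised eigenspace for z by
  \<open>cnj (h (cnj z))\<close>, which is \<open>h z\<close>. As these scalars determine the
  matrix, it equals its own conjugate.\<close>

lemma spectral_fun_real:
  assumes "\<And>z. h (cnj z) = cnj (h z)"
  shows "cmat (map_mat Re (spectral_fun h)) = spectral_fun h"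
proof -
  have "map_mat cnj (spectral_fun h) = spectral_fun h"
  proof (rule spectral_fun_eqI)
    fix z x assume x: "x \<in> gen_kernel z"
    note xc = gen_kernelD(1)[OF x]
    have xx: "map_vec cnj (map_vec cnj x) = x" by (intro eq_vecI) auto
    have "map_mat cnj (spectral_fun h) *\<^sub>v x = map_vec cnj (spectral_fun h *\<^sub>v map_vec cnj x)"
      using xc cnj_hom.mult_mat_vec_hom[of "spectral_fun h" d d "map_vec cnj x"] by (simp add: xx)
    also have "\<dots> = map_vec cnj (h (cnj z) \<cdot>\<^sub>v map_vec cnj x)"
      by (simp add: spectral_fun_gen_kernel[OF cnj_gen_kernel[OF x]])
    also have "\<dots> = h z \<cdot>\<^sub>v x" using assms[of z] by (intro eq_vecI) auto
    finally show "map_mat cnj (spectral_fun h) *\<^sub>v x = h z \<cdot>\<^sub>v x" .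
  qed simp
  then have "cnj (spectral_fun h $$ (i,j)) = spectral_fun h $$ (i,j)" if "i < d" "j < d" for i j
    using that spectral_fun_carrier[of h] by (metis carrier_matD index_map_mat(1))
  then show ?thesis
    using spectral_fun_carrier[of h, THEN carrier_matD(1)] spectral_fun_carrier[of h, THEN carrier_matD(2)]
    by (intro eq_matI) (auto simp: complex_eq_iff)
qed

text \<open>The entrywise real part of \<open>spectral_fun h\<close> satisfies the defining
  conditions of \<open>rotation\<close> and is the only such matrix. From here on rotations are
  handled through their spectral form.\<close>

lemma rotation_spectral_fun:
  assumes h0: "h 0 = 1" and hc: "\<And>z. h (cnj z) = cnj (h z)"
  shows "rotation k d u A h \<in> carrier_mat d d" and "cmat (rotation k d u A h) = spectral_fun h"
    and "x \<in> V.orth_compl \<Longrightarrow> rotation k d u A h *\<^sub>v x = x"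
proof -
  let ?Q = "\<lambda>M. M \<in> carrier_mat d d \<and>
     (\<forall>z. \<forall>x\<in>gen_eigenspace k d u A z. cmat M *\<^sub>v x = h z \<cdot>\<^sub>v x) \<and>
     (\<forall>x\<in>V.orth_compl. M *\<^sub>v x = x)"
  let ?X = "map_mat Re (spectral_fun h)"
  have X: "?X \<in> carrier_mat d d" by simp
  have cX: "cmat ?X = spectral_fun h" using hc by (rule spectral_fun_real)
  have "?X *\<^sub>v x = x" if x: "x \<in> V.orth_compl" for x
  proof -
    have xc: "x \<in> carrier_vec d" using x by (simp add: V.orth_compl_iff)
    let ?x = "map_vec complex_of_real x"
    have xr: "?x \<in> carrier_vec d" using xc by simp
    have "C *\<^sub>v x = C *\<^sub>v (V.P *\<^sub>v x)"
      using V.orth_proj(1) xc compressed_orth_proj by (simp flip: assoc_mat_vec)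
    also have "\<dots> = 0\<^sub>v d"
      unfolding V.orth_proj_on_orth_compl[OF x]
      using compressed_carrier[THEN carrier_matD(1)] compressed_carrier[THEN carrier_matD(2)]
      by (intro eq_vecI) auto
    finally have "Cc *\<^sub>v ?x = map_vec complex_of_real (0\<^sub>v d)"
      using of_real_hom.mult_mat_vec_hom[OF compressed_carrier xc, where 'a = complex] by simp
    also have "\<dots> = 0\<^sub>v d" by auto
    finally have "Cc *\<^sub>v ?x = 0\<^sub>v d" .
    then have K0: "char_matrix Cc 0 *\<^sub>v ?x = 0\<^sub>v d"
      using xr by (simp add: char_matrix_mult_vec) (auto intro!: eq_vecI)
    have "char_matrix Cc 0 ^\<^sub>m n *\<^sub>v 0\<^sub>v d = 0\<^sub>v d" for n
      using pow_carrier_mat[OF char_matrix_closed[OF carriers(4)], THEN carrier_matD(1)]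
        pow_carrier_mat[OF char_matrix_closed[OF carriers(4)], THEN carrier_matD(2)]
      by (intro eq_vecI) auto
    \<comment> \<open>Since the exponent d is positive, a vector annihilated by C itself lies in the
      generalised eigenspace for 0.\<close>
    moreover obtain e where "d = Suc e" using d_pos by (cases d) auto
    then have "char_matrix Cc 0 ^\<^sub>m d = char_matrix Cc 0 ^\<^sub>m e * char_matrix Cc 0"
      by (simp only: pow_mat.simps)
    moreover have "char_matrix Cc 0 ^\<^sub>m e * char_matrix Cc 0 *\<^sub>v ?x =
        char_matrix Cc 0 ^\<^sub>m e *\<^sub>v (char_matrix Cc 0 *\<^sub>v ?x)"
      using xr by (intro assoc_mat_vec) auto
    ultimately have "char_matrix Cc 0 ^\<^sub>m d *\<^sub>v ?x = 0\<^sub>v d" using K0 by simp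
    then have "?x \<in> gen_kernel 0" by (rule gen_kernelI[OF xr])
    then have "spectral_fun h *\<^sub>v ?x = ?x"
      using spectral_fun_gen_kernel[of ?x 0 h] h0 by simp
    then have "map_vec Re (cmat ?X *\<^sub>v ?x) = map_vec Re ?x" unfolding cX by simp
    then have "?X *\<^sub>v map_vec Re ?x = map_vec Re ?x" using Re_Im_mult_cmat(1)[OF X xr] by simp
    moreover have "map_vec Re ?x = x" by (intro eq_vecI) auto
    ultimately show ?thesis by simp
  qed
  then have QX: "?Q ?X"
    using X by (auto simp: cX gen_eigenspace_eq spectral_fun_gen_kernel)
  have uniq: "M = ?X" if "?Q M" for M
  proof -
    have "cmat M = cmat ?X"
      unfolding cX using that h0 by (intro rotation_condition_imp_spectral_fun) auto
    then show ?thesis by (rule of_real_hom.mat_hom_inj)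
  qed
  have "rotation k d u A h = ?X"
    unfolding rotation_def using QX uniq by (rule the_equality)
  then show "rotation k d u A h \<in> carrier_mat d d" "cmat (rotation k d u A h) = spectral_fun h"
    "x \<in> V.orth_compl \<Longrightarrow> rotation k d u A h *\<^sub>v x = x"
    using QX cX by auto
qed

end

section \<open>Growth of powers\<close>

text \<open>The quotient is a product of t factors (n - i) / n, each tending to 1, times a power of
  1 / n. The limit contains \<open>0 ^ (m - t)\<close>, which is 1 for t = m and 0 for t <
  m.\<close>

lemma binomial_over_power_convergent:
  assumes "t \<le> m"
  shows "convergent (\<lambda>n. real (n choose t) / real n ^ m)"
proof -
  have "(\<lambda>n. (\<Prod>i = 0..<t. (real n - real i) / real n) * (1 / real n) ^ (m - t) / fact t)
      \<longlonglongrightarrow> (\<Prod>i = 0..<t. 1) * 0 ^ (m - t) / fact t"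
  proof (intro tendsto_intros)
    fix i
    have "(\<lambda>n. 1 - real i * (1 / real n)) \<longlonglongrightarrow> 1 - real i * 0"
      by (intro tendsto_intros lim_1_over_n)
    moreover have "\<forall>\<^sub>F n in sequentially. 1 - real i * (1 / real n) = (real n - real i) / real n"
      using eventually_gt_at_top[of 0] by eventually_elim (simp add: field_simps)
    ultimately have "(\<lambda>n. (real n - real i) / real n) \<longlonglongrightarrow> 1 - real i * 0"
      by (rule Lim_transform_eventually)
    then show "(\<lambda>n. (real n - real i) / real n) \<longlonglongrightarrow> 1" by simp
  qed (auto intro: lim_1_over_n)
  moreover have "\<forall>\<^sub>F n in sequentially.
      (\<Prod>i = 0..<t. (real n - real i) / real n) * (1 / real n) ^ (m - t) / fact t =
      real (n choose t) / real n ^ m"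
    using eventually_gt_at_top[of 0]
  proof eventually_elim
    case (elim n)
    have "real n ^ m = real n ^ t * real n ^ (m - t)" using assms by (simp flip: power_add)
    moreover have "real (n choose t) = (\<Prod>i = 0..<t. real n - real i) / fact t"
      by (simp add: binomial_gbinomial gbinomial_prod_rev)
    ultimately show ?case by (simp add: prod_dividef power_divide)
  qed
  ultimately show ?thesis
    by (rule convergentI[OF Lim_transform_eventually])
qed

text \<open>Write b as the square of its root: one factor \<open>sqrt b ^ n\<close> keeps the
  polynomial bounded, the other tends to 0.\<close>

lemma power_times_geometric_tendsto_0:
  assumes "0 < b" "b < (1 :: real)"
  shows "(\<lambda>n. real n ^ t * b ^ n) \<longlonglongrightarrow> 0"
proof -
  have sb: "0 < sqrt b" "sqrt b < 1" using assms by auto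
  obtain p where p: "\<And>n. sqrt b ^ n * real n ^ t \<le> p" using poly_exp_bound[OF sb, of t] by auto
  show ?thesis
  proof (rule tendsto_sandwich[of "\<lambda>_. 0" _ _ "\<lambda>n. p * sqrt b ^ n"])
    show "\<forall>\<^sub>F n in sequentially. real n ^ t * b ^ n \<le> p * sqrt b ^ n"
    proof (rule always_eventually, rule allI)
      fix n
      have "b ^ n = (sqrt b * sqrt b) ^ n" using assms by simp
      also have "\<dots> = sqrt b ^ n * sqrt b ^ n" by (rule power_mult_distrib)
      finally have "b ^ n = sqrt b ^ n * sqrt b ^ n" .
      then have "real n ^ t * b ^ n = (sqrt b ^ n * real n ^ t) * sqrt b ^ n" by simp
      also have "\<dots> \<le> p * sqrt b ^ n" using p[of n] sb by (intro mult_right_mono) auto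
      finally show "real n ^ t * b ^ n \<le> p * sqrt b ^ n" .
    qed
    have "(\<lambda>n. p * sqrt b ^ n) \<longlonglongrightarrow> p * 0" using sb by (intro tendsto_mult tendsto_const LIMSEQ_power_zero) simp
    then show "(\<lambda>n. p * sqrt b ^ n) \<longlonglongrightarrow> 0" by simp
  qed (use assms in auto)
qed

text \<open>A matrix carries its size as a value, so the size is a parameter here. Nothing is said
  about carriers, whence the carrier hypotheses of the rules below.\<close>

definition entries_tendsto :: "nat \<Rightarrow> (nat \<Rightarrow> 'a :: real_normed_field mat) \<Rightarrow> 'a mat \<Rightarrow> bool" where
  "entries_tendsto d M L \<longleftrightarrow> (\<forall>i<d. \<forall>j<d. (\<lambda>n. M n $$ (i,j)) \<longlonglongrightarrow> L $$ (i,j))"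

lemma entries_tendsto_mult:
  assumes "entries_tendsto d M L" "entries_tendsto d N K"
    and "\<And>n. M n \<in> carrier_mat d d" "\<And>n. N n \<in> carrier_mat d d"
    and "L \<in> carrier_mat d d" "K \<in> carrier_mat d d"
  shows "entries_tendsto d (\<lambda>n. M n * N n) (L * K)"
  unfolding entries_tendsto_def
proof (intro allI impI)
  fix i j assume ij: "i < d" "j < d"
  have entry: "(X * Y) $$ (i,j) = (\<Sum>l=0..<d. X $$ (i,l) * Y $$ (l,j))"
    if "X \<in> carrier_mat d d" "Y \<in> carrier_mat d d" for X Y :: "'a mat"
    using that ij by (auto simp: scalar_prod_def)
  have "(\<lambda>n. \<Sum>l=0..<d. M n $$ (i,l) * N n $$ (l,j)) \<longlonglongrightarrow> (\<Sum>l=0..<d. L $$ (i,l) * K $$ (l,j))"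
    using assms(1,2) ij by (intro tendsto_intros) (auto simp: entries_tendsto_def)
  then show "(\<lambda>n. (M n * N n) $$ (i,j)) \<longlonglongrightarrow> (L * K) $$ (i,j)"
    using assms by (simp add: entry)
qed

lemma entries_tendsto_const: "entries_tendsto d (\<lambda>n. M) M"
  by (simp add: entries_tendsto_def)

lemma entries_tendsto_compose:
  assumes "entries_tendsto d M L" "filterlim s at_top sequentially"
  shows "entries_tendsto d (\<lambda>n. M (s n)) L"
  using assms filterlim_compose[OF _ assms(2)] unfolding entries_tendsto_def by fast

lemma entries_tendsto_smult:
  assumes "entries_tendsto d M L" "c \<longlonglongrightarrow> a"
    and "\<And>n. M n \<in> carrier_mat d d" "L \<in> carrier_mat d d"
  shows "entries_tendsto d (\<lambda>n. c n \<cdot>\<^sub>m M n) (a \<cdot>\<^sub>m L)"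
  using assms(1,2) carrier_matD[OF assms(3)] carrier_matD[OF assms(4)]
  by (auto simp: entries_tendsto_def intro!: tendsto_mult)

lemma entries_tendsto_scalar_prod:
  assumes "entries_tendsto d M L"
    and "\<And>n. M n \<in> carrier_mat d d" "L \<in> carrier_mat d d"
    and "z \<in> carrier_vec d" "x \<in> carrier_vec d"
  shows "(\<lambda>n. z \<bullet> (M n *\<^sub>v x)) \<longlonglongrightarrow> z \<bullet> (L *\<^sub>v x)"
proof -
  have *: "z \<bullet> (X *\<^sub>v x) = (\<Sum>i=0..<d. z $ i * (\<Sum>l=0..<d. X $$ (i,l) * x $ l))"
    if "X \<in> carrier_mat d d" for X
    using that assms(4,5) by (auto simp: scalar_prod_def intro!: sum.cong)
  have "(\<lambda>n. \<Sum>i=0..<d. z $ i * (\<Sum>l=0..<d. M n $$ (i,l) * x $ l)) \<longlonglongrightarrow>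
      (\<Sum>i=0..<d. z $ i * (\<Sum>l=0..<d. L $$ (i,l) * x $ l))"
    using assms(1) by (intro tendsto_intros) (auto simp: entries_tendsto_def)
  then show ?thesis using assms(2,3) by (simp add: *)
qed

lemma entries_tendsto_unique:
  assumes "entries_tendsto d M L" "entries_tendsto d M K"
    and "L \<in> carrier_mat d d" "K \<in> carrier_mat d d"
  shows "L = K"
proof (rule eq_matI)
  fix i j assume "i < dim_row K" "j < dim_col K"
  then have "i < d" "j < d" using assms(4) by auto
  then show "L $$ (i,j) = K $$ (i,j)"
    using assms(1,2) unfolding entries_tendsto_def by (blast intro: LIMSEQ_unique)
qed (use assms in auto)

lemma entries_tendsto_of_real_iff:
  assumes "\<And>n. M n \<in> carrier_mat d d" "L \<in> carrier_mat d d"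
  shows "entries_tendsto d (\<lambda>n. cmat (M n)) (cmat L) \<longleftrightarrow> entries_tendsto d M L"
  using carrier_matD[OF assms(1)] carrier_matD[OF assms(2)]
  by (simp add: entries_tendsto_def tendsto_of_real_iff)

section \<open>Convergence of the normalised and derotated powers\<close>

locale growing_family = spectral_family +
  assumes rho_pos: "rho k d u A > 0"
    and blocks_pos: "0 \<notin> fst ` set n_as"
begin

abbreviation "\<rho> \<equiv> rho k d u A"
abbreviation "ph \<equiv> phase k d u A"
abbreviation "r \<equiv> max_block k d u A"
abbreviation "c \<equiv> growth_coeff k d u A"
abbreviation "R \<equiv> inv_rotation k d u A"
abbreviation "L \<equiv> limit_mat k d u A"
abbreviation "rot \<equiv> rotation k d u A"

lemma eigenvalue_norm_le:
  assumes "eigenvalue Cc z"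
  shows "cmod z \<le> \<rho>"
  unfolding rho_def using assms
  by (intro spectral_radius_mem_max(2)[OF carriers(4) d_pos]) (auto simp: spectrum_def)

lemma diagonal_eigenvalue:
  assumes "i < d"
  shows "eigenvalue Cc (J $$ (i,i))"
proof -
  have "char_poly Cc = char_poly J"
    by (rule char_poly_similar) (use wit in \<open>auto simp: similar_mat_def\<close>)
  also have "\<dots> = (\<Prod>a\<leftarrow>diag_mat J. [:- a, 1:])"
    using jordan_matrix_upper_triangular[of _ n_as]
    by (intro char_poly_upper_triangular[of _ d]) (auto simp: upper_triangular_def)
  finally have "poly (char_poly Cc) (J $$ (i,i)) = 0"
    using assms by (auto simp: poly_prod_list prod_list_zero_iff diag_mat_def)
  then show ?thesis using eigenvalue_root_char_poly[OF carriers(4)] by simp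
qed

lemma phase_norm: "cmod (ph z) = 1"
  using rho_pos by (simp add: phase_def norm_divide)

lemma phase_nonzero: "ph z \<noteq> 0"
  using phase_norm[of z] by auto

lemma phase_zero: "ph 0 = 1"
  using rho_pos by (simp add: phase_def)

lemma phase_cnj: "ph (cnj z) = cnj (ph z)"
proof -
  have "map_mat cnj Cc = Cc" by (rule eq_matI) auto
  then have "eigenvalue Cc (cnj z)" if "eigenvalue Cc z" for z
    using cnj_hom.char_poly_hom[OF carriers(4)] that
    unfolding eigenvalue_root_char_poly[OF carriers(4)]
    by (metis cnj_hom.poly_map_poly complex_cnj_zero)
  from this[of z] this[of "cnj z"] have "eigenvalue Cc (cnj z) \<longleftrightarrow> eigenvalue Cc z" by auto
  then show ?thesis by (simp add: phase_def)
qed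

lemma jordan_nf_Cc: "jordan_nf Cc n_as"
  using wit blocks_pos by (auto simp: jordan_nf_def similar_mat_def)

text \<open>\<open>max_block\<close> is a maximum over all Jordan forms of the matrix. The set is
  finite because the block sizes of any such form add up to d.\<close>

lemma block_le_max_block:
  assumes "(N, z) \<in> set n_as" "cmod z = \<rho>"
  shows "N \<le> r"
proof -
  have "m \<le> d" if "jordan_nf Cc bs" "(m, w) \<in> set bs" for m w bs
  proof -
    have "sum_list (map fst bs) = d"
    proof -
      have "similar_mat Cc (jordan_matrix bs)" using that(1) by (simp only: jordan_nf_def)
      from similar_matD[OF this] obtain n P Q where "{Cc, jordan_matrix bs, P, Q} \<subseteq> carrier_mat n n"
        by blast
      then have "Cc \<in> carrier_mat n n" "jordan_matrix bs \<in> carrier_mat n n" by blast+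
      then have "dim_row Cc = n" "dim_row (jordan_matrix bs) = n" by (simp_all only: carrier_matD)
      then show ?thesis by simp
    qed
    then show ?thesis using member_le_sum_list[of m "map fst bs"] that(2) by force
  qed
  then have "{m. \<exists>n_as z. jordan_nf Cc n_as \<and> (m, z) \<in> set n_as \<and> cmod z = \<rho>} \<subseteq> {..d}"
    by blast
  then have "finite {m. \<exists>n_as z. jordan_nf Cc n_as \<and> (m, z) \<in> set n_as \<and> cmod z = \<rho>}"
    by (rule finite_subset) (rule finite_atMost)
  moreover have "N \<in> {m. \<exists>n_as z. jordan_nf Cc n_as \<and> (m, z) \<in> set n_as \<and> cmod z = \<rho>}"
    using assms jordan_nf_Cc by blast
  ultimately show ?thesis
    unfolding max_block_def by (rule Max_ge)
qed

lemma growth_coeff_eq: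
  "c n = fact (r - 1) * \<rho> powi (int r - 1) / (real n ^ (r - 1) * \<rho> ^ n)"
proof -
  have "\<rho> powi (int n - int r + 1) = \<rho> ^ n / \<rho> powi (int r - 1)"
    using power_int_diff[of \<rho> "int n" "int r - 1"] rho_pos by (simp add: algebra_simps)
  then show ?thesis by (simp add: growth_coeff_def Let_def)
qed

lemma growth_coeff_pos: "n > 0 \<Longrightarrow> c n > 0"
  using rho_pos by (simp add: growth_coeff_eq)

text \<open>The powers of n cancel in the limit and only the geometric factor remains. This is the
  origin of the factor rho to the power -l in the mass of a cell of level l.\<close>

lemma growth_coeff_ratio: "(\<lambda>n. c n / c (n + l)) \<longlonglongrightarrow> \<rho> ^ l"
proof -
  have "(\<lambda>n. (1 + real l * (1 / real n)) ^ (r - 1) * \<rho> ^ l) \<longlonglongrightarrow> (1 + real l * 0) ^ (r - 1) * \<rho> ^ l"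
    by (intro tendsto_intros lim_1_over_n)
  moreover have "\<forall>\<^sub>F n in sequentially. (1 + real l * (1 / real n)) ^ (r - 1) * \<rho> ^ l = c n / c (n + l)"
    using eventually_gt_at_top[of 0]
  proof eventually_elim
    case (elim n)
    have "1 + real l * (1 / real n) = real (n + l) / real n" using elim by (simp add: field_simps)
    moreover have "\<rho> powi (int r - 1) \<noteq> 0" using rho_pos by simp
    ultimately show ?case
      unfolding growth_coeff_eq using rho_pos elim by (simp add: power_divide power_add field_simps)
  qed
  ultimately show ?thesis by (simp add: filterlim_cong)
qed

text \<open>On the circle of radius rho the inverse phase turns the power of z into a power of rho,
  which \<open>c n\<close> cancels up to a constant; what remains is a binomial coefficient over
  \<open>n ^ (r - 1)\<close> with t <= r - 1. Inside the circle geometric decay beats the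
  polynomial.\<close>

lemma block_entry_convergent:
  assumes N: "(N, z) \<in> set n_as" "t < N" and ev: "eigenvalue Cc z"
  shows "convergent (\<lambda>n. of_real (c n) * (inverse (ph z) ^ n * (of_nat (n choose t) * z ^ (n - t))))"
    (is "convergent ?f")
proof (cases "cmod z = \<rho>")
  case True
  have "N \<le> r" using block_le_max_block N True by blast
  then have t: "t \<le> r - 1" "r \<ge> 1" using N by auto
  obtain a where a: "(\<lambda>n. real (n choose t) / real n ^ (r - 1)) \<longlonglongrightarrow> a"
    using binomial_over_power_convergent[OF t(1)] by (auto simp: convergent_def)
  let ?K = "of_real (fact (r - 1) * \<rho> powi (int r - 1) / \<rho> ^ t) * inverse (ph z) ^ t"
  have "(\<lambda>n. ?K * of_real (real (n choose t) / real n ^ (r - 1))) \<longlonglongrightarrow> ?K * of_real a"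
    by (intro tendsto_intros a)
  moreover have "\<forall>\<^sub>F n in sequentially. ?K * of_real (real (n choose t) / real n ^ (r - 1)) = ?f n"
    using eventually_ge_at_top[of "Suc t"]
  proof eventually_elim
    case (elim n)
    have z: "z = of_real \<rho> * ph z" using True ev rho_pos by (simp add: phase_def)
    have n: "n = t + (n - t)" using elim by simp
    have "inverse (ph z) ^ n * z ^ (n - t) = inverse (ph z) ^ t * (inverse (ph z) ^ (n - t) * (of_real \<rho> * ph z) ^ (n - t))"
      by (subst n, subst (2) z) (simp add: power_add)
    also have "\<dots> = inverse (ph z) ^ t * of_real \<rho> ^ (n - t)"
      using phase_nonzero[of z] by (simp add: power_mult_distrib field_simps)
    finally have 1: "inverse (ph z) ^ n * z ^ (n - t) = inverse (ph z) ^ t * of_real \<rho> ^ (n - t)" .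
    have "\<rho> ^ n = \<rho> ^ t * \<rho> ^ (n - t)" using elim by (simp flip: power_add)
    then have 2: "c n * \<rho> ^ (n - t) = fact (r - 1) * \<rho> powi (int r - 1) / \<rho> ^ t / real n ^ (r - 1)"
      unfolding growth_coeff_eq using rho_pos by simp
    have "?f n = of_real (c n * \<rho> ^ (n - t)) * inverse (ph z) ^ t * of_nat (n choose t)"
      using 1 by (simp add: mult_ac)
    then show ?case unfolding 2 by simp
  qed
  ultimately show ?thesis by (rule convergentI[OF Lim_transform_eventually])
next
  case False
  then have lt: "cmod z < \<rho>" using eigenvalue_norm_le[OF ev] by simp
  \<comment> \<open>The midpoint lies strictly below rho and is positive even for z = 0, so that
    division by \<open>q ^ t\<close> is possible.\<close>
  define q where "q = (cmod z + \<rho>) / 2"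
  have q: "cmod z \<le> q" "0 < q" "q < \<rho>" using lt rho_pos norm_ge_zero[of z] add_nonneg_pos[OF norm_ge_zero rho_pos, of z] by (auto simp: q_def)
  let ?K = "fact (r - 1) * \<rho> powi (int r - 1) / q ^ t"
  have "?f \<longlonglongrightarrow> 0"
  proof (rule Lim_null_comparison)
    show "\<forall>\<^sub>F n in sequentially. norm (?f n) \<le> ?K * (real n ^ t * (q / \<rho>) ^ n)"
      using eventually_ge_at_top[of "Suc t"]
    proof eventually_elim
      case (elim n)
      have "norm (?f n) = c n * (real (n choose t) * cmod z ^ (n - t))"
        using growth_coeff_pos[of n] elim
        by (simp add: norm_mult norm_power norm_inverse phase_norm abs_of_pos)
      also have "\<dots> \<le> c n * (real n ^ t * q ^ (n - t))"
      proof (intro mult_left_mono mult_mono power_mono)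
        show "real (n choose t) \<le> real n ^ t"
          using binomial_le_pow[of t n] elim by (simp flip: of_nat_power)
      qed (use q growth_coeff_pos[of n] elim in auto)
      also have "\<dots> \<le> fact (r - 1) * \<rho> powi (int r - 1) / \<rho> ^ n * (real n ^ t * q ^ (n - t))"
      proof (rule mult_right_mono)
        have "c n = fact (r - 1) * \<rho> powi (int r - 1) / \<rho> ^ n / real n ^ (r - 1)"
          by (simp add: growth_coeff_eq)
        also have "\<dots> \<le> fact (r - 1) * \<rho> powi (int r - 1) / \<rho> ^ n / 1"
          using rho_pos elim by (intro divide_left_mono) auto
        finally show "c n \<le> fact (r - 1) * \<rho> powi (int r - 1) / \<rho> ^ n" by simp
      qed (use q in auto)
      also have "q ^ (n - t) = q ^ n / q ^ t" using q elim by (intro power_diff) auto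
      also have "fact (r - 1) * \<rho> powi (int r - 1) / \<rho> ^ n * (real n ^ t * (q ^ n / q ^ t)) =
          ?K * (real n ^ t * (q / \<rho>) ^ n)"
        by (simp add: power_divide)
      finally show ?case .
    qed
    have "(\<lambda>n. ?K * (real n ^ t * (q / \<rho>) ^ n)) \<longlonglongrightarrow> ?K * 0"
      using q rho_pos by (intro tendsto_mult tendsto_const power_times_geometric_tendsto_0) auto
    then show "(\<lambda>n. ?K * (real n ^ t * (q / \<rho>) ^ n)) \<longlonglongrightarrow> 0" by simp
  qed
  then show ?thesis by (rule convergentI)
qed

lemma inv_rotation:
  shows "R \<in> carrier_mat d d" and "cmat R = spectral_fun (\<lambda>z. inverse (ph z))"
    and "x \<in> V.orth_compl \<Longrightarrow> R *\<^sub>v x = x"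
  unfolding inv_rotation_def by (auto intro!: rotation_spectral_fun simp: phase_zero phase_cnj)

lemma R_carrier [simp]: "R \<in> carrier_mat d d" "dim_row R = d" "dim_col R = d"
  using inv_rotation(1) by auto

lemma L_carrier [simp]: "L \<in> carrier_mat d d" by (simp add: limit_mat_def)

lemma cmat_R_pow: "cmat (R ^\<^sub>m n) = spectral_fun (\<lambda>z. inverse (ph z) ^ n)"
  using of_real_hom.mat_hom_pow[OF inv_rotation(1), where 'a = complex, of n]
  by (simp add: inv_rotation(2) spectral_fun_pow)

text \<open>The entries of \<open>limit_mat\<close> are values of \<open>lim\<close> and mean
  something only once convergence is known. In Jordan coordinates each entry is a finite combination
  of the sequences treated in \<open>block_entry_convergent\<close>.\<close>

lemma limit_mat_tendsto:
  "entries_tendsto d (\<lambda>n. c n \<cdot>\<^sub>m (R ^\<^sub>m n * C ^\<^sub>m n)) L"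
  unfolding entries_tendsto_def
proof (intro allI impI)
  fix i j assume ij: "i < d" "j < d"
  have carr: "R ^\<^sub>m n * C ^\<^sub>m n \<in> carrier_mat d d" for n
    by (intro mult_carrier_mat[of _ d d]) (auto intro!: pow_carrier_mat)
  let ?D = "\<lambda>n. diag_fun (\<lambda>z. inverse (ph z) ^ n)"
  have Jp: "J ^\<^sub>m n \<in> carrier_mat d d" for n by (intro pow_carrier_mat) simp
  have DJ: "?D n * J ^\<^sub>m n \<in> carrier_mat d d" for n by (rule mult_carrier_mat[OF diag_fun_carrier Jp])
  have "cmat (R ^\<^sub>m n * C ^\<^sub>m n) = S * (?D n * J ^\<^sub>m n) * S'" for n
  proof -
    have "cmat (R ^\<^sub>m n * C ^\<^sub>m n) = cmat (R ^\<^sub>m n) * cmat (C ^\<^sub>m n)"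
      by (intro of_real_hom.mat_hom_mult[of _ d d _ d]) (auto intro!: pow_carrier_mat)
    also have "\<dots> = spectral_fun (\<lambda>z. inverse (ph z)) ^\<^sub>m n * Cc ^\<^sub>m n"
      unfolding cmat_R_pow spectral_fun_pow by (simp add: of_real_hom.mat_hom_pow[of _ d])
    finally show ?thesis by (simp add: spectral_fun_pow_mult_pow)
  qed
  then have entry: "complex_of_real (c n * (R ^\<^sub>m n * C ^\<^sub>m n) $$ (i,j)) =
      (\<Sum>b = 0..<d. (\<Sum>a = 0..<d. S $$ (i,a) *
        (of_real (c n) * (inverse (ph (J $$ (a,a))) ^ n * (J ^\<^sub>m n) $$ (a,b)))) * S' $$ (b,j))" for n
  proof -
    have "complex_of_real ((R ^\<^sub>m n * C ^\<^sub>m n) $$ (i,j)) = cmat (R ^\<^sub>m n * C ^\<^sub>m n) $$ (i,j)"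
      using carr[of n, THEN carrier_matD(1)] carr[of n, THEN carrier_matD(2)] ij by (subst index_map_mat) auto
    also have "\<dots> = (S * (?D n * J ^\<^sub>m n) * S') $$ (i,j)" by (simp only: \<open>cmat (R ^\<^sub>m n * C ^\<^sub>m n) = _\<close>)
    also have "\<dots> = (\<Sum>b = 0..<d. (S * (?D n * J ^\<^sub>m n)) $$ (i,b) * S' $$ (b,j))"
      using ij by (subst index_mult_mat) (auto simp: scalar_prod_def)
    also have "\<dots> = (\<Sum>b = 0..<d. (\<Sum>a = 0..<d. S $$ (i,a) * (?D n * J ^\<^sub>m n) $$ (a,b)) * S' $$ (b,j))"
      using ij DJ[of n, THEN carrier_matD(1)] DJ[of n, THEN carrier_matD(2)]
      by (intro sum.cong refl arg_cong2[where f = "(*)"], subst index_mult_mat) (auto simp: scalar_prod_def)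
    also have "\<dots> = (\<Sum>b = 0..<d. (\<Sum>a = 0..<d. S $$ (i,a) *
        (inverse (ph (J $$ (a,a))) ^ n * (J ^\<^sub>m n) $$ (a,b))) * S' $$ (b,j))"
      by (intro sum.cong refl arg_cong2[where f = "(*)"]) (auto simp: diag_fun_mult_entry(1)[OF Jp])
    finally show ?thesis by (simp add: sum_distrib_left sum_distrib_right mult_ac)
  qed
  have conv: "convergent (\<lambda>n. of_real (c n) * (inverse (ph (J $$ (a,a))) ^ n * (J ^\<^sub>m n) $$ (a,b)))"
    if ab: "a < d" "b < d" for a b
  proof -
    have "a < sum_list (map fst n_as)" "b < sum_list (map fst n_as)" using ab by simp_all
    from jordan_matrix_pow_entry[OF this] show ?thesis
    proof (elim disjE exE conjE)
      fix N z t assume *: "(N, z) \<in> set n_as" "t < N" "J $$ (a,a) = z"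
        "\<forall>m. (J ^\<^sub>m m) $$ (a,b) = of_nat (m choose t) * z ^ (m - t)"
      have "eigenvalue Cc z" using diagonal_eigenvalue[OF ab(1)] *(3) by simp
      from block_entry_convergent[OF *(1,2) this] show ?thesis unfolding *(3) by (simp only: *(4))
    qed (simp add: convergent_const)
  qed
  have "convergent (\<lambda>n. complex_of_real (c n * (R ^\<^sub>m n * C ^\<^sub>m n) $$ (i,j)))"
    unfolding entry
  proof (rule convergent_sum)
    fix b assume "b \<in> {0..<d}"
    then have "convergent (\<lambda>n. \<Sum>a = 0..<d. S $$ (i,a) *
        (of_real (c n) * (inverse (ph (J $$ (a,a))) ^ n * (J ^\<^sub>m n) $$ (a,b))))"
      by (intro convergent_sum convergent_mult[OF convergent_const conv]) auto
    then show "convergent (\<lambda>n. (\<Sum>a = 0..<d. S $$ (i,a) *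
        (of_real (c n) * (inverse (ph (J $$ (a,a))) ^ n * (J ^\<^sub>m n) $$ (a,b)))) * S' $$ (b,j))"
      by (intro convergent_mult convergent_const)
  qed
  then have "convergent (\<lambda>n. Re (complex_of_real (c n * (R ^\<^sub>m n * C ^\<^sub>m n) $$ (i,j))))"
    by (auto simp only: convergent_def intro: tendsto_Re)
  then have "(\<lambda>n. c n * (R ^\<^sub>m n * C ^\<^sub>m n) $$ (i,j)) \<longlonglongrightarrow> L $$ (i,j)"
    using ij by (simp add: limit_mat_def convergent_LIMSEQ_iff)
  then show "(\<lambda>n. (c n \<cdot>\<^sub>m (R ^\<^sub>m n * C ^\<^sub>m n)) $$ (i, j)) \<longlonglongrightarrow> L $$ (i, j)"
    using ij carr[THEN carrier_matD(1)] carr[THEN carrier_matD(2)] by (subst index_smult_mat) auto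
qed

end

section \<open>Recurrence and limits along the phase group\<close>

text \<open>The powers stay in the closed unit disc; compactness yields one further subsequence for
  each element of \<open>E\<close>.\<close>

lemma simultaneously_convergent_powers:
  fixes g :: "'b \<Rightarrow> complex"
  assumes "finite E" "\<And>z. cmod (g z) = 1"
  shows "\<exists>s :: nat \<Rightarrow> nat. strict_mono s \<and> (\<forall>z\<in>E. convergent (\<lambda>j. g z ^ s j))"
  using assms(1)
proof (induction rule: finite_induct)
  case empty
  then show ?case using strict_mono_id by auto
next
  case (insert z E)
  then obtain s :: "nat \<Rightarrow> nat" where s: "strict_mono s" "\<And>w. w \<in> E \<Longrightarrow> convergent (\<lambda>j. g w ^ s j)" by auto
  have "g z ^ s j \<in> cball 0 1" for j by (simp add: norm_power assms(2))
  then obtain l t where t: "strict_mono t" "((\<lambda>j. g z ^ s j) \<circ> t) \<longlonglongrightarrow> l"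
    using compact_cball[of "0 :: complex" 1] unfolding compact_eq_seq_compact_metric seq_compact_def by metis
  have "convergent (\<lambda>j. g w ^ s (t j))" if "w \<in> E" for w
    using LIMSEQ_subseq_LIMSEQ[OF _ t(1)] s(2)[OF that] unfolding convergent_def comp_def by blast
  moreover have "convergent (\<lambda>j. g z ^ s (t j))" using t(2) by (auto simp: convergent_def comp_def)
  moreover have "strict_mono (\<lambda>j. s (t j))" using strict_mono_o[OF s(1) t(1)] by (simp add: comp_def)
  ultimately show ?case by (intro exI[of _ "\<lambda>j. s (t j)"]) auto
qed

text \<open>Along a subsequence on which all powers converge, two late powers are close to each
  other. Since all moduli are 1, the difference of their exponents gives powers close to 1.\<close>

lemma simultaneous_recurrence:
  fixes g :: "'b \<Rightarrow> complex"
  assumes "finite E" "\<And>z. cmod (g z) = 1" and "\<epsilon> > 0"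
  shows "\<exists>n\<ge>N. \<forall>z\<in>E. cmod (g z ^ n - 1) < \<epsilon>"
proof -
  obtain s :: "nat \<Rightarrow> nat" where s: "strict_mono s" "\<And>z. z \<in> E \<Longrightarrow> convergent (\<lambda>j. g z ^ s j)"
    using simultaneously_convergent_powers[of E g, OF assms(1,2)] by blast
  have "\<forall>z\<in>E. \<forall>\<^sub>F M in sequentially. \<forall>i\<ge>M. \<forall>j\<ge>M. dist (g z ^ s i) (g z ^ s j) < \<epsilon>"
  proof
    fix z assume "z \<in> E"
    then have "Cauchy (\<lambda>j. g z ^ s j)" using s(2) convergent_Cauchy by blast
    then obtain M where "\<forall>i\<ge>M. \<forall>j\<ge>M. dist (g z ^ s i) (g z ^ s j) < \<epsilon>"
      using assms(3) unfolding Cauchy_def by blast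
    then show "\<forall>\<^sub>F M in sequentially. \<forall>i\<ge>M. \<forall>j\<ge>M. dist (g z ^ s i) (g z ^ s j) < \<epsilon>"
      unfolding eventually_sequentially by (meson order_trans)
  qed
  then have "\<forall>\<^sub>F M in sequentially. \<forall>z\<in>E. \<forall>i\<ge>M. \<forall>j\<ge>M. dist (g z ^ s i) (g z ^ s j) < \<epsilon>"
    using assms(1) by (rule eventually_ball_finite[rotated])
  then obtain M where M: "\<And>z i j. z \<in> E \<Longrightarrow> i \<ge> M \<Longrightarrow> j \<ge> M \<Longrightarrow> dist (g z ^ s i) (g z ^ s j) < \<epsilon>"
    unfolding eventually_sequentially by blast
  \<comment> \<open>A strictly increasing sequence satisfies \<open>i \<le> s i\<close>. The index
    is chosen large enough for the difference of the two exponents to be at least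
    \<open>N\<close>.\<close>
  have "M + (s M + N) \<le> s (M + (s M + N))" using strict_mono_imp_increasing[OF s(1)] by blast
  then have le: "s M + N \<le> s (M + (s M + N))" by linarith
  define n where "n = s (M + (s M + N)) - s M"
  have "cmod (g z ^ n - 1) < \<epsilon>" if "z \<in> E" for z
  proof -
    have "g z ^ s (M + (s M + N)) - g z ^ s M = g z ^ s M * (g z ^ n - 1)"
      using le by (simp add: n_def algebra_simps flip: power_add)
    then have "cmod (g z ^ n - 1) = dist (g z ^ s (M + (s M + N))) (g z ^ s M)"
      by (simp add: dist_norm norm_mult norm_power assms(2))
    also have "\<dots> < \<epsilon>" using that by (intro M) auto
    finally show ?thesis .
  qed
  moreover have "n \<ge> N" using le by (simp add: n_def)
  ultimately show ?thesis by blast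
qed

lemma tendsto_fun_pointwise:
  fixes f :: "'b \<Rightarrow> 'i \<Rightarrow> 'a :: topological_space"
  assumes "\<And>i. ((\<lambda>x. f x i) \<longlongrightarrow> l i) F"
  shows "(f \<longlongrightarrow> l) F"
proof -
  have "limitin (product_topology (\<lambda>i. euclidean) UNIV) f l F"
    unfolding limitin_componentwise using assms by simp
  then show ?thesis by (simp add: euclidean_product_topology)
qed

text \<open>Approximating h in the closure gives an exponent m that need not be large. Adding a
  recurrence exponent p >= N makes it large at little cost. Outside \<open>E\<close> all powers are
  1 and so is h, which leaves finitely many coordinates to control.\<close>

lemma closure_powers_sequence:
  fixes g h :: "'b \<Rightarrow> complex"
  assumes "finite E" "\<And>z. cmod (g z) = 1" "\<And>z. z \<notin> E \<Longrightarrow> g z = 1"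
    and h: "h \<in> closure (range (\<lambda>n :: nat. \<lambda>z. g z ^ n))"
  shows "\<exists>s :: nat \<Rightarrow> nat. filterlim s at_top sequentially \<and> (\<forall>z. (\<lambda>j. g z ^ s j) \<longlonglongrightarrow> h z)"
proof -
  have near: "\<exists>n\<ge>N. \<forall>z\<in>F. cmod (g z ^ n - h z) < \<epsilon>" if "finite F" "\<epsilon> > 0" for F \<epsilon> N
  proof -
    have "open {f :: 'b \<Rightarrow> complex. cmod (f z - h z) < \<epsilon> / 2}" for z
      by (intro open_Collect_less continuous_intros continuous_on_product_coordinates)
    then have "open (\<Inter>z\<in>F. {f :: 'b \<Rightarrow> complex. cmod (f z - h z) < \<epsilon> / 2})" (is "open ?U")
      using \<open>finite F\<close> by (intro open_INT) auto
    moreover have "h \<in> ?U" using that by simp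
    ultimately obtain m :: nat where m: "(\<lambda>z. g z ^ m) \<in> ?U"
      using h open_Int_closure_eq_empty[of ?U "range (\<lambda>n z. g z ^ n)"] by blast
    have "\<epsilon> / 2 > 0" using that by simp
    from simultaneous_recurrence[of F g "\<epsilon> / 2" N, OF that(1) assms(2) this]
    obtain p where p: "p \<ge> N" "\<And>z. z \<in> F \<Longrightarrow> cmod (g z ^ p - 1) < \<epsilon> / 2" by blast
    have "cmod (g z ^ (m + p) - h z) < \<epsilon>" if "z \<in> F" for z
    proof -
      have "g z ^ (m + p) - h z = g z ^ m * (g z ^ p - 1) + (g z ^ m - h z)"
        by (simp add: power_add algebra_simps)
      also have "cmod \<dots> \<le> cmod (g z ^ m * (g z ^ p - 1)) + cmod (g z ^ m - h z)" by (rule norm_triangle_ineq)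
      also have "cmod (g z ^ m * (g z ^ p - 1)) = cmod (g z ^ p - 1)"
        by (simp add: norm_mult norm_power assms(2))
      also have "cmod (g z ^ p - 1) + cmod (g z ^ m - h z) < \<epsilon> / 2 + \<epsilon> / 2"
        using m p(2) that by (intro add_strict_mono) auto
      finally show ?thesis by simp
    qed
    then show ?thesis using p(1) by (intro exI[of _ "m + p"]) auto
  qed
  have "\<exists>n\<ge>j. \<forall>z\<in>E. cmod (g z ^ n - h z) < 1 / real (Suc j)" for j
    using near[OF assms(1)] by simp
  then obtain s where s: "\<And>j. s j \<ge> j" "\<And>j z. z \<in> E \<Longrightarrow> cmod (g z ^ s j - h z) < 1 / real (Suc j)"
    by metis
  have "filterlim s at_top sequentially"
    using s(1) by (intro filterlim_at_top_mono[OF filterlim_ident]) auto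
  moreover have "(\<lambda>j. g z ^ s j) \<longlonglongrightarrow> h z" for z
  proof (cases "z \<in> E")
    case True
    have "(\<lambda>j. g z ^ s j - h z) \<longlonglongrightarrow> 0"
    proof (rule Lim_null_comparison)
      show "\<forall>\<^sub>F j in sequentially. norm (g z ^ s j - h z) \<le> 1 / real (Suc j)"
        using s(2)[OF True] by (auto intro: always_eventually less_imp_le)
      show "(\<lambda>j. 1 / real (Suc j)) \<longlonglongrightarrow> 0" using LIMSEQ_inverse_real_of_nat by (simp add: inverse_eq_divide)
    qed
    then show ?thesis by (rule LIM_zero_cancel)
  next
    case False
    have "h z = 1"
    proof (rule ccontr)
      assume "h z \<noteq> 1"
      then have "0 < cmod (1 - h z)" by simp
      from near[of "{z}", OF _ this] assms(3)[OF False] show False by auto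
    qed
    then show ?thesis using assms(3)[OF False] by simp
  qed
  ultimately show ?thesis by blast
qed

lemma cmat_smult: "cmat (a \<cdot>\<^sub>m X) = complex_of_real a \<cdot>\<^sub>m cmat X"
  by (intro eq_matI) auto

context growing_family
begin

lemma finite_phase_support: "finite {z. eigenvalue Cc z}" "ph z \<noteq> 1 \<Longrightarrow> eigenvalue Cc z"
  using card_finite_spectrum(1)[OF carriers(4)] by (auto simp: spectrum_def phase_def split: if_splits)

lemma phase_group_sequence:
  assumes "h \<in> phase_group k d u A"
  obtains s where "filterlim s at_top sequentially" "\<And>z. (\<lambda>j. ph z ^ s j) \<longlonglongrightarrow> h z"
  using closure_powers_sequence[OF finite_phase_support(1) phase_norm _ assms[unfolded phase_group_def]]
    finite_phase_support(2) by blast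

lemma phase_limit_properties:
  assumes "\<And>z. (\<lambda>j. ph z ^ s j) \<longlonglongrightarrow> h z"
  shows "h 0 = 1" "h (cnj z) = cnj (h z)"
proof -
  have "(\<lambda>j. 1) \<longlonglongrightarrow> h 0" using assms[of 0] by (simp add: phase_zero)
  then show "h 0 = 1" using LIMSEQ_unique tendsto_const by blast
  have "(\<lambda>j. cnj (ph z ^ s j)) \<longlonglongrightarrow> cnj (h z)" by (intro tendsto_cnj assms)
  then show "h (cnj z) = cnj (h z)"
    using LIMSEQ_unique[OF assms[of "cnj z"]] by (simp add: phase_cnj)
qed

lemma spectral_fun_tendsto:
  assumes "\<And>z. (\<lambda>j. f j z) \<longlonglongrightarrow> h z"
  shows "entries_tendsto d (\<lambda>j. spectral_fun (f j)) (spectral_fun h)"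
  unfolding spectral_fun_def
proof (intro entries_tendsto_mult entries_tendsto_const)
  show "entries_tendsto d (\<lambda>j. diag_fun (f j)) (diag_fun h)"
    using assms by (auto simp: entries_tendsto_def diag_fun_def)
qed (auto intro!: mult_carrier_mat[of _ d d])

lemma R_C_commute: "R * C = C * R"
proof (rule of_real_hom.mat_hom_inj)
  show "cmat (R * C) = cmat (C * R)"
    by (simp add: of_real_hom.mat_hom_mult[of _ d d _ d] inv_rotation(2) spectral_fun_commute)
qed

text \<open>\<open>R\<close> fixes the orthogonal complement of V pointwise, so the residual of x is
  still annihilated by the projection after \<open>R\<close> has been applied. In transposed form
  this is the stability of V in \<open>row_orbit_R\<close>.\<close>

lemma orth_proj_R: "V.P * R * V.P = V.P * R"
proof (rule eq_mat_vecI[of _ d d])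
  fix x :: "real vec" assume x: "x \<in> carrier_vec d"
  have Px: "V.P *\<^sub>v x \<in> carrier_vec d" using x by (simp add: mult_mat_vec_carrier[of _ d d])
  have Rx: "R *\<^sub>v y \<in> carrier_vec d" if "y \<in> carrier_vec d" for y using that by (simp add: mult_mat_vec_carrier[of _ d d])
  define q where "q = x - V.P *\<^sub>v x"
  have q: "q \<in> V.orth_compl" "q \<in> carrier_vec d" using V.orth_proj(3)[OF x] x Px by (auto simp: q_def)
  have xq: "x = V.P *\<^sub>v x + q" using x Px by (intro eq_vecI) (auto simp: q_def simp del: index_mult_mat_vec)
  have "V.P *\<^sub>v (R *\<^sub>v x) = V.P *\<^sub>v (R *\<^sub>v (V.P *\<^sub>v x) + R *\<^sub>v q)"
    by (subst xq) (simp add: mult_add_distrib_mat_vec[OF inv_rotation(1) Px q(2)])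
  also have "\<dots> = V.P *\<^sub>v (R *\<^sub>v (V.P *\<^sub>v x)) + V.P *\<^sub>v q"
    using inv_rotation(3)[OF q(1)] Rx[OF Px] q(2) by (simp add: mult_add_distrib_mat_vec[of _ d d])
  also have "\<dots> = V.P *\<^sub>v (R *\<^sub>v (V.P *\<^sub>v x))"
    using V.orth_proj_on_orth_compl[OF q(1)] Rx[OF Px] by (simp add: mult_mat_vec_carrier[of _ d d])
  finally show "(V.P * R * V.P) *\<^sub>v x = (V.P * R) *\<^sub>v x"
    using x Px by (simp add: assoc_mat_vec mult_carrier_mat[of _ d d])
qed (auto intro!: mult_carrier_mat[of _ d d])

lemma orth_proj_R_C: "V.P * (R * C) = R * C"
proof -
  have "V.P * (R * C) = V.P * C * R"
    unfolding R_C_commute by (simp add: assoc_mat)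
  then show ?thesis by (simp add: orth_proj_compressed R_C_commute)
qed

lemma row_orbit_R:
  assumes "z \<in> V"
  shows "transpose_mat R *\<^sub>v z \<in> V"
proof (rule V.mem_if_orth_proj_fixes)
  have z: "z \<in> carrier_vec d" using assms V.carr by auto
  have "transpose_mat (V.P * R * V.P) = V.P * (transpose_mat R * V.P)"
    by (simp add: transpose_mult[of _ d d _ d] V.orth_proj_symmetric mult_carrier_mat[of _ d d])
  moreover have "transpose_mat (V.P * R) = transpose_mat R * V.P"
    by (simp add: transpose_mult[of _ d d _ d] V.orth_proj_symmetric)
  ultimately have *: "V.P * (transpose_mat R * V.P) = transpose_mat R * V.P" by (simp only: orth_proj_R)
  have "V.P *\<^sub>v (transpose_mat R *\<^sub>v z) = V.P *\<^sub>v (transpose_mat R *\<^sub>v (V.P *\<^sub>v z))"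
    by (simp add: V.orth_proj_fixes[OF assms])
  also have "\<dots> = (V.P * (transpose_mat R * V.P)) *\<^sub>v z"
    using z by (simp add: assoc_mat_vec mult_carrier_mat[of _ d d])
  also have "\<dots> = transpose_mat R *\<^sub>v (V.P *\<^sub>v z)"
    unfolding * using z by (simp add: assoc_mat_vec)
  finally show "V.P *\<^sub>v (transpose_mat R *\<^sub>v z) = transpose_mat R *\<^sub>v z"
    by (simp add: V.orth_proj_fixes[OF assms])
  show "transpose_mat R *\<^sub>v z \<in> carrier_vec d" using z by (simp add: mult_mat_vec_carrier[of _ d d])
qed

text \<open>\<open>R * C\<close> is similar to a triangular matrix with diagonal entries z divided
  by the phase of z. These equal rho when z has modulus rho; otherwise the phase is 1 and the
  modulus stays below rho.\<close>

lemma eigenvalue_R_C: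
  assumes "eigenvalue (cmat (R * C)) w"
  shows "w = complex_of_real \<rho> \<or> cmod w < \<rho>"
proof -
  let ?D = "diag_fun (\<lambda>z. inverse (ph z))"
  have c: "?D * J \<in> carrier_mat d d" by (intro mult_carrier_mat[of _ d d]) auto
  have RC: "cmat (R * C) \<in> carrier_mat d d" by (simp add: mult_carrier_mat[of _ d d])
  have "cmat (R * C) = spectral_fun (\<lambda>z. inverse (ph z)) ^\<^sub>m 1 * Cc ^\<^sub>m 1"
    by (simp add: of_real_hom.mat_hom_mult[of _ d d _ d] inv_rotation(2))
  also have "\<dots> = S * (?D * J) * S'"
    unfolding spectral_fun_pow_mult_pow by simp
  finally have "similar_mat (cmat (R * C)) (?D * J)"
    using RC c inverse_mat by (auto simp: similar_mat_def intro!: exI similar_mat_witI[of _ _ d])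
  then have "char_poly (cmat (R * C)) = char_poly (?D * J)" by (rule char_poly_similar)
  also have "\<dots> = (\<Prod>a\<leftarrow>diag_mat (?D * J). [:- a, 1:])"
    using jordan_matrix_upper_triangular[of _ n_as]
    by (intro char_poly_upper_triangular[OF c])
      (auto simp: upper_triangular_def diag_fun_mult_entry(1)[OF carriers(1)] diag_fun_carrier[THEN carrier_matD(1)]
        simp del: index_mult_mat(1))
  finally have "poly (\<Prod>a\<leftarrow>diag_mat (?D * J). [:- a, 1:]) w = 0"
    using assms eigenvalue_root_char_poly[OF RC] by simp
  then obtain i where i: "i < d" "w = (?D * J) $$ (i,i)"
    using c by (auto simp: poly_prod_list prod_list_zero_iff diag_mat_def)
  define z where "z = J $$ (i,i)"
  have w: "w = inverse (ph z) * z" using i by (simp add: diag_fun_mult_entry(1)[OF carriers(1)] z_def)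
  have z: "eigenvalue Cc z" "cmod z \<le> \<rho>"
    using diagonal_eigenvalue[OF i(1)] eigenvalue_norm_le by (auto simp: z_def)
  show ?thesis
  proof (cases "cmod z = \<rho>")
    case True
    then have "z \<noteq> 0" "ph z = z / complex_of_real \<rho>" using z rho_pos by (auto simp: phase_def)
    then show ?thesis unfolding w by simp
  next
    case False
    then show ?thesis unfolding w using z by (simp add: phase_def)
  qed
qed

text \<open>Multiplication by \<open>R * C\<close> sends the n-th normalised power to the next one
  times c(n) / c(n + 1), and this quotient tends to rho.\<close>

lemma R_C_limit_mat: "R * C * L = \<rho> \<cdot>\<^sub>m L"
proof -
  let ?M = "\<lambda>n. c n \<cdot>\<^sub>m (R ^\<^sub>m n * C ^\<^sub>m n)"
  have Rp: "R ^\<^sub>m n \<in> carrier_mat d d" and Cp: "C ^\<^sub>m n \<in> carrier_mat d d" for n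
    by (auto intro!: pow_carrier_mat)
  have M: "?M n \<in> carrier_mat d d" for n using Rp Cp by (auto intro!: mult_carrier_mat[of _ d d])
  have RC: "R * C \<in> carrier_mat d d" by (auto intro!: mult_carrier_mat[of _ d d])
  have step: "R * C * (R ^\<^sub>m n * C ^\<^sub>m n) = R ^\<^sub>m Suc n * C ^\<^sub>m Suc n" for n
  proof -
    have "R * C * (R ^\<^sub>m n * C ^\<^sub>m n) = R * (C * R ^\<^sub>m n) * C ^\<^sub>m n"
      using Rp Cp by (simp add: assoc_mat mult_carrier_mat[of _ d d])
    also have "C * R ^\<^sub>m n = R ^\<^sub>m n * C" by (intro mat_commute_pow[of _ d]) (auto simp: R_C_commute)
    also have "R * (R ^\<^sub>m n * C) * C ^\<^sub>m n = (R * R ^\<^sub>m n) * (C * C ^\<^sub>m n)"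
      using Rp Cp by (simp add: assoc_mat mult_carrier_mat[of _ d d])
    also have "R * R ^\<^sub>m n = R ^\<^sub>m n * R" by (intro mat_commute_pow[of _ d]) auto
    also have "C * C ^\<^sub>m n = C ^\<^sub>m n * C" by (intro mat_commute_pow[of _ d]) auto
    finally show ?thesis by simp
  qed
  have shift: "filterlim Suc at_top sequentially" by (rule filterlim_Suc)
  have "entries_tendsto d (\<lambda>n. R * C * ?M (Suc n)) (R * C * L)"
    using entries_tendsto_compose[OF limit_mat_tendsto shift] RC M
    by (intro entries_tendsto_mult entries_tendsto_const) auto
  moreover have "R * C * ?M (Suc n) = (c (Suc n) / c (Suc n + 1)) \<cdot>\<^sub>m ?M (Suc (Suc n))" for n
  proof -
    have "R * C * ?M (Suc n) = c (Suc n) \<cdot>\<^sub>m (R ^\<^sub>m Suc (Suc n) * C ^\<^sub>m Suc (Suc n))"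
      unfolding step[symmetric] using RC Rp Cp
      by (intro mult_smult_distrib[of _ d d _ d]) (auto intro!: mult_carrier_mat[of _ d d] simp del: pow_mat.simps)
    also have "\<dots> = (c (Suc n) / c (Suc n + 1)) \<cdot>\<^sub>m ?M (Suc (Suc n))"
      using growth_coeff_pos[of "Suc (Suc n)"] by (intro eq_matI) auto
    finally show ?thesis .
  qed
  moreover have "entries_tendsto d (\<lambda>n. (c (Suc n) / c (Suc n + 1)) \<cdot>\<^sub>m ?M (Suc (Suc n))) (\<rho> \<cdot>\<^sub>m L)"
  proof (intro entries_tendsto_smult)
    show "entries_tendsto d (\<lambda>n. ?M (Suc (Suc n))) L"
      by (rule entries_tendsto_compose[OF entries_tendsto_compose[OF limit_mat_tendsto shift] shift])
    show "(\<lambda>n. c (Suc n) / c (Suc n + 1)) \<longlonglongrightarrow> \<rho>"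
      using filterlim_compose[OF growth_coeff_ratio[of 1] shift] by simp
  qed (use M L_carrier in auto)
  ultimately show ?thesis
    by (intro entries_tendsto_unique[of d]) (auto intro!: mult_carrier_mat[of _ d d])
qed

text \<open>The power of C is recovered from the convergent product of powers of \<open>R\<close>
  and C by undoing the rotation, that is, by multiplying with the n-th powers of the phases. Along
  \<open>s\<close> these tend to h, and the correcting matrix tends to the rotation by h.\<close>

lemma scaled_powers_tendsto:
  assumes s: "filterlim s at_top sequentially" and h: "\<And>z. (\<lambda>j. ph z ^ s j) \<longlonglongrightarrow> h z"
  shows "entries_tendsto d (\<lambda>j. c (s j) \<cdot>\<^sub>m C ^\<^sub>m s j) (rot h * L)"
proof -
  note rh = rotation_spectral_fun[OF phase_limit_properties[OF h]]
  let ?M = "\<lambda>n. c n \<cdot>\<^sub>m (R ^\<^sub>m n * C ^\<^sub>m n)"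
  have Rp: "R ^\<^sub>m n \<in> carrier_mat d d" and Cp: "C ^\<^sub>m n \<in> carrier_mat d d" for n
    by (auto intro!: pow_carrier_mat)
  have M: "?M n \<in> carrier_mat d d" for n using Rp Cp by (auto intro!: mult_carrier_mat[of _ d d])
  have "cmat (c n \<cdot>\<^sub>m C ^\<^sub>m n) = spectral_fun (\<lambda>z. ph z ^ n) * cmat (?M n)" for n
  proof -
    have "cmat (?M n) = of_real (c n) \<cdot>\<^sub>m (cmat (R ^\<^sub>m n) * cmat (C ^\<^sub>m n))"
      using Rp Cp by (simp add: of_real_hom.mat_hom_mult[of _ d d _ d] cmat_smult)
    then have "spectral_fun (\<lambda>z. ph z ^ n) * cmat (?M n) =
        of_real (c n) \<cdot>\<^sub>m (spectral_fun (\<lambda>z. ph z ^ n) * spectral_fun (\<lambda>z. inverse (ph z) ^ n) * cmat (C ^\<^sub>m n))"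
      using Rp Cp cmat_R_pow[of n]
      by (simp add: mult_smult_distrib[of _ d d _ d] assoc_mat mult_carrier_mat[of _ d d])
    also have "spectral_fun (\<lambda>z. ph z ^ n) * spectral_fun (\<lambda>z. inverse (ph z) ^ n) = 1\<^sub>m d"
      unfolding spectral_fun_mult using phase_nonzero
      by (simp add: spectral_fun_one flip: power_mult_distrib)
    finally show ?thesis using Cp by (simp add: cmat_smult)
  qed
  moreover have "entries_tendsto d (\<lambda>j. spectral_fun (\<lambda>z. ph z ^ s j) * cmat (?M (s j))) (spectral_fun h * cmat L)"
  proof (intro entries_tendsto_mult spectral_fun_tendsto h)
    have "entries_tendsto d (\<lambda>j. ?M (s j)) L"
      by (rule entries_tendsto_compose[OF limit_mat_tendsto s])
    then show "entries_tendsto d (\<lambda>j. cmat (?M (s j))) (cmat L)"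
      using M by (subst entries_tendsto_of_real_iff) auto
    show "cmat (?M (s j)) \<in> carrier_mat d d" for j using M[of "s j"] by (simp only: map_carrier_mat)
  qed auto
  ultimately have "entries_tendsto d (\<lambda>j. cmat (c (s j) \<cdot>\<^sub>m C ^\<^sub>m s j)) (cmat (rot h * L))"
    using rh(1,2) by (simp add: of_real_hom.mat_hom_mult[of _ d d _ d])
  then show ?thesis
    using Cp rh(1) by (subst (asm) entries_tendsto_of_real_iff) (auto intro!: mult_carrier_mat[of _ d d])
qed

text \<open>Reading a word with l digits after the leading one leaves the exponent
  \<open>s j - l\<close>; its phases tend to h times the l-th inverse powers. Hence the factor
  \<open>R ^\<^sub>m l\<close>.\<close>

lemma rotation_shift:
  assumes h: "\<And>z. (\<lambda>j. ph z ^ s j) \<longlonglongrightarrow> h z" and h': "\<And>z. (\<lambda>j. ph z ^ s' j) \<longlonglongrightarrow> h' z"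
    and eq: "\<And>z. h' z = inverse (ph z) ^ l * h z"
  shows "rot h' = R ^\<^sub>m l * rot h"
proof (rule of_real_hom.mat_hom_inj)
  note rh = rotation_spectral_fun[OF phase_limit_properties[OF h]]
  note rh' = rotation_spectral_fun[OF phase_limit_properties[OF h']]
  have "cmat (R ^\<^sub>m l * rot h) = cmat (R ^\<^sub>m l) * cmat (rot h)"
    using rh(1) by (intro of_real_hom.mat_hom_mult[of _ d d _ d]) (auto intro!: pow_carrier_mat)
  also have "\<dots> = spectral_fun h'"
    unfolding cmat_R_pow rh(2) spectral_fun_mult eq ..
  finally show "cmat (rot h') = cmat (R ^\<^sub>m l * rot h)" using rh'(2) by simp
qed

lemma rotation_R_C_commute:
  assumes h: "\<And>z. (\<lambda>j. ph z ^ s j) \<longlonglongrightarrow> h z"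
  shows "R * C * rot h = rot h * (R * C)"
proof (rule of_real_hom.mat_hom_inj)
  note rh = rotation_spectral_fun[OF phase_limit_properties[OF h]]
  have "spectral_fun f * Cc * spectral_fun h = spectral_fun h * (spectral_fun f * Cc)" for f
  proof -
    have "spectral_fun f * Cc * spectral_fun h = spectral_fun f * (Cc * spectral_fun h)"
      by (rule assoc_mat) auto
    also have "Cc * spectral_fun h = spectral_fun h * Cc" by (rule spectral_fun_commute[symmetric])
    also have "spectral_fun f * (spectral_fun h * Cc) = spectral_fun f * spectral_fun h * Cc"
      by (rule assoc_mat[symmetric]) auto
    also have "spectral_fun f * spectral_fun h = spectral_fun h * spectral_fun f"
      by (simp add: spectral_fun_mult mult.commute)
    also have "spectral_fun h * spectral_fun f * Cc = spectral_fun h * (spectral_fun f * Cc)"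
      by (rule assoc_mat) auto
    finally show ?thesis .
  qed
  then show "cmat (R * C * rot h) = cmat (rot h * (R * C))"
    using rh(1) by (simp add: of_real_hom.mat_hom_mult[of _ d d _ d] mult_carrier_mat[of _ d d]
      inv_rotation(2) rh(2))
qed

end

section \<open>Ghost measures\<close>

lemma space_torus: "space torus = {0..<1}"
  by (simp add: torus_def space_restrict_space)

lemma sets_torus: "X \<in> sets torus \<longleftrightarrow> X \<in> sets borel \<and> X \<subseteq> {0..<1}"
  by (auto simp: torus_def sets_restrict_space_iff)

lemma borel_measurable_torus:
  assumes "continuous_on UNIV (\<phi> :: real \<Rightarrow> real)" "sets M = sets torus"
  shows "\<phi> \<in> borel_measurable M"
proof -
  have "\<phi> \<in> borel_measurable borel" using assms(1) by (rule borel_measurable_continuous_onI)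
  then have "\<phi> \<in> borel_measurable torus"
    unfolding torus_def by (rule measurable_restrict_space1)
  then show ?thesis using assms(2) measurable_cong_sets by blast
qed

text \<open>The arc from x to 1 has centre (x + 1) / 2 and angular half-length pi * (1 - x). A point
  lies in it iff the cosine of its angular distance from the centre exceeds the cosine of the
  half-length.\<close>

lemma cos_arc_iff:
  fixes x y :: real
  assumes "0 \<le> x" "x < 1" "0 \<le> y" "y < 1"
  shows "cos (2 * pi * (y - (x + 1) / 2)) > cos (pi * (1 - x)) \<longleftrightarrow> y > x"
proof -
  define a where "a = pi * (1 - x)"
  define t where "t = 2 * pi * ((x + 1) / 2 - y)"
  have a: "0 < a" "a \<le> pi" using assms by (auto simp: a_def)
  have ta: "t - a = 2 * pi * (x - y)" "t + a = 2 * pi * (1 - y)" by (auto simp: t_def a_def algebra_simps)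
  have t': "2 * pi * (y - (x + 1) / 2) = - t" by (simp add: t_def algebra_simps)
  have lo: "t > - a" using ta(2) assms(4) by (smt (verit) mult_pos_pos pi_gt_zero)
  show ?thesis
  proof (cases "y > x")
    case True
    then have "2 * pi * (x - y) < 0" by (simp add: mult_pos_neg)
    then have "t < a" using ta(1) by linarith
    then have "\<bar>t\<bar> < a" using lo by auto
    then have "cos a < cos \<bar>t\<bar>" using a by (intro cos_monotone_0_pi) auto
    then show ?thesis using True by (simp add: t' a_def)
  next
    case False
    then have "2 * pi * (x - y) \<ge> 0" by simp
    then have ge: "t \<ge> a" using ta(1) by linarith
    have "2 * pi * (1 - y) \<le> 2 * pi * 1" using assms by (intro mult_left_mono) auto
    then have le: "t \<le> 2 * pi - a" using ta(2) by linarith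
    have "cos t \<le> cos a"
    proof (cases "t \<le> pi")
      case True
      then show ?thesis using ge a by (intro cos_monotone_0_pi_le) auto
    next
      case False
      \<comment> \<open>Beyond pi the angle is reflected: 2 * pi - t lies between a and pi, where
        the cosine decreases.\<close>
      have "cos t = cos (2 * pi - t)" by (simp add: cos_diff)
      also have "\<dots> \<le> cos a" using False le a by (intro cos_monotone_0_pi_le) auto
      finally show ?thesis .
    qed
    then show ?thesis using False by (simp add: t' a_def)
  qed
qed

text \<open>The truncated multiples are continuous and, being built from a cosine, have period one.
  They increase to the indicator of the open arc and are bounded by 1, so dominated convergence
  applies.\<close>

lemma integral_arc_approximation:
  assumes "prob_space M" "sets M = sets torus" and x: "0 \<le> x" "x < (1 :: real)"
  shows "(\<lambda>n. lebesgue_integral M (\<lambda>y. min 1 (real n * max 0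
            (cos (2 * pi * (y - (x + 1) / 2)) - cos (pi * (1 - x)))))) \<longlonglongrightarrow> measure M {x<..<1}"
    (is "(\<lambda>n. lebesgue_integral M (?\<phi> n)) \<longlonglongrightarrow> _")
proof -
  interpret prob_space M by fact
  have sp: "space M = {0..<1}" using sets_eq_imp_space_eq[OF assms(2)] by (simp add: space_torus)
  have I: "{x<..<1} \<in> sets M" using x by (auto simp: assms(2) sets_torus)
  have "(\<lambda>n. lebesgue_integral M (?\<phi> n)) \<longlonglongrightarrow> lebesgue_integral M (indicat_real {x<..<1})"
  proof (rule integral_dominated_convergence[where w = "\<lambda>_. 1"])
    show "indicat_real {x<..<1} \<in> borel_measurable M" using I by simp
    show "?\<phi> n \<in> borel_measurable M" for n
      using assms(2) by (intro borel_measurable_torus continuous_intros)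
    show "AE y in M. (\<lambda>n. ?\<phi> n y) \<longlonglongrightarrow> indicat_real {x<..<1} y"
    proof (rule AE_I2)
      fix y assume "y \<in> space M"
      then have y: "0 \<le> y" "y < 1" by (auto simp: sp)
      define e where "e = cos (2 * pi * (y - (x + 1) / 2)) - cos (pi * (1 - x))"
      have e: "e > 0 \<longleftrightarrow> y > x" using cos_arc_iff[OF x y] by (simp add: e_def)
      show "(\<lambda>n. ?\<phi> n y) \<longlonglongrightarrow> indicat_real {x<..<1} y"
      proof (cases "y > x")
        case True
        then have "e > 0" using e by simp
        obtain N where N: "1 / e < real N" using reals_Archimedean2 by blast
        have "\<forall>\<^sub>F n in sequentially. 1 = ?\<phi> n y"
          using eventually_ge_at_top[of N]
        proof eventually_elim
          case (elim n)
          then have "1 / e < real n" using N by linarith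
          then have "1 < real n * e" using \<open>e > 0\<close> by (simp add: field_simps)
          then show ?case using \<open>e > 0\<close> unfolding e_def[symmetric] by simp
        qed
        then have "(\<lambda>n. ?\<phi> n y) \<longlonglongrightarrow> 1" by (rule Lim_transform_eventually[OF tendsto_const])
        then show ?thesis using True y by simp
      next
        case False
        then have "max 0 e = 0" using e by auto
        then have "?\<phi> n y = 0" for n unfolding e_def[symmetric] by simp
        then show ?thesis using False by simp
      qed
    qed
    show "AE y in M. norm (?\<phi> n y) \<le> 1" for n
    proof (rule AE_I2)
      fix y
      have "0 \<le> ?\<phi> n y" "?\<phi> n y \<le> 1" by auto
      then show "norm (?\<phi> n y) \<le> 1" by simp
    qed
  qed simp
  then show ?thesis using I by simp
qed

text \<open>Periodic test functions determine the mass of every open arc that ends at 1, hence that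
  of the complementary segments starting at 0. After transport to the real line these masses are the
  distribution function.\<close>

lemma torus_measure_eqI:
  assumes M: "prob_space M" "sets M = sets torus" and N: "prob_space N" "sets N = sets torus"
    and eq: "\<And>\<phi> :: real \<Rightarrow> real. continuous_on UNIV \<phi> \<Longrightarrow> (\<And>x. \<phi> (x + 1) = \<phi> x) \<Longrightarrow>
      lebesgue_integral M \<phi> = lebesgue_integral N \<phi>"
  shows "M = N"
proof -
  have arc: "measure M {x<..<1} = measure N {x<..<1}" if x: "0 \<le> x" "x < (1 :: real)" for x
  proof -
    let ?\<phi> = "\<lambda>n y. min 1 (real n * max 0 (cos (2 * pi * (y - (x + 1) / 2)) - cos (pi * (1 - x))))"
    have "lebesgue_integral M (?\<phi> n) = lebesgue_integral N (?\<phi> n)" for n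
    proof (rule eq)
      show "continuous_on UNIV (?\<phi> n)" by (intro continuous_intros)
      fix y :: real
      have "2 * pi * (y + 1 - (x + 1) / 2) = 2 * pi * (y - (x + 1) / 2) + 2 * pi" by (simp add: algebra_simps)
      then show "?\<phi> n (y + 1) = ?\<phi> n y" by (simp only: cos_periodic)
    qed
    then show ?thesis
      using integral_arc_approximation[OF M x] integral_arc_approximation[OF N x] LIMSEQ_unique by simp
  qed
  have rd: "real_distribution (distr K borel (\<lambda>x. x))" "\<And>X. X \<in> sets borel \<Longrightarrow>
      measure (distr K borel (\<lambda>x. x)) X = measure K (X \<inter> {0..<1})"
    "\<And>x. 0 \<le> x \<Longrightarrow> x < 1 \<Longrightarrow> measure K {0..x} = 1 - measure K {x<..<1}"
    if K: "prob_space K" "sets K = sets torus" for K :: "real measure"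
  proof -
    interpret K: prob_space K by fact
    have m: "(\<lambda>x. x) \<in> borel_measurable K" using K(2) by (intro borel_measurable_torus continuous_intros)
    have sp: "space K = {0..<1}" using sets_eq_imp_space_eq[OF K(2)] by (simp add: space_torus)
    show "real_distribution (distr K borel (\<lambda>x. x))" using m by (rule K.real_distribution_distr)
    show "measure (distr K borel (\<lambda>x. x)) X = measure K (X \<inter> {0..<1})" if "X \<in> sets borel" for X
      using measure_distr[OF m that] by (simp add: sp)
    show "measure K {0..x} = 1 - measure K {x<..<1}" if "0 \<le> x" "x < 1" for x
    proof -
      have "{x<..<1} \<in> sets K" using that by (auto simp: K(2) sets_torus)
      moreover have "{0..x} = space K - {x<..<1}" using that by (auto simp: sp)
      ultimately show ?thesis using K.prob_compl by simp
    qed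
  qed
  have "cdf (distr M borel (\<lambda>x. x)) x = cdf (distr N borel (\<lambda>x. x)) x" for x
  proof -
    consider "x < 0" | "0 \<le> x" "x < 1" | "x \<ge> 1" by linarith
    then show ?thesis
    proof cases
      case 1
      then have "{..x} \<inter> {0..<1} = {}" by auto
      then show ?thesis by (simp add: cdf_def rd(2)[OF M] rd(2)[OF N])
    next
      case 2
      then have "{..x} \<inter> {0..<1} = {0..x}" by auto
      then show ?thesis using 2 arc by (simp add: cdf_def rd(2)[OF M] rd(2)[OF N] rd(3)[OF M] rd(3)[OF N])
    next
      case 3
      then have "{..x} \<inter> {0..<1} = {0..<1}" by auto
      moreover have "measure M {0..<1} = 1" "measure N {0..<1} = 1"
        using prob_space.prob_space[OF M(1)] prob_space.prob_space[OF N(1)]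
          sets_eq_imp_space_eq[OF M(2)] sets_eq_imp_space_eq[OF N(2)] by (simp_all add: space_torus)
      ultimately show ?thesis by (simp add: cdf_def rd(2)[OF M] rd(2)[OF N])
    qed
  qed
  then have "distr M borel (\<lambda>x. x) = distr N borel (\<lambda>x. x)"
    using rd(1)[OF M] rd(1)[OF N] by (intro cdf_unique) auto
  then have *: "measure M (X \<inter> {0..<1}) = measure N (X \<inter> {0..<1})" if "X \<in> sets borel" for X
    using rd(2)[OF M that] rd(2)[OF N that] by simp
  show ?thesis
  proof (rule measure_eqI)
    fix X assume "X \<in> sets M"
    then have "X \<in> sets borel" "X \<inter> {0..<1} = X" by (auto simp: M(2) sets_torus)
    then have "measure M X = measure N X" using * by metis
    then show "emeasure M X = emeasure N X"
      using M(1) N(1) by (simp add: finite_measure.emeasure_eq_measure prob_space.finite_measure)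
  qed (simp add: M N)
qed

section \<open>Masses of cells and weak convergence\<close>

lemma integral_block_measure:
  assumes k: "k \<ge> 2" and f: "\<And>n. f n \<ge> 0" and \<phi>: "continuous_on UNIV (\<phi> :: real \<Rightarrow> real)"
  shows "lebesgue_integral (block_measure k f N) \<phi> =
    (\<Sum>n = k ^ N..<k ^ (N + 1). f n / block_sum k f N *
       \<phi> ((real n - real k ^ N) / (real k ^ N * (real k - 1))))"
proof -
  let ?p = "\<lambda>m. real m / (real k ^ N * (real k - 1))"
  let ?w = "\<lambda>m. f (k ^ N + m) / block_sum k f N"
  have le: "k ^ N \<le> k ^ (N + 1)" using k by simp
  have w: "?w m \<ge> 0" for m using f by (auto simp: block_sum_def intro!: divide_nonneg_nonneg sum_nonneg)
  have "?p m \<in> {0..<1}" if "m < k ^ (N + 1) - k ^ N" for m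
  proof -
    have "real m < real (k ^ (N + 1) - k ^ N)" using that by (simp only: of_nat_less_iff)
    also have "\<dots> = real k ^ N * (real k - 1)" using le by (simp add: of_nat_diff algebra_simps)
    finally have "real m < real k ^ N * (real k - 1)" .
    moreover have "real k ^ N * (real k - 1) > 0" using k by simp
    ultimately show ?thesis by (simp add: divide_less_eq)
  qed
  then have p: "?p \<in> measurable (point_measure {..<k ^ (N + 1) - k ^ N} (\<lambda>m. ennreal (?w m))) torus"
    unfolding measurable_point_measure_eq1 by (auto simp: space_torus)
  have "lebesgue_integral (block_measure k f N) \<phi> =
      lebesgue_integral (point_measure {..<k ^ (N + 1) - k ^ N} (\<lambda>m. ennreal (?w m))) (\<lambda>m. \<phi> (?p m))"
    unfolding block_measure_def using p \<phi> by (intro integral_distr borel_measurable_torus) auto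
  also have "\<dots> = (\<Sum>m<k ^ (N + 1) - k ^ N. ?w m * \<phi> (?p m))"
    using w by (subst lebesgue_integral_point_measure_finite) auto
  also have "\<dots> = (\<Sum>n = k ^ N..<k ^ (N + 1). f n / block_sum k f N *
       \<phi> ((real n - real k ^ N) / (real k ^ N * (real k - 1))))"
    using le by (intro sum.reindex_bij_witness[of _ "\<lambda>n. n - k ^ N" "\<lambda>m. k ^ N + m"]) auto
  finally show ?thesis .
qed

text \<open>Words with N + 1 digits, grouped by their leading l + 1 digits.\<close>

lemma block_sum_split:
  fixes k :: nat and F :: "nat \<Rightarrow> real"
  assumes "k \<ge> 2" "l \<le> N"
  shows "(\<Sum>n = k ^ N..<k ^ (N + 1). F n) =
    (\<Sum>n = k ^ l..<k ^ (l + 1). \<Sum>m<k ^ (N - l). F (k ^ (N - l) * n + m) :: real)"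
proof -
  have "k ^ N = k ^ l * k ^ (N - l)" "k ^ (N + 1) = k ^ (l + 1) * k ^ (N - l)"
    using assms(2) power_add[of k l "N - l"] power_add[of k "l + 1" "N - l"] by simp_all
  moreover have "k ^ l \<le> k ^ (l + 1)" using assms by simp
  ultimately show ?thesis by (simp only: sum_blocks)
qed

text \<open>For a word n with l + 1 digits this is the share of the words with N + 1 digits that
  begin with n, in other words the mass that the N-th block measure gives to the cell of n.\<close>

definition block_mass :: "nat \<Rightarrow> (nat \<Rightarrow> real) \<Rightarrow> nat \<Rightarrow> nat \<Rightarrow> nat \<Rightarrow> real" where
  "block_mass k f N l n = (\<Sum>m<k ^ (N - l). f (k ^ (N - l) * n + m)) / block_sum k f N"

lemma sum_block_mass:
  assumes "k \<ge> 2" "l \<le> N" "block_sum k f N \<noteq> 0"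
  shows "(\<Sum>n = k ^ l..<k ^ (l + 1). block_mass k f N l n) = 1"
proof -
  have "(\<Sum>n = k ^ l..<k ^ (l + 1). \<Sum>m<k ^ (N - l). f (k ^ (N - l) * n + m)) = block_sum k f N"
    unfolding block_sum_def by (rule block_sum_split[OF assms(1,2), symmetric])
  then show ?thesis using assms(3) unfolding block_mass_def by (simp flip: sum_divide_distrib)
qed

text \<open>Every point of a cell of level l lies to the right of its left end by less than the cell
  length 1 / (k^l (k - 1)). Moving its weight to the left end changes the integral by at most
  \<epsilon> times the total mass 1.\<close>

lemma integral_block_measure_approx:
  assumes k: "k \<ge> 2" and f: "\<And>n. f n \<ge> 0" and \<phi>: "continuous_on UNIV (\<phi> :: real \<Rightarrow> real)"
    and l: "l \<le> N" and nz: "block_sum k f N \<noteq> 0"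
    and \<epsilon>: "\<And>x y. x \<in> {0..1} \<Longrightarrow> y \<in> {0..1} \<Longrightarrow> \<bar>x - y\<bar> < 1 / (real k ^ l * (real k - 1)) \<Longrightarrow> \<bar>\<phi> x - \<phi> y\<bar> \<le> \<epsilon>"
  shows "\<bar>lebesgue_integral (block_measure k f N) \<phi> -
    (\<Sum>n = k ^ l..<k ^ (l + 1). block_mass k f N l n *
       \<phi> ((real n - real k ^ l) / (real k ^ l * (real k - 1))))\<bar> \<le> \<epsilon>"
proof -
  let ?S = "block_sum k f N" and ?q = "k ^ (N - l)"
  let ?pN = "\<lambda>n. (real n - real k ^ N) / (real k ^ N * (real k - 1))"
  let ?pl = "\<lambda>n. (real n - real k ^ l) / (real k ^ l * (real k - 1))"
  have S: "?S \<ge> 0" using f by (auto simp: block_sum_def intro: sum_nonneg)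
  have kpos: "real k ^ i * (real k - 1) > 0" for i using k by simp
  have kN: "real k ^ N = real k ^ (N - l) * real k ^ l" using l by (simp flip: power_add)
  have close: "\<bar>\<phi> (?pN (?q * n + m)) - \<phi> (?pl n)\<bar> \<le> \<epsilon>" if n: "n \<in> {k ^ l..<k ^ (l + 1)}" and m: "m < ?q" for n m
  proof (rule \<epsilon>)
    have diff: "?pN (?q * n + m) - ?pl n = real m / (real k ^ N * (real k - 1))"
    proof -
      have "real (?q * n + m) - real k ^ N = real k ^ (N - l) * (real n - real k ^ l) + real m"
        unfolding kN by (simp add: algebra_simps)
      then have "?pN (?q * n + m) = real k ^ (N - l) * (real n - real k ^ l) / (real k ^ N * (real k - 1))
          + real m / (real k ^ N * (real k - 1))"
        by (simp only: add_divide_distrib)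
      also have "real k ^ (N - l) * (real n - real k ^ l) / (real k ^ N * (real k - 1)) = ?pl n"
        using k unfolding kN mult.assoc by (subst mult_divide_mult_cancel_left) auto
      finally show ?thesis by simp
    qed
    have mlt: "real m < real k ^ (N - l)" using m by (metis of_nat_less_iff of_nat_power)
    have "real m / (real k ^ N * (real k - 1)) < real k ^ (N - l) / (real k ^ N * (real k - 1))"
      using mlt kpos[of N] by (rule divide_strict_right_mono)
    also have "\<dots> = 1 / (real k ^ l * (real k - 1))"
      using k unfolding kN by simp
    finally have lt: "real m / (real k ^ N * (real k - 1)) < 1 / (real k ^ l * (real k - 1))" .
    have m0: "0 \<le> real m / (real k ^ N * (real k - 1))" using kpos[of N] by (simp add: divide_nonneg_pos)
    show "\<bar>?pN (?q * n + m) - ?pl n\<bar> < 1 / (real k ^ l * (real k - 1))"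
      unfolding diff using lt m0 by (simp only: abs_of_nonneg)
    have "real (k ^ l) \<le> real n" using n by (simp only: of_nat_le_iff) simp
    then have p0: "0 \<le> ?pl n" using kpos[of l] by (simp add: divide_nonneg_pos)
    have "real n + 1 \<le> real (k ^ (l + 1))" using n by (metis Suc_leI atLeastLessThan_iff of_nat_Suc of_nat_le_iff add.commute)
    then have "?pl n + 1 / (real k ^ l * (real k - 1)) \<le> 1"
      using kpos[of l] by (simp add: field_simps flip: add_divide_distrib)
    \<comment> \<open>Here b is the left end of a cell, e the length of the cell, and a a point of
      the cell at distance c from b.\<close>
    moreover have "a \<in> {0..1} \<and> b \<in> {0..1}"
      if "b + e \<le> 1" "0 \<le> b" "a - b = c" "c < e" "0 \<le> c" for a b c e :: real
      using that by simp
    ultimately show "?pN (?q * n + m) \<in> {0..1}" "?pl n \<in> {0..1}"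
      using p0 diff lt m0 by blast+
  qed
  have "lebesgue_integral (block_measure k f N) \<phi> =
      (\<Sum>n = k ^ l..<k ^ (l + 1). \<Sum>m<?q. f (?q * n + m) / ?S * \<phi> (?pN (?q * n + m)))"
    unfolding integral_block_measure[OF k f \<phi>] by (rule block_sum_split[OF k l])
  moreover have "(\<Sum>n = k ^ l..<k ^ (l + 1). block_mass k f N l n * \<phi> (?pl n)) =
      (\<Sum>n = k ^ l..<k ^ (l + 1). \<Sum>m<?q. f (?q * n + m) / ?S * \<phi> (?pl n))"
    by (simp add: block_mass_def sum_divide_distrib sum_distrib_right)
  ultimately have diff: "lebesgue_integral (block_measure k f N) \<phi> -
      (\<Sum>n = k ^ l..<k ^ (l + 1). block_mass k f N l n * \<phi> (?pl n)) =
      (\<Sum>n = k ^ l..<k ^ (l + 1). \<Sum>m<?q. f (?q * n + m) / ?S * (\<phi> (?pN (?q * n + m)) - \<phi> (?pl n)))"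
    by (simp add: right_diff_distrib sum_subtractf)
  have "\<bar>\<Sum>n = k ^ l..<k ^ (l + 1). \<Sum>m<?q. f (?q * n + m) / ?S * (\<phi> (?pN (?q * n + m)) - \<phi> (?pl n))\<bar>
      \<le> (\<Sum>n = k ^ l..<k ^ (l + 1). \<Sum>m<?q. f (?q * n + m) / ?S * \<epsilon>)"
  proof (intro sum_abs[THEN order_trans] sum_mono)
    fix n m assume "n \<in> {k ^ l..<k ^ (l + 1)}" "m \<in> {..<?q}"
    then have "\<bar>\<phi> (?pN (?q * n + m)) - \<phi> (?pl n)\<bar> \<le> \<epsilon>" by (intro close) auto
    moreover have nn: "0 \<le> f (?q * n + m) / ?S" using f S by simp
    ultimately show "\<bar>f (?q * n + m) / ?S * (\<phi> (?pN (?q * n + m)) - \<phi> (?pl n))\<bar> \<le> f (?q * n + m) / ?S * \<epsilon>"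
      unfolding abs_mult abs_of_nonneg[OF nn] by (intro mult_left_mono)
  qed
  also have "\<dots> = (\<Sum>n = k ^ l..<k ^ (l + 1). block_mass k f N l n) * \<epsilon>"
    by (simp only: block_mass_def sum_divide_distrib sum_distrib_right)
  also have "\<dots> = \<epsilon>" using sum_block_mass[OF k l nz] by simp
  finally show ?thesis unfolding diff .
qed

text \<open>Both integrals are compared with one sum over the cells of level l, weighted by the
  limit masses. As masses of one level add up to 1, so do their limits, which yields the block sums
  of \<open>g\<close>. The value at 0 needs its own hypothesis because no cell belongs to 0.\<close>

lemma weak_limit_from_masses:
  assumes k: "k \<ge> 2" and f: "\<And>n. f n \<ge> 0" and s: "filterlim s at_top sequentially"
    and nz: "\<And>j. block_sum k f (s j) \<noteq> 0"
    and w: "weak_conv_torus (\<lambda>j. block_measure k f (s j)) \<mu>" and \<rho>: "\<rho> > 0"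
    and mass: "\<And>l n. k ^ l \<le> n \<Longrightarrow> n < k ^ (l + 1) \<Longrightarrow> (\<lambda>j. block_mass k f (s j) l n) \<longlonglongrightarrow> g n / \<rho> ^ l"
    and g0: "g 0 = 0"
  shows "g n \<ge> 0" "block_sum k g l = \<rho> ^ l" "weak_conv_torus (block_measure k g) \<mu>"
proof -
  have g_nonneg: "g n \<ge> 0" for n
  proof (cases "n = 0")
    case False
    then have "1 \<le> n" by simp
    then obtain l where l: "k ^ l \<le> n" "n < k ^ (l + 1)"
      using ex_power_ivl1[OF k] by blast
    have "0 \<le> g n / \<rho> ^ l"
    proof (rule LIMSEQ_le_const[OF mass[OF l]])
      show "\<exists>N. \<forall>j\<ge>N. 0 \<le> block_mass k f (s j) l n"
        using f by (auto simp: block_mass_def block_sum_def intro!: divide_nonneg_nonneg sum_nonneg)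
    qed
    then have "0 \<le> g n / \<rho> ^ l * \<rho> ^ l" using \<rho> by (intro mult_nonneg_nonneg) auto
    then show ?thesis using \<rho> by simp
  qed (simp add: g0)
  then show "g n \<ge> 0" .
  have sl: "\<forall>\<^sub>F j in sequentially. l \<le> s j" for l using s by (simp add: filterlim_at_top)
  have bs: "block_sum k g l = \<rho> ^ l" for l
  proof -
    have "(\<lambda>j. \<Sum>n = k ^ l..<k ^ (l + 1). block_mass k f (s j) l n) \<longlonglongrightarrow> (\<Sum>n = k ^ l..<k ^ (l + 1). g n / \<rho> ^ l)"
      by (intro tendsto_sum mass) auto
    moreover have "\<forall>\<^sub>F j in sequentially. (\<Sum>n = k ^ l..<k ^ (l + 1). block_mass k f (s j) l n) = 1"
      using sl[of l] by eventually_elim (rule sum_block_mass[OF k _ nz])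
    ultimately have "(\<lambda>j. 1) \<longlonglongrightarrow> (\<Sum>n = k ^ l..<k ^ (l + 1). g n / \<rho> ^ l)"
      by (rule Lim_transform_eventually)
    then have "1 = (\<Sum>n = k ^ l..<k ^ (l + 1). g n / \<rho> ^ l)" by (rule LIMSEQ_unique[OF tendsto_const])
    then show ?thesis using \<rho> by (simp add: block_sum_def field_simps flip: sum_divide_distrib)
  qed
  then show "block_sum k g l = \<rho> ^ l" .
  show "weak_conv_torus (block_measure k g) \<mu>"
    unfolding weak_conv_torus_def
  proof (intro conjI allI impI)
    show "prob_space \<mu>" "sets \<mu> = sets torus" using w by (auto simp: weak_conv_torus_def)
    fix \<phi> :: "real \<Rightarrow> real" assume \<phi>: "continuous_on UNIV \<phi> \<and> (\<forall>x. \<phi> (x + 1) = \<phi> x)"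
    then have lim: "(\<lambda>j. lebesgue_integral (block_measure k f (s j)) \<phi>) \<longlonglongrightarrow> lebesgue_integral \<mu> \<phi>"
      using w by (auto simp: weak_conv_torus_def)
    have c: "continuous_on UNIV \<phi>" using \<phi> by simp
    let ?p = "\<lambda>l n. (real n - real k ^ l) / (real k ^ l * (real k - 1))"
    show "(\<lambda>l. lebesgue_integral (block_measure k g l) \<phi>) \<longlonglongrightarrow> lebesgue_integral \<mu> \<phi>"
    proof (rule LIMSEQ_I)
      fix e :: real assume "e > 0"
      have "uniformly_continuous_on {0..1} \<phi>"
        using c by (intro compact_uniformly_continuous continuous_on_subset[OF c]) auto
      then obtain \<delta> where \<delta>: "\<delta> > 0"
        "\<And>x y. x \<in> {0..1} \<Longrightarrow> y \<in> {0..1} \<Longrightarrow> dist y x < \<delta> \<Longrightarrow> dist (\<phi> y) (\<phi> x) < e / 2"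
        using \<open>e > 0\<close> unfolding uniformly_continuous_on_def by (metis half_gt_zero)
      \<comment> \<open>From level \<open>L\<close> on the cells are shorter than \<delta>.\<close>
      obtain L where L: "1 / \<delta> < real k ^ L" using real_arch_pow[of "real k"] k by auto
      show "\<exists>L. \<forall>l\<ge>L. norm (lebesgue_integral (block_measure k g l) \<phi> - lebesgue_integral \<mu> \<phi>) < e"
      proof (intro exI allI impI)
        fix l assume "L \<le> l"
        then have "real k ^ L \<le> real k ^ l * (real k - 1)"
          using k mult_mono[of "real k ^ L" "real k ^ l" 1 "real k - 1"] by (simp add: power_increasing)
        then have large: "1 / \<delta> < real k ^ l * (real k - 1)" using L by linarith
        have small: "1 / (real k ^ l * (real k - 1)) < \<delta>"
        proof -
          have "0 < real k ^ l * (real k - 1)" using k by simp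
          moreover have "1 < real k ^ l * (real k - 1) * \<delta>"
            using large \<delta>(1) by (simp only: pos_divide_less_eq)
          ultimately show ?thesis by (simp only: pos_divide_less_eq mult.commute)
        qed
        let ?G = "\<Sum>n = k ^ l..<k ^ (l + 1). g n / \<rho> ^ l * \<phi> (?p l n)"
        have approx: "\<forall>\<^sub>F j in sequentially. \<bar>lebesgue_integral (block_measure k f (s j)) \<phi> -
            (\<Sum>n = k ^ l..<k ^ (l + 1). block_mass k f (s j) l n * \<phi> (?p l n))\<bar> \<le> e / 2"
          using sl[of l]
        proof eventually_elim
          case (elim j)
          show ?case
          proof (rule integral_block_measure_approx[OF k f c elim nz])
            fix x y :: real assume "x \<in> {0..1}" "y \<in> {0..1}" "\<bar>x - y\<bar> < 1 / (real k ^ l * (real k - 1))"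
            then show "\<bar>\<phi> x - \<phi> y\<bar> \<le> e / 2"
              using \<delta>(2)[of y x] small by (auto simp: dist_real_def)
          qed
        qed
        have "(\<lambda>j. \<bar>lebesgue_integral (block_measure k f (s j)) \<phi> -
            (\<Sum>n = k ^ l..<k ^ (l + 1). block_mass k f (s j) l n * \<phi> (?p l n))\<bar>) \<longlonglongrightarrow>
            \<bar>lebesgue_integral \<mu> \<phi> - ?G\<bar>"
          by (intro tendsto_intros lim mass) auto
        then have "\<bar>lebesgue_integral \<mu> \<phi> - ?G\<bar> \<le> e / 2"
          using approx by (rule tendsto_upperbound) simp
        moreover have "lebesgue_integral (block_measure k g l) \<phi> = ?G"
          unfolding integral_block_measure[OF k g_nonneg c] bs ..
        ultimately show "norm (lebesgue_integral (block_measure k g l) \<phi> - lebesgue_integral \<mu> \<phi>) < e"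
          using \<open>e > 0\<close> by (simp add: abs_minus_commute)
      qed
    qed
  qed
qed

text \<open>The full sequence of block measures converges, so every subsequence has the same weak
  limit, and weak limits on the circle are unique.\<close>

lemma unique_ghost_measure:
  assumes "\<And>l. block_sum k g l \<noteq> 0" and w: "weak_conv_torus (block_measure k g) \<mu>"
  shows "ghost_measure k g \<nu> \<longleftrightarrow> \<nu> = \<mu>"
proof
  assume "\<nu> = \<mu>"
  then show "ghost_measure k g \<nu>"
    unfolding ghost_measure_def using assms by (intro exI[of _ "\<lambda>j. j"]) (auto simp: strict_mono_def)
next
  assume "ghost_measure k g \<nu>"
  then obtain s :: "nat \<Rightarrow> nat" where s: "strict_mono s" "weak_conv_torus (\<lambda>j. block_measure k g (s j)) \<nu>"
    by (auto simp: ghost_measure_def)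
  show "\<nu> = \<mu>"
  proof (rule torus_measure_eqI)
    fix \<phi> :: "real \<Rightarrow> real" assume \<phi>: "continuous_on UNIV \<phi>" "\<And>x. \<phi> (x + 1) = \<phi> x"
    have "(\<lambda>l. lebesgue_integral (block_measure k g l) \<phi>) \<longlonglongrightarrow> lebesgue_integral \<mu> \<phi>"
      using w \<phi> by (auto simp: weak_conv_torus_def)
    from LIMSEQ_subseq_LIMSEQ[OF this s(1)]
    have "(\<lambda>j. lebesgue_integral (block_measure k g (s j)) \<phi>) \<longlonglongrightarrow> lebesgue_integral \<mu> \<phi>"
      by (simp add: comp_def)
    moreover have "(\<lambda>j. lebesgue_integral (block_measure k g (s j)) \<phi>) \<longlonglongrightarrow> lebesgue_integral \<nu> \<phi>"
      using s(2) \<phi> by (auto simp: weak_conv_torus_def)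
    ultimately show "lebesgue_integral \<nu> \<phi> = lebesgue_integral \<mu> \<phi>" by (rule LIMSEQ_unique[symmetric])
  qed (use s(2) w in \<open>auto simp: weak_conv_torus_def\<close>)
qed

section \<open>Regularity and cell masses\<close>

lemma smult_mat_mult_vec:
  fixes X :: "'a :: comm_semiring_1 mat"
  assumes "X \<in> carrier_mat n m" "x \<in> carrier_vec m"
  shows "(a \<cdot>\<^sub>m X) *\<^sub>v x = a \<cdot>\<^sub>v (X *\<^sub>v x)"
  using assms by (intro eq_vecI) (auto simp: scalar_prod_def sum_distrib_left mult.assoc)

lemma sum_fun_apply: "(\<Sum>i\<in>I. F i) x = (\<Sum>i\<in>I. F i x :: 'b :: comm_monoid_add)"
  by (induction I rule: infinite_finite_induct) auto

context matrix_family
begin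

text \<open>Appending a fixed string of l digits multiplies by a fixed matrix on the right. The
  restriction to n >= 1 reflects that leading zeros contribute no factor: for n = 0 the product
  belongs to r without its padding.\<close>

lemma digit_prod_shift:
  assumes "r < k ^ l"
  shows "\<exists>X \<in> carrier_mat d d. \<forall>n\<ge>1. D (k ^ l * n + r) = D n * X"
  using assms
proof (induction l arbitrary: r)
  case 0
  then show ?case by (intro bexI[of _ "1\<^sub>m d"]) (auto simp: right_mult_one_mat[of _ d d])
next
  case (Suc l)
  have "r div k < k ^ l" using Suc.prems k2 by (simp add: less_mult_imp_div_less mult.commute)
  then obtain X where X: "X \<in> carrier_mat d d" "\<And>n. n \<ge> 1 \<Longrightarrow> D (k ^ l * n + r div k) = D n * X"
    using Suc.IH by blast
  have rk: "r mod k < k" using k2 by simp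
  have "D (k ^ Suc l * n + r) = D n * (X * A (r mod k))" if "n \<ge> 1" for n
  proof -
    have "k ^ Suc l * n + r = k * (k ^ l * n + r div k) + r mod k"
      by (simp add: distrib_left mult.assoc)
    moreover have "1 \<le> k ^ l * n + r div k" using k2 that by (simp add: Suc_le_eq)
    ultimately have "D (k ^ Suc l * n + r) = D n * X * A (r mod k)"
      using digit_prod_append[OF _ rk] X(2)[OF that] by metis
    then show ?thesis using X(1) A[OF rk] by (simp add: assoc_mat)
  qed
  then show ?case using X(1) A[OF rk] by (intro bexI[of _ "X * A (r mod k)"]) auto
qed

text \<open>Away from 0 every element of the kernel is a combination of the d sequences
  \<open>e i\<close>, with coefficients from the appended matrix applied to the right
  vector.\<close>

lemma linear_rep_k_regular:
  assumes "linear_rep k f d u A v"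
  shows "k_regular k f"
proof -
  have v: "v \<in> carrier_vec d" and f: "\<And>n. f n = u \<bullet> (D n *\<^sub>v v)"
    using assms by (auto simp: linear_rep_def)
  define e where "e i = (\<lambda>n. if n = 0 then 0 else u \<bullet> (D n *\<^sub>v unit_vec d i))" for i
  \<comment> \<open>At n = 0 the padding digits are dropped and the value \<open>f r\<close> need
    not follow the pattern of the combination; one further sequence supported at 0 absorbs
    it.\<close>
  define \<delta> where "\<delta> = (\<lambda>n :: nat. if n = 0 then 1 else 0 :: real)"
  let ?S = "insert \<delta> (e ` {0..<d})"
  have "k_kernel k f \<subseteq> seq.span ?S"
  proof
    fix F assume "F \<in> k_kernel k f"
    then obtain l r where F: "F = (\<lambda>n. f (k ^ l * n + r))" and r: "r < k ^ l"
      by (auto simp: k_kernel_def)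
    obtain X where X: "X \<in> carrier_mat d d" "\<And>n. n \<ge> 1 \<Longrightarrow> D (k ^ l * n + r) = D n * X"
      using digit_prod_shift[OF r] by blast
    define y where "y = X *\<^sub>v v"
    have y: "y \<in> carrier_vec d" using X v by (auto simp: y_def)
    have lin: "u \<bullet> (D n *\<^sub>v y) = (\<Sum>i = 0..<d. y $ i * (u \<bullet> (D n *\<^sub>v unit_vec d i)))" for n
    proof -
      let ?z = "transpose_mat (D n) *\<^sub>v u"
      have z: "u \<bullet> (D n *\<^sub>v x) = ?z \<bullet> x" if "x \<in> carrier_vec d" for x
        using that u by (intro scalar_prod_mult_mat_vec[of _ d d]) auto
      have zc: "?z \<in> carrier_vec d" using u by (intro mult_mat_vec_carrier[of _ d d]) auto
      have "?z \<bullet> y = (\<Sum>i = 0..<d. ?z $ i * y $ i)" using y by (simp add: scalar_prod_def)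
      also have "\<dots> = (\<Sum>i = 0..<d. y $ i * (?z \<bullet> unit_vec d i))"
        using zc by (intro sum.cong) (auto simp: mult.commute simp del: index_mult_mat_vec)
      finally show ?thesis using y by (simp add: z)
    qed
    have "F = (\<Sum>i = 0..<d. (\<lambda>n. y $ i * e i n)) + (\<lambda>n. f r * \<delta> n)"
    proof
      fix n
      show "F n = ((\<Sum>i = 0..<d. (\<lambda>n. y $ i * e i n)) + (\<lambda>n. f r * \<delta> n)) n"
      proof (cases "n = 0")
        case False
        then have "F n = u \<bullet> (D n *\<^sub>v y)"
          using X v u by (simp add: F f y_def assoc_mat_vec)
        then show ?thesis using False by (simp add: lin sum_fun_apply e_def \<delta>_def)
      qed (simp add: F sum_fun_apply e_def \<delta>_def)
    qed
    also have "\<dots> \<in> seq.span ?S"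
      by (intro seq.span_add seq.span_sum seq.span_scale seq.span_base) auto
    finally show "F \<in> seq.span ?S" .
  qed
  \<comment> \<open>Regularity asks for equality of spans, not for inclusion. An independent
    spanning subset of the kernel is finite because it lies in the span of a finite set.\<close>
  moreover obtain Z where Z: "Z \<subseteq> k_kernel k f" "seq.independent Z" "k_kernel k f \<subseteq> seq.span Z"
    by (rule seq.maximal_independent_subset)
  ultimately have "finite Z" using seq.independent_span_bound[of ?S Z] by auto
  moreover have "kernel_space k f = seq.span Z"
    unfolding kernel_space_def seq.span_eq using Z(1,3) seq.span_superset[of "k_kernel k f"]
      seq.span_superset[of Z] seq.span_mono[OF Z(1)] by blast
  ultimately show ?thesis by (auto simp: k_regular_def)
qed

text \<open>The range of the transposed compressed matrix lies in the complexification of V. An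
  eigenvector for z nonzero is therefore fixed by the projection, and on fixed vectors the
  transposes of \<open>C\<close> and \<open>T\<close> agree. The spectrum can thus be bounded
  without computing the row orbit space.\<close>

lemma compressed_eigenvalue:
  assumes ev: "eigenvalue (cmat C) z" and z: "z \<noteq> 0"
  obtains q where "q \<in> carrier_vec d" "q \<noteq> 0\<^sub>v d" "cmat (transpose_mat T) *\<^sub>v q = z \<cdot>\<^sub>v q"
proof -
  note Pc = V.orth_proj(1)
  have Ct: "transpose_mat C \<in> carrier_mat d d" "transpose_mat T \<in> carrier_mat d d" by simp_all
  have cCt: "cmat (transpose_mat C) \<in> carrier_mat d d" using Ct by simp
  have "char_poly (cmat (transpose_mat C)) = char_poly (cmat C)"
    using char_poly_transpose_mat[of "cmat C" d] by (simp add: map_mat_transpose)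
  then have "eigenvalue (cmat (transpose_mat C)) z"
    using ev eigenvalue_root_char_poly[OF cCt] eigenvalue_root_char_poly[of "cmat C" d z] by simp
  then obtain q where q: "q \<in> carrier_vec d" "q \<noteq> 0\<^sub>v d" "cmat (transpose_mat C) *\<^sub>v q = z \<cdot>\<^sub>v q"
    using compressed_carrier[THEN carrier_matD(2)] by (auto simp: eigenvalue_def eigenvector_def)
  have CtT: "transpose_mat C = transpose_mat T * V.P"
    using Pc by (simp add: compressed_eq transpose_mult[of _ d d _ d] V.orth_proj_symmetric)
  have "transpose_mat (C * V.P) = V.P * transpose_mat C"
    using Pc by (simp add: transpose_mult[of _ d d _ d] V.orth_proj_symmetric)
  then have PCt: "V.P * transpose_mat C = transpose_mat C" by (simp add: compressed_orth_proj)
  have "z \<cdot>\<^sub>v (cmat V.P *\<^sub>v q) = cmat V.P *\<^sub>v (z \<cdot>\<^sub>v q)"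
    using Pc q by (simp add: mult_mat_vec[of _ d d])
  also have "\<dots> = cmat (V.P * transpose_mat C) *\<^sub>v q"
    unfolding q(3)[symmetric] using Pc Ct q
    by (simp add: of_real_hom.mat_hom_mult[of _ d d _ d] assoc_mat_vec)
  also have "\<dots> = z \<cdot>\<^sub>v q" unfolding PCt q(3) ..
  finally have zq: "z \<cdot>\<^sub>v (cmat V.P *\<^sub>v q) = z \<cdot>\<^sub>v q" .
  have "inverse z \<cdot>\<^sub>v (z \<cdot>\<^sub>v (cmat V.P *\<^sub>v q)) = inverse z \<cdot>\<^sub>v (z \<cdot>\<^sub>v q)" unfolding zq ..
  then have Pq: "cmat V.P *\<^sub>v q = q" using z by (simp add: smult_smult_assoc)
  have "cmat (transpose_mat T) *\<^sub>v (cmat V.P *\<^sub>v q) = cmat (transpose_mat C) *\<^sub>v q"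
    unfolding CtT using Pc Ct q
    by (simp add: of_real_hom.mat_hom_mult[of _ d d _ d] assoc_mat_vec)
  then show thesis using that q unfolding Pq by simp
qed

end

section \<open>Limits of block sums and cell masses along a sequence of phases tending to h\<close>

context growing_family
begin

lemma phase_limit_shift:
  assumes s: "filterlim s at_top sequentially" and h: "\<And>z. (\<lambda>j. ph z ^ s j) \<longlonglongrightarrow> h z"
  shows "filterlim (\<lambda>j. s j - l) at_top sequentially"
    and "(\<lambda>j. ph z ^ (s j - l)) \<longlonglongrightarrow> inverse (ph z) ^ l * h z"
proof -
  show "filterlim (\<lambda>j. s j - l) at_top sequentially"
    unfolding filterlim_at_top
  proof
    fix N
    have "\<forall>\<^sub>F j in sequentially. N + l \<le> s j" using s by (simp add: filterlim_at_top)
    then show "\<forall>\<^sub>F j in sequentially. N \<le> s j - l" by eventually_elim simp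
  qed
  have "\<forall>\<^sub>F j in sequentially. l \<le> s j" using s by (simp add: filterlim_at_top)
  then have "\<forall>\<^sub>F j in sequentially. inverse (ph z) ^ l * ph z ^ s j = ph z ^ (s j - l)"
  proof eventually_elim
    case (elim j)
    then have "ph z ^ s j = ph z ^ l * ph z ^ (s j - l)" by (simp flip: power_add)
    then show ?case using phase_nonzero[of z] by (simp add: power_inverse)
  qed
  moreover have "(\<lambda>j. inverse (ph z) ^ l * ph z ^ s j) \<longlonglongrightarrow> inverse (ph z) ^ l * h z"
    by (intro tendsto_mult tendsto_const h)
  ultimately show "(\<lambda>j. ph z ^ (s j - l)) \<longlonglongrightarrow> inverse (ph z) ^ l * h z"
    by (rule Lim_transform_eventually[rotated])
qed

text \<open>The sum is the row vector of n applied to the power of C with exponent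
  \<open>s j - l\<close>. Comparing c(s j) with c(s j - l) gives the power of rho, and comparing the
  phases at the two exponents gives the power of \<open>R\<close>.\<close>

lemma scaled_block_tendsto:
  assumes s: "filterlim s at_top sequentially" and h: "\<And>z. (\<lambda>j. ph z ^ s j) \<longlonglongrightarrow> h z"
    and v: "v \<in> carrier_vec d" and n: "n \<ge> 1"
  shows "(\<lambda>j. c (s j) * (\<Sum>m<k ^ (s j - l). u \<bullet> (D (k ^ (s j - l) * n + m) *\<^sub>v v)))
    \<longlonglongrightarrow> u \<bullet> (D n *\<^sub>v ((R ^\<^sub>m l) *\<^sub>v ((rot h * L) *\<^sub>v v))) / \<rho> ^ l"
proof -
  let ?t = "\<lambda>j. s j - l" and ?h = "\<lambda>z. inverse (ph z) ^ l * h z"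
  note t = phase_limit_shift[OF s h, where l = l]
  note rh = rotation_spectral_fun(1)[OF phase_limit_properties[OF h]]
  define z where "z = transpose_mat (D n) *\<^sub>v u"
  have zV: "z \<in> V" unfolding z_def using n by (rule row_orbit_mem)
  have zc: "z \<in> carrier_vec d" using zV V.carr by auto
  have uz: "u \<bullet> (D n *\<^sub>v x) = z \<bullet> x" if "x \<in> carrier_vec d" for x
    unfolding z_def using that u by (intro scalar_prod_mult_mat_vec[of _ d d]) auto
  have Tp: "T ^\<^sub>m N \<in> carrier_mat d d" "C ^\<^sub>m N \<in> carrier_mat d d" "R ^\<^sub>m N \<in> carrier_mat d d" for N
    by (auto intro!: pow_carrier_mat)
  have "rot ?h = R ^\<^sub>m l * rot h" by (rule rotation_shift[OF h t(2)]) simp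
  then have "entries_tendsto d (\<lambda>j. c (?t j) \<cdot>\<^sub>m C ^\<^sub>m ?t j) (R ^\<^sub>m l * rot h * L)"
    using scaled_powers_tendsto[OF t] by simp
  then have "(\<lambda>j. z \<bullet> ((c (?t j) \<cdot>\<^sub>m C ^\<^sub>m ?t j) *\<^sub>v v)) \<longlonglongrightarrow> z \<bullet> ((R ^\<^sub>m l * rot h * L) *\<^sub>v v)"
    using Tp rh zc v by (intro entries_tendsto_scalar_prod[of d]) (auto intro!: mult_carrier_mat[of _ d d])
  moreover have "(R ^\<^sub>m l * rot h * L) *\<^sub>v v = (R ^\<^sub>m l) *\<^sub>v ((rot h * L) *\<^sub>v v)"
    using Tp rh v by (simp add: assoc_mat assoc_mat_vec mult_carrier_mat[of _ d d])
  moreover have "z \<bullet> ((c (?t j) \<cdot>\<^sub>m C ^\<^sub>m ?t j) *\<^sub>v v) = c (?t j) * (z \<bullet> ((C ^\<^sub>m ?t j) *\<^sub>v v))" for j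
    using Tp[of "?t j"] zc v
    by (simp add: smult_mat_mult_vec[of _ d d] scalar_prod_smult_distrib[of _ d] mult_mat_vec_carrier[of _ d d])
  moreover have "(\<lambda>j. inverse (c (?t j) / c (?t j + l))) \<longlonglongrightarrow> inverse (\<rho> ^ l)"
    using rho_pos by (intro tendsto_inverse filterlim_compose[OF growth_coeff_ratio t(1)]) simp
  ultimately have lim: "(\<lambda>j. inverse (c (?t j) / c (?t j + l)) * (c (?t j) * (z \<bullet> ((C ^\<^sub>m ?t j) *\<^sub>v v))))
      \<longlonglongrightarrow> inverse (\<rho> ^ l) * (z \<bullet> ((R ^\<^sub>m l) *\<^sub>v ((rot h * L) *\<^sub>v v)))"
    by (intro tendsto_mult) simp_all
  \<comment> \<open>The extra 1 keeps the exponent \<open>s j - l\<close> positive: then the power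
    of \<open>T\<close> may be replaced by that of \<open>C\<close>, and the coefficient that is
    cancelled is positive.\<close>
  have "\<forall>\<^sub>F j in sequentially. l + 1 \<le> s j" using s by (simp only: filterlim_at_top)
  then have "\<forall>\<^sub>F j in sequentially. inverse (c (?t j) / c (?t j + l)) * (c (?t j) * (z \<bullet> ((C ^\<^sub>m ?t j) *\<^sub>v v)))
      = c (s j) * (\<Sum>m<k ^ ?t j. u \<bullet> (D (k ^ ?t j * n + m) *\<^sub>v v))"
  proof eventually_elim
    case (elim j)
    have pos: "c (?t j) > 0" using elim by (intro growth_coeff_pos) simp
    have "?t j + l = s j" using elim by simp
    have "(\<Sum>m<k ^ ?t j. u \<bullet> (D (k ^ ?t j * n + m) *\<^sub>v v)) = z \<bullet> ((T ^\<^sub>m ?t j) *\<^sub>v v)"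
      unfolding sum_digit_prod_block[OF n v] using Tp v by (intro uz mult_mat_vec_carrier[of _ d d]) auto
    also have "\<dots> = z \<bullet> ((C ^\<^sub>m ?t j) *\<^sub>v v)" using zV v elim by (intro scalar_prod_total_pow) auto
    finally show ?case using pos \<open>?t j + l = s j\<close> by simp
  qed
  with lim have "(\<lambda>j. c (s j) * (\<Sum>m<k ^ ?t j. u \<bullet> (D (k ^ ?t j * n + m) *\<^sub>v v)))
      \<longlonglongrightarrow> inverse (\<rho> ^ l) * (z \<bullet> ((R ^\<^sub>m l) *\<^sub>v ((rot h * L) *\<^sub>v v)))"
    by (rule Lim_transform_eventually)
  moreover have "(R ^\<^sub>m l) *\<^sub>v ((rot h * L) *\<^sub>v v) \<in> carrier_vec d"
    using Tp rh v by (intro mult_mat_vec_carrier[of _ d d] mult_carrier_mat[of _ d d]) auto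
  ultimately show ?thesis by (simp add: uz divide_inverse mult.commute)
qed

text \<open>The case l = 0 of the preceding limit, summed over the leading digits 1, ..., k - 1. The
  limit is the quantity that nondegeneracy makes positive.\<close>

lemma scaled_block_sum_tendsto:
  assumes s: "filterlim s at_top sequentially" and h: "\<And>z. (\<lambda>j. ph z ^ s j) \<longlonglongrightarrow> h z"
    and rep: "linear_rep k f d u A v"
  shows "(\<lambda>j. c (s j) * block_sum k f (s j)) \<longlonglongrightarrow> u \<bullet> ((T - A 0) *\<^sub>v ((rot h * L) *\<^sub>v v))"
proof -
  have v: "v \<in> carrier_vec d" and f: "f = (\<lambda>n. u \<bullet> (D n *\<^sub>v v))"
    using rep by (auto simp: linear_rep_def)
  note rh = rotation_spectral_fun(1)[OF phase_limit_properties[OF h]]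
  have y: "(rot h * L) *\<^sub>v v \<in> carrier_vec d"
    using rh v by (intro mult_mat_vec_carrier[of _ d d] mult_carrier_mat[of _ d d]) auto
  have dim0: "dim_row R = d" by simp
  have "c (s j) * block_sum k f (s j) =
      (\<Sum>i = 1..<k. c (s j) * (\<Sum>m<k ^ (s j - 0). u \<bullet> (D (k ^ (s j - 0) * i + m) *\<^sub>v v)))" for j
    unfolding block_sum_def f using block_sum_split[OF k2, of 0 "s j"] by (simp add: sum_distrib_left)
  moreover have "(\<lambda>j. \<Sum>i = 1..<k. c (s j) * (\<Sum>m<k ^ (s j - 0). u \<bullet> (D (k ^ (s j - 0) * i + m) *\<^sub>v v)))
      \<longlonglongrightarrow> (\<Sum>i = 1..<k. u \<bullet> (D i *\<^sub>v ((R ^\<^sub>m 0) *\<^sub>v ((rot h * L) *\<^sub>v v))) / \<rho> ^ 0)"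
    by (intro tendsto_sum scaled_block_tendsto[OF s h v]) auto
  moreover have "(\<Sum>i = 1..<k. u \<bullet> (D i *\<^sub>v ((R ^\<^sub>m 0) *\<^sub>v ((rot h * L) *\<^sub>v v))) / \<rho> ^ 0) =
      u \<bullet> ((T - A 0) *\<^sub>v ((rot h * L) *\<^sub>v v))"
    unfolding scalar_prod_total_minus[OF u y] using y dim0 by (intro sum.cong) (auto simp: digit_prod_digit)
  ultimately show ?thesis by simp
qed

lemma block_mass_tendsto:
  assumes s: "filterlim s at_top sequentially" and h: "\<And>z. (\<lambda>j. ph z ^ s j) \<longlonglongrightarrow> h z"
    and rep: "linear_rep k f d u A v" and n: "n \<ge> 1"
    and K: "K = u \<bullet> ((T - A 0) *\<^sub>v ((rot h * L) *\<^sub>v v))" "K \<noteq> 0"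
    and y: "y = (1 / K) \<cdot>\<^sub>v ((rot h * L) *\<^sub>v v)"
  shows "(\<lambda>j. block_mass k f (s j) l n) \<longlonglongrightarrow> u \<bullet> (D n *\<^sub>v ((R ^\<^sub>m l) *\<^sub>v y)) / \<rho> ^ l"
proof -
  have v: "v \<in> carrier_vec d" and f: "f = (\<lambda>n. u \<bullet> (D n *\<^sub>v v))"
    using rep by (auto simp: linear_rep_def)
  note rh = rotation_spectral_fun(1)[OF phase_limit_properties[OF h]]
  define y0 where "y0 = (rot h * L) *\<^sub>v v"
  have y0: "y0 \<in> carrier_vec d"
    unfolding y0_def using rh v by (intro mult_mat_vec_carrier[of _ d d] mult_carrier_mat[of _ d d]) auto
  have Rl: "R ^\<^sub>m l \<in> carrier_mat d d" by (auto intro!: pow_carrier_mat)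
  have Ry0: "(R ^\<^sub>m l) *\<^sub>v y0 \<in> carrier_vec d" by (rule mult_mat_vec_carrier[OF Rl y0])
  have "(\<lambda>j. (c (s j) * (\<Sum>m<k ^ (s j - l). f (k ^ (s j - l) * n + m))) / (c (s j) * block_sum k f (s j)))
      \<longlonglongrightarrow> u \<bullet> (D n *\<^sub>v ((R ^\<^sub>m l) *\<^sub>v y0)) / \<rho> ^ l / K"
    unfolding K(1) y0_def
    using scaled_block_tendsto[OF s h v n, of l] scaled_block_sum_tendsto[OF s h rep] K
    by (intro tendsto_divide) (simp_all add: f)
  moreover have "\<forall>\<^sub>F j in sequentially. (c (s j) * (\<Sum>m<k ^ (s j - l). f (k ^ (s j - l) * n + m))) /
      (c (s j) * block_sum k f (s j)) = block_mass k f (s j) l n"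
  proof -
    have "\<forall>\<^sub>F j in sequentially. 1 \<le> s j" using s by (simp only: filterlim_at_top)
    then show ?thesis
    proof eventually_elim
      case (elim j)
      then have "c (s j) \<noteq> 0" using growth_coeff_pos[of "s j"] by simp
      then show ?case by (simp add: block_mass_def)
    qed
  qed
  ultimately have "(\<lambda>j. block_mass k f (s j) l n) \<longlonglongrightarrow> u \<bullet> (D n *\<^sub>v ((R ^\<^sub>m l) *\<^sub>v y0)) / \<rho> ^ l / K"
    by (rule Lim_transform_eventually)
  moreover have "u \<bullet> (D n *\<^sub>v ((R ^\<^sub>m l) *\<^sub>v y)) = u \<bullet> (D n *\<^sub>v ((R ^\<^sub>m l) *\<^sub>v y0)) / K"
    unfolding y y0_def[symmetric] using Rl y0 Ry0 u mult_mat_vec_carrier[OF digit_prod_carrier Ry0]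
    by (simp add: mult_mat_vec[OF Rl y0] mult_mat_vec[OF digit_prod_carrier Ry0] scalar_prod_smult_distrib[of _ d])
  ultimately show ?thesis by (simp add: field_simps)
qed

end

section \<open>The reduced representation\<close>

lemma smult_append_vec:
  "a \<cdot>\<^sub>v (x @\<^sub>v y) = (a \<cdot>\<^sub>v x) @\<^sub>v (a \<cdot>\<^sub>v (y :: 'a :: semiring_1 vec))"
  by (intro eq_vecI) auto

text \<open>The construction uses \<open>y\<close> only as an eigenvector of \<open>R * C\<close>;
  it is later taken as the normalised vector obtained from the limit matrix.\<close>

locale rotated_family = growing_family +
  fixes y :: "real vec"
  assumes y: "y \<in> carrier_vec d"
    and y_eigen: "(R * C) *\<^sub>v y = \<rho> \<cdot>\<^sub>v y"
    and R_digit_commute: "i < k \<Longrightarrow> R * A i = A i * R"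
begin

text \<open>The first \<open>d\<close> coordinates form an initial state that is left after one digit. Hence the
  leading digit is read without a factor \<open>R\<close>, and the value at \<open>0\<close> vanishes. The projection
  in the second block turns the digit sum into \<open>R * C\<close>.\<close>

definition B :: "nat \<Rightarrow> real mat" where
  "B i = four_block_mat (0\<^sub>m d d) (A i) (0\<^sub>m d d) (V.P * R * A i)"

definition w :: "real vec" where "w = u @\<^sub>v 0\<^sub>v d"

lemma B_carrier: "i < k \<Longrightarrow> B i \<in> carrier_mat (d + d) (d + d)"
  unfolding B_def by (rule four_block_carrier_mat) (auto intro!: mult_carrier_mat[of _ d d] A)

lemma w_carrier: "w \<in> carrier_vec (d + d)"
  using u by (simp add: w_def)

sublocale Q: matrix_family k "d + d" w B
  using k2 w_carrier B_carrier by unfold_locales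

abbreviation "DR n l \<equiv> transpose_mat (D n * R ^\<^sub>m l) *\<^sub>v u"

lemma R_pow_carrier [simp]: "R ^\<^sub>m l \<in> carrier_mat d d"
  by (rule pow_carrier_mat) simp

lemma DR_carrier: "DR n l \<in> carrier_vec d"
  using u by (intro mult_mat_vec_carrier[of _ d d]) (auto intro!: mult_carrier_mat[of _ d d])

lemma DR_mem: "n \<ge> 1 \<Longrightarrow> DR n l \<in> V"
proof (induction l)
  case 0
  then show ?case using row_orbit_mem by (simp add: right_mult_one_mat[of _ d d])
next
  case (Suc l)
  have "DR n (Suc l) = transpose_mat R *\<^sub>v DR n l"
  proof -
    have c: "D n * R ^\<^sub>m l \<in> carrier_mat d d" by (auto intro!: mult_carrier_mat[of _ d d])
    have "D n * R ^\<^sub>m Suc l = D n * R ^\<^sub>m l * R"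
      unfolding pow_mat.simps by (rule assoc_mat[symmetric]) auto
    then have "transpose_mat (D n * R ^\<^sub>m Suc l) = transpose_mat R * transpose_mat (D n * R ^\<^sub>m l)"
      by (simp only: transpose_mult[OF c R_carrier(1)])
    then show ?thesis using c u by (simp only:) (rule assoc_mat_vec, auto)
  qed
  then show ?case using row_orbit_R[OF Suc.IH] Suc.prems by simp
qed

text \<open>On row vectors whose second half lies in V, the projection inside \<open>B i\<close>
  acts as the identity. It is therefore invisible in the orbit of \<open>w\<close>.\<close>

lemma transpose_B_mult_vec:
  assumes i: "i < k" and a: "a \<in> carrier_vec d" and q: "q \<in> V"
  shows "transpose_mat (B i) *\<^sub>v (a @\<^sub>v q) =
    0\<^sub>v d @\<^sub>v (transpose_mat (A i) *\<^sub>v a + transpose_mat (A i) *\<^sub>v (transpose_mat R *\<^sub>v q))"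
proof -
  have qc: "q \<in> carrier_vec d" using q V.carr by auto
  note Ai = A[OF i]
  have "transpose_mat (B i) =
      four_block_mat (0\<^sub>m d d) (0\<^sub>m d d) (transpose_mat (A i)) (transpose_mat (V.P * R * A i))"
    unfolding B_def using Ai
    by (subst transpose_four_block_mat[of _ d d _ d _ d]) (auto intro!: mult_carrier_mat[of _ d d])
  then have "transpose_mat (B i) *\<^sub>v (a @\<^sub>v q) = (0\<^sub>m d d *\<^sub>v a + 0\<^sub>m d d *\<^sub>v q) @\<^sub>v
      (transpose_mat (A i) *\<^sub>v a + transpose_mat (V.P * R * A i) *\<^sub>v q)"
    using Ai a qc
    by (simp only:) (rule four_block_mat_mult_vec[of _ d d _ d _ d], auto intro!: mult_carrier_mat[of _ d d])
  also have "0\<^sub>m d d *\<^sub>v a + 0\<^sub>m d d *\<^sub>v q = 0\<^sub>v d" using a qc by (intro eq_vecI) auto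
  also have "transpose_mat (V.P * R * A i) *\<^sub>v q = transpose_mat (A i) *\<^sub>v (transpose_mat R *\<^sub>v q)"
    using Ai qc V.orth_proj_fixes[OF q]
    by (simp add: transpose_mult[of _ d d _ d] V.orth_proj_symmetric assoc_mat_vec
      mult_carrier_mat[of _ d d] mult_mat_vec_carrier[of _ d d])
  finally show ?thesis .
qed

text \<open>The leading digit leaves the initial state and contributes no \<open>R\<close>; each
  later digit contributes one. Commutation of \<open>R\<close> with the digit matrices collects all
  of these factors on the right.\<close>

lemma B_orbit:
  assumes "k ^ l \<le> n" "n < k ^ (l + 1)"
  shows "transpose_mat (Q.D n) *\<^sub>v w = 0\<^sub>v d @\<^sub>v DR n l"
  using assms
proof (induction l arbitrary: n)
  case 0
  then have n: "0 < n" "n < k" by auto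
  have z: "0\<^sub>v d \<in> V" by (rule V.zero_mem)
  have "transpose_mat (Q.D n) *\<^sub>v w = transpose_mat (B n) *\<^sub>v (u @\<^sub>v 0\<^sub>v d)"
    unfolding Q.digit_prod_digit[OF n] by (simp add: w_def)
  also have "\<dots> = 0\<^sub>v d @\<^sub>v (transpose_mat (A n) *\<^sub>v u + transpose_mat (A n) *\<^sub>v (transpose_mat R *\<^sub>v 0\<^sub>v d))"
    by (rule transpose_B_mult_vec[OF n(2) u z])
  also have "transpose_mat (A n) *\<^sub>v u + transpose_mat (A n) *\<^sub>v (transpose_mat R *\<^sub>v 0\<^sub>v d) = transpose_mat (A n) *\<^sub>v u"
    using A[OF n(2)] u by (intro eq_vecI) (auto simp: scalar_prod_def)
  also have "transpose_mat (A n) *\<^sub>v u = DR n 0"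
    using A[OF n(2)] by (simp add: digit_prod_digit[OF n] right_mult_one_mat[of _ d d])
  finally show ?case .
next
  case (Suc l)
  define m j where "m = n div k" and "j = n mod k"
  have j: "j < k" using k2 by (simp add: j_def)
  have n: "n = k * m + j" by (simp add: m_def j_def)
  have "k ^ l \<le> m" "m < k ^ (l + 1)"
    using Suc.prems k2 by (auto simp: m_def less_eq_div_iff_mult_less_eq mult.commute div_less_iff_less_mult)
  note IH = Suc.IH[OF this]
  have m1: "1 \<le> m" using \<open>k ^ l \<le> m\<close> k2 by (metis le_trans one_le_power Suc_1 Suc_leD One_nat_def)
  have "transpose_mat (Q.D n) *\<^sub>v w = transpose_mat (B j) *\<^sub>v (transpose_mat (Q.D m) *\<^sub>v w)"
    unfolding n Q.digit_prod_append[OF m1 j] using B_carrier[OF j] w_carrier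
    by (simp add: transpose_mult[of _ "d + d" "d + d" _ "d + d"]
      assoc_mult_mat_vec[of _ "d + d" "d + d" _ "d + d"])
  also have "\<dots> = 0\<^sub>v d @\<^sub>v (transpose_mat (A j) *\<^sub>v 0\<^sub>v d + transpose_mat (A j) *\<^sub>v (transpose_mat R *\<^sub>v DR m l))"
    unfolding IH by (rule transpose_B_mult_vec[OF j zero_carrier_vec DR_mem[OF m1]])
  also have "transpose_mat (A j) *\<^sub>v 0\<^sub>v d = 0\<^sub>v d" using A[OF j] by (intro eq_vecI) (auto simp: scalar_prod_def)
  also have "0\<^sub>v d + transpose_mat (A j) *\<^sub>v (transpose_mat R *\<^sub>v DR m l) =
      transpose_mat (A j) *\<^sub>v (transpose_mat R *\<^sub>v DR m l)"
    using A[OF j] by (intro left_zero_vec) (auto intro!: mult_mat_vec_carrier[of _ d d] DR_carrier)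
  also have "\<dots> = transpose_mat (D m * R ^\<^sub>m l * R * A j) *\<^sub>v u"
  proof -
    have c: "D m * R ^\<^sub>m l \<in> carrier_mat d d" by (auto intro!: mult_carrier_mat[of _ d d])
    show ?thesis
      using A[OF j] c u
      by (simp add: transpose_mult[OF mult_carrier_mat[OF c R_carrier(1)] A[OF j]] transpose_mult[OF c R_carrier(1)]
        assoc_mat_vec mult_carrier_mat[of _ d d] mult_mat_vec_carrier[of _ d d])
  qed
  also have "D m * R ^\<^sub>m l * R * A j = D n * R ^\<^sub>m Suc l"
  proof -
    have "D m * R ^\<^sub>m l * R * A j = D m * (R ^\<^sub>m Suc l * A j)"
      using A[OF j] by (simp add: assoc_mat mult_carrier_mat[of _ d d])
    also have "R ^\<^sub>m Suc l * A j = A j * R ^\<^sub>m Suc l"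
      using A[OF j] R_digit_commute[OF j] by (intro mat_commute_pow[of _ d, symmetric]) auto
    also have "D m * (A j * R ^\<^sub>m Suc l) = D n * R ^\<^sub>m Suc l"
      unfolding n digit_prod_append[OF m1 j] using A[OF j]
      by (intro assoc_mat[symmetric]) auto
    finally show ?thesis .
  qed
  finally show ?case by simp
qed

lemma B_orbit_subset: "Q.V \<subseteq> {0\<^sub>v d @\<^sub>v a | a. a \<in> carrier_vec d}" (is "_ \<subseteq> ?S")
proof (rule Q.row_orbit_subset)
  show "vec_subspace (d + d) ?S"
  proof
    have "0\<^sub>v (d + d) = (0\<^sub>v d @\<^sub>v 0\<^sub>v d :: real vec)" by (intro eq_vecI) auto
    then show "0\<^sub>v (d + d) \<in> ?S" by auto
    fix p q :: "real vec"
    assume "p \<in> ?S" "q \<in> ?S"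
    then obtain a b where ab: "p = 0\<^sub>v d @\<^sub>v a" "q = 0\<^sub>v d @\<^sub>v b" "a \<in> carrier_vec d" "b \<in> carrier_vec d" by blast
    then have "p + q = 0\<^sub>v d @\<^sub>v (a + b)"
      by (simp add: append_vec_add[of _ d _ _ d])
    then show "p + q \<in> ?S" using ab by auto
  next
    fix p :: "real vec" and e
    assume "p \<in> ?S"
    then obtain a where a: "p = 0\<^sub>v d @\<^sub>v a" "a \<in> carrier_vec d" by blast
    have "e \<cdot>\<^sub>v 0\<^sub>v d = (0\<^sub>v d :: real vec)" by (intro eq_vecI) auto
    then have "e \<cdot>\<^sub>v p = 0\<^sub>v d @\<^sub>v (e \<cdot>\<^sub>v a)" by (simp add: a smult_append_vec)
    then show "e \<cdot>\<^sub>v p \<in> ?S" using a by auto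
  qed auto
  fix n :: nat assume "n \<ge> 1"
  then obtain l where "k ^ l \<le> n" "n < k ^ (l + 1)" using ex_power_ivl1[OF k2] by blast
  from B_orbit[OF this] show "transpose_mat (Q.D n) *\<^sub>v w \<in> ?S"
    using DR_carrier by auto
qed

lemma first_block_orth_compl:
  assumes "a \<in> carrier_vec d"
  shows "a @\<^sub>v 0\<^sub>v d \<in> Q.V.orth_compl"
  unfolding Q.V.orth_compl_iff
proof (intro conjI ballI)
  show "a @\<^sub>v 0\<^sub>v d \<in> carrier_vec (d + d)" using assms by simp
  fix q assume "q \<in> Q.V"
  then obtain b where "q = 0\<^sub>v d @\<^sub>v b" "b \<in> carrier_vec d" using B_orbit_subset by blast
  then show "(a @\<^sub>v 0\<^sub>v d) \<bullet> q = 0"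
    using assms by (simp add: scalar_prod_append[of _ d _ d])
qed

abbreviation "x0 \<equiv> 0\<^sub>v d @\<^sub>v y"

definition x :: "real vec" where "x = Q.V.P *\<^sub>v x0"

lemma x0_carrier: "x0 \<in> carrier_vec (d + d)" using y by simp

lemma x_carrier: "x \<in> carrier_vec (d + d)"
  unfolding x_def using Q.V.orth_proj(1) x0_carrier by (rule mult_mat_vec_carrier)

definition g :: "nat \<Rightarrow> real" where "g n = w \<bullet> (Q.D n *\<^sub>v x)"

lemma linear_rep_g: "linear_rep k g (d + d) w B x"
  using w_carrier x_carrier B_carrier by (simp add: linear_rep_def g_def)

text \<open>The vector \<open>x\<close> lies in the row orbit space of the enlarged family, whose
  elements vanish in the first half, whereas \<open>w\<close> vanishes in the second.\<close>

lemma g_zero: "g 0 = 0"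
proof -
  have "x \<in> Q.V" unfolding x_def using x0_carrier by (rule Q.V.orth_proj(2))
  then have "(u @\<^sub>v 0\<^sub>v d) \<bullet> x = 0"
    using first_block_orth_compl[OF u, unfolded Q.V.orth_compl_iff] by blast
  then have "w \<bullet> x = 0" by (subst w_def)
  moreover have "Q.D 0 = 1\<^sub>m (d + d)" by (simp add: digit_prod.simps)
  ultimately show ?thesis using x_carrier by (simp add: g_def)
qed

text \<open>The projection defining \<open>x\<close> can be moved onto the row vector of n, which it
  fixes. Passing from \<open>x0\<close> to \<open>x\<close> therefore leaves the values at n >= 1
  unchanged.\<close>

lemma g_eq:
  assumes "k ^ l \<le> n" "n < k ^ (l + 1)"
  shows "g n = u \<bullet> (D n *\<^sub>v ((R ^\<^sub>m l) *\<^sub>v y))"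
proof -
  have n: "n \<ge> 1" using assms(1) k2 by (metis le_trans one_le_power Suc_1 Suc_leD One_nat_def)
  let ?q = "transpose_mat (Q.D n) *\<^sub>v w"
  have qV: "?q \<in> Q.V" using n by (rule Q.row_orbit_mem)
  have qc: "?q \<in> carrier_vec (d + d)" using qV Q.V.carr by auto
  have "g n = ?q \<bullet> x"
    unfolding g_def using w_carrier x_carrier by (intro scalar_prod_mult_mat_vec[of _ "d + d" "d + d"]) auto
  also have "\<dots> = (Q.V.P *\<^sub>v ?q) \<bullet> x0"
    unfolding x_def using qc x0_carrier by (rule Q.V.orth_proj_self_adjoint[symmetric])
  also have "\<dots> = ?q \<bullet> x0" unfolding Q.V.orth_proj_fixes[OF qV] ..
  also have "\<dots> = (0\<^sub>v d @\<^sub>v DR n l) \<bullet> x0" unfolding B_orbit[OF assms] ..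
  also have "\<dots> = DR n l \<bullet> y"
    using y DR_carrier by (subst scalar_prod_append[of _ d _ d]) auto
  also have "\<dots> = u \<bullet> ((D n * R ^\<^sub>m l) *\<^sub>v y)"
    using u y by (intro scalar_prod_mult_mat_vec[of _ d d, symmetric]) (auto intro!: mult_carrier_mat[of _ d d])
  also have "\<dots> = u \<bullet> (D n *\<^sub>v ((R ^\<^sub>m l) *\<^sub>v y))"
    using y by (simp add: assoc_mat_vec)
  finally show ?thesis .
qed

section \<open>Spectrum of the enlarged family\<close>

lemma total_B: "Q.T = four_block_mat (0\<^sub>m d d) T (0\<^sub>m d d) (R * C)"
proof (rule eq_matI)
  have RC: "R * C \<in> carrier_mat d d" by (auto intro!: mult_carrier_mat[of _ d d])
  note dims = RC[THEN carrier_matD(1)] RC[THEN carrier_matD(2)]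
    total_carrier[THEN carrier_matD(1)] total_carrier[THEN carrier_matD(2)]
  \<comment> \<open>By \<open>orth_proj_R\<close> a projection may be inserted behind
    \<open>R\<close>, which turns \<open>T\<close> into \<open>C\<close>; the projection in front is
    absorbed because the range of \<open>R * C\<close> lies in V.\<close>
  have PRT: "V.P * R * T = R * C"
  proof -
    have "V.P * R * T = V.P * R * V.P * T" unfolding orth_proj_R ..
    also have "\<dots> = V.P * R * (V.P * T)"
      by (rule assoc_mat) (auto intro!: mult_carrier_mat[of _ d d])
    also have "\<dots> = V.P * (R * C)"
      unfolding compressed_eq[symmetric] by (rule assoc_mat) auto
    finally show ?thesis unfolding orth_proj_R_C .
  qed
  have low: "(\<Sum>l<k. (V.P * R * A l) $$ (i,j)) = (R * C) $$ (i,j)" if ij: "i < d" "j < d" for i j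
  proof -
    have PR: "V.P * R \<in> carrier_mat d d" by (auto intro!: mult_carrier_mat[of _ d d])
    have "(\<Sum>l<k. (V.P * R * A l) $$ (i,j)) = (\<Sum>l<k. \<Sum>m = 0..<d. (V.P * R) $$ (i,m) * A l $$ (m,j))"
    proof (intro sum.cong refl)
      fix l assume "l \<in> {..<k}"
      then have "A l \<in> carrier_mat d d" using A by simp
      then show "(V.P * R * A l) $$ (i,j) = (\<Sum>m = 0..<d. (V.P * R) $$ (i,m) * A l $$ (m,j))"
        using ij PR by (subst index_mult_mat) (auto simp: scalar_prod_def)
    qed
    also have "\<dots> = (\<Sum>m = 0..<d. \<Sum>l<k. (V.P * R) $$ (i,m) * A l $$ (m,j))" by (rule sum.swap)
    also have "\<dots> = (\<Sum>m = 0..<d. (V.P * R) $$ (i,m) * T $$ (m,j))"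
      using ij by (simp add: mat_total_def sum_distrib_left)
    also have "\<dots> = (V.P * R * T) $$ (i,j)"
      using ij PR dims by (subst index_mult_mat) (auto simp: scalar_prod_def)
    finally show ?thesis unfolding PRT .
  qed
  fix i j
  assume "i < dim_row (four_block_mat (0\<^sub>m d d) T (0\<^sub>m d d) (R * C))"
    "j < dim_col (four_block_mat (0\<^sub>m d d) T (0\<^sub>m d d) (R * C))"
  then have ij: "i < d + d" "j < d + d" using dims by auto
  have Bij: "B l $$ (i,j) = (if i < d then if j < d then 0 else A l $$ (i, j - d)
      else if j < d then 0 else (V.P * R * A l) $$ (i - d, j - d))" if "l < k" for l
    unfolding B_def using ij A[OF that] by (subst index_mat_four_block) auto
  have "Q.T $$ (i,j) = (\<Sum>l<k. B l $$ (i,j))" using ij by (simp add: mat_total_def)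
  also have "\<dots> = (if i < d then if j < d then 0 else T $$ (i, j - d)
      else if j < d then 0 else (R * C) $$ (i - d, j - d))"
    using ij low[of "i - d" "j - d"] by (auto simp: Bij mat_total_def)
  also have "\<dots> = four_block_mat (0\<^sub>m d d) T (0\<^sub>m d d) (R * C) $$ (i,j)"
    using ij dims by (subst index_mat_four_block) auto
  finally show "Q.T $$ (i,j) = four_block_mat (0\<^sub>m d d) T (0\<^sub>m d d) (R * C) $$ (i,j)" .
qed (auto simp: mat_total_def)

text \<open>The block matrix sends \<open>x0\<close> to the vector with halves T y and rho y. The
  first half is orthogonal to the row orbit space and disappears under the projection, so what
  remains is rho times \<open>x\<close>.\<close>

lemma compressed_B_x: "Q.C *\<^sub>v x = \<rho> \<cdot>\<^sub>v x"
proof -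
  have RC: "R * C \<in> carrier_mat d d" by (auto intro!: mult_carrier_mat[of _ d d])
  have Ty: "T *\<^sub>v y \<in> carrier_vec d" using y by (simp add: mult_mat_vec_carrier[of _ d d])
  have z: "T *\<^sub>v 0\<^sub>v d = 0\<^sub>v d" by (intro eq_vecI) (auto simp: mat_total_def scalar_prod_def)
  have "Q.T *\<^sub>v x0 = (0\<^sub>m d d *\<^sub>v 0\<^sub>v d + T *\<^sub>v y) @\<^sub>v (0\<^sub>m d d *\<^sub>v 0\<^sub>v d + (R * C) *\<^sub>v y)"
    unfolding total_B using y RC by (intro four_block_mat_mult_vec[of _ d d _ d _ d]) auto
  also have "0\<^sub>m d d *\<^sub>v 0\<^sub>v d = (0\<^sub>v d :: real vec)" by (intro eq_vecI) auto
  also have "(0\<^sub>v d + T *\<^sub>v y) @\<^sub>v (0\<^sub>v d + (R * C) *\<^sub>v y) = (T *\<^sub>v y) @\<^sub>v (\<rho> \<cdot>\<^sub>v y)"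
    unfolding y_eigen using y Ty by simp
  also have "\<dots> = ((T *\<^sub>v y) @\<^sub>v 0\<^sub>v d) + \<rho> \<cdot>\<^sub>v x0"
  proof -
    have "\<rho> \<cdot>\<^sub>v x0 = 0\<^sub>v d @\<^sub>v (\<rho> \<cdot>\<^sub>v y)" by (auto simp: smult_append_vec)
    then show ?thesis using y Ty by (simp add: append_vec_add[of _ d _ _ d])
  qed
  finally have Tx0: "Q.T *\<^sub>v x0 = ((T *\<^sub>v y) @\<^sub>v 0\<^sub>v d) + \<rho> \<cdot>\<^sub>v x0" .
  have "Q.C *\<^sub>v x = (Q.C * Q.V.P) *\<^sub>v x0"
    unfolding x_def using Q.V.orth_proj(1) x0_carrier
    by (intro assoc_mult_mat_vec[of _ "d + d" "d + d" _ "d + d", symmetric]) auto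
  also have "\<dots> = Q.V.P *\<^sub>v (Q.T *\<^sub>v x0)"
    unfolding Q.compressed_orth_proj unfolding Q.compressed_eq using Q.V.orth_proj(1) x0_carrier
    by (intro assoc_mult_mat_vec[of _ "d + d" "d + d" _ "d + d"]) auto
  also have "\<dots> = Q.V.P *\<^sub>v ((T *\<^sub>v y) @\<^sub>v 0\<^sub>v d) + Q.V.P *\<^sub>v (\<rho> \<cdot>\<^sub>v x0)"
    unfolding Tx0 using Q.V.orth_proj(1) x0_carrier Ty
    by (intro mult_add_distrib_mat_vec[of _ "d + d" "d + d"]) auto
  also have "\<dots> = \<rho> \<cdot>\<^sub>v x"
    unfolding Q.V.orth_proj_on_orth_compl[OF first_block_orth_compl[OF Ty]]
    using x_carrier by (simp add: mult_mat_vec[OF Q.V.orth_proj(1) x0_carrier] flip: x_def)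
  finally show ?thesis .
qed

text \<open>A left eigenvector for z nonzero has a vanishing first half, because the first block
  column of the total matrix is zero. Its second half is then a left eigenvector of
  \<open>R * C\<close>.\<close>

lemma compressed_B_eigenvalue:
  assumes ev: "eigenvalue (cmat Q.C) z" and z: "z \<noteq> 0"
  shows "z = complex_of_real \<rho> \<or> cmod z < \<rho>"
proof -
  have RC: "R * C \<in> carrier_mat d d" by (auto intro!: mult_carrier_mat[of _ d d])
  obtain q where q: "q \<in> carrier_vec (d + d)" "q \<noteq> 0\<^sub>v (d + d)"
    "cmat (transpose_mat Q.T) *\<^sub>v q = z \<cdot>\<^sub>v q"
    using Q.compressed_eigenvalue[OF ev z] .
  define q1 q2 where "q1 = vec_first q d" and "q2 = vec_last q d"
  have qq: "q = q1 @\<^sub>v q2" "q1 \<in> carrier_vec d" "q2 \<in> carrier_vec d" using q by (simp_all add: q1_def q2_def)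
  let ?T = "cmat (transpose_mat T)" and ?RC = "cmat (transpose_mat (R * C))"
  have c: "?T \<in> carrier_mat d d" "?RC \<in> carrier_mat d d" using RC by simp_all
  have "cmat (transpose_mat Q.T) = four_block_mat (0\<^sub>m d d) (0\<^sub>m d d) ?T ?RC"
    unfolding total_B using RC
    by (subst transpose_four_block_mat[of _ d d _ d _ d], auto)
      (subst map_four_block_mat[of _ d d _ d _ d], auto)
  then have "cmat (transpose_mat Q.T) *\<^sub>v q =
      (0\<^sub>m d d *\<^sub>v q1 + 0\<^sub>m d d *\<^sub>v q2) @\<^sub>v (?T *\<^sub>v q1 + ?RC *\<^sub>v q2)"
    unfolding qq(1) using qq c
    by (simp only:) (rule four_block_mat_mult_vec[of _ d d _ d _ d], auto)
  also have "0\<^sub>m d d *\<^sub>v q1 + 0\<^sub>m d d *\<^sub>v q2 = 0\<^sub>v d" using qq by (intro eq_vecI) auto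
  finally have "z \<cdot>\<^sub>v q = 0\<^sub>v d @\<^sub>v (?T *\<^sub>v q1 + ?RC *\<^sub>v q2)" unfolding q(3) .
  then have "z \<cdot>\<^sub>v (q1 @\<^sub>v q2) = 0\<^sub>v d @\<^sub>v (?T *\<^sub>v q1 + ?RC *\<^sub>v q2)" unfolding qq(1) .
  then have 1: "z \<cdot>\<^sub>v q1 = 0\<^sub>v d" and 2: "z \<cdot>\<^sub>v q2 = ?T *\<^sub>v q1 + ?RC *\<^sub>v q2"
    using qq unfolding smult_append_vec by (simp_all add: append_vec_eq[of _ d])
  have "inverse z \<cdot>\<^sub>v (z \<cdot>\<^sub>v q1) = 0\<^sub>v d" unfolding 1 by (intro eq_vecI) auto
  then have q1: "q1 = 0\<^sub>v d" using z by (simp add: smult_smult_assoc)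
  have "?T *\<^sub>v q1 = 0\<^sub>v d" unfolding q1 using c(1)[THEN carrier_matD(1)] c(1)[THEN carrier_matD(2)]
    by (intro eq_vecI) (auto simp: scalar_prod_def)
  then have "?RC *\<^sub>v q2 = z \<cdot>\<^sub>v q2" using 2 mult_mat_vec_carrier[OF c(2) qq(3)] by simp
  moreover have "q2 \<noteq> 0\<^sub>v d"
  proof
    assume "q2 = 0\<^sub>v d"
    then have "q = 0\<^sub>v (d + d)" unfolding qq(1) q1 by (intro eq_vecI) auto
    then show False using q(2) by simp
  qed
  ultimately have "eigenvalue ?RC z"
    unfolding eigenvalue_def eigenvector_def c(2)[THEN carrier_matD(1)] using qq(3) by blast
  moreover have "char_poly ?RC = char_poly (cmat (R * C))"
    using char_poly_transpose_mat[of "cmat (R * C)" d] RC by (simp only: map_mat_transpose map_carrier_mat)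
  ultimately have "eigenvalue (cmat (R * C)) z"
    using RC eigenvalue_root_char_poly[OF c(2)] eigenvalue_root_char_poly[of "cmat (R * C)" d z] by simp
  then show ?thesis by (rule eigenvalue_R_C)
qed

text \<open>The eigenvector \<open>x\<close> shows that the spectral radius of the enlarged family
  is at least rho. Every nonzero eigenvalue is rho or smaller in modulus, so the two radii agree and
  rho is the only peripheral eigenvalue.\<close>

lemma reduced_rep_g:
  assumes bs: "\<And>l. block_sum k g l = \<rho> ^ l" and ghost: "\<exists>!\<nu>. ghost_measure k g \<nu>"
  shows "reduced_rep k g (d + d) w B x"
proof -
  have Cc: "cmat Q.C \<in> carrier_mat (d + d) (d + d)" by simp
  have dd: "d + d > 0" using d_pos by simp
  \<comment> \<open>If \<open>x\<close> were zero, so would be \<open>g\<close>, but its block sum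
    at level 0 is 1.\<close>
  have xnz: "x \<noteq> 0\<^sub>v (d + d)"
  proof
    assume x0: "x = 0\<^sub>v (d + d)"
    have "g n = 0" for n
      unfolding g_def x0 using w_carrier Q.digit_prod_carrier[of n, THEN carrier_matD(2)]
      by (auto simp: scalar_prod_def)
    then show False using bs[of 0] by (simp add: block_sum_def)
  qed
  have ev: "eigenvector Q.C x \<rho>"
    unfolding eigenvector_def using x_carrier xnz compressed_B_x Q.compressed_carrier[THEN carrier_matD(1)] by simp
  then have evc: "eigenvalue (cmat Q.C) (complex_of_real \<rho>)"
    using of_real_hom.eigenvalue_hom[OF Q.compressed_carrier, of \<rho>] by (auto simp: eigenvalue_def)
  note sr = spectral_radius_mem_max[OF Cc dd]
  have "\<rho> \<in> norm ` spectrum (cmat Q.C)"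
    using evc rho_pos by (force simp: spectrum_def image_iff)
  then have le: "\<rho> \<le> rho k (d + d) w B" unfolding rho_def[of k "d + d"] by (rule sr(2))
  obtain z where z: "eigenvalue (cmat Q.C) z" "cmod z = rho k (d + d) w B"
    using sr(1) unfolding rho_def[of k "d + d"] by (auto simp: spectrum_def)
  have peripheral: "z = complex_of_real \<rho>" if "eigenvalue (cmat Q.C) z" "cmod z = rho k (d + d) w B" for z
  proof -
    have "z \<noteq> 0" using that(2) le rho_pos by auto
    then show ?thesis using compressed_B_eigenvalue[OF that(1)] that(2) le by auto
  qed
  have rho_eq: "rho k (d + d) w B = \<rho>" using peripheral[OF z] z(2) rho_pos by simp
  show ?thesis
    unfolding reduced_rep_def rho_eq
    using linear_rep_g evc peripheral ev bs ghost by (simp add: rho_eq)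
qed

end

section \<open>Choice of the sequence of exponents, the normalised eigenvector and the resulting
  sequence for a given h\<close>

theorem corollary5:
  fixes k d :: nat and f :: "nat \<Rightarrow> real"
    and u v :: "real vec" and A :: "nat \<Rightarrow> real mat"
    and h :: "complex \<Rightarrow> complex" and \<mu> :: "real measure"
  assumes "k \<ge> 2"
    and "\<forall>n. f n \<ge> 0" and "k_regular k f"
    and "minimal_rep k f d u A v" and "nondegenerate_rep k d u A v"
    and "h \<in> phase_group k d u A" and "ghost_measure_at k f d u A h \<mu>"
    and "\<forall>i<k. inv_rotation k d u A * A i = A i * inv_rotation k d u A"
  shows "\<exists>g d' w B x.
    (\<forall>n. g n \<ge> 0) \<and> k_regular k g \<and> reduced_rep k g d' w B x \<and>
    (\<forall>\<nu>. ghost_measure k g \<nu> \<longleftrightarrow> \<nu> = \<mu>)"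
proof -
  have rep: "linear_rep k f d u A v" using assms(4) unfolding minimal_rep_def by blast
  then have uA: "u \<in> carrier_vec d" "v \<in> carrier_vec d" "\<And>j. j < k \<Longrightarrow> A j \<in> carrier_mat d d"
    by (auto simp: linear_rep_def)
  interpret F: matrix_family k d u A using assms(1) uA by unfold_locales
  have Cc: "cmat F.C \<in> carrier_mat d d" by simp
  obtain as where "char_poly (cmat F.C) = (\<Prod>a\<leftarrow>as. [:- a, 1:])"
    using char_poly_factorized[OF Cc] by blast
  then obtain n_as where "jordan_nf (cmat F.C) n_as" using jordan_nf_exists[OF Cc] by blast
  then obtain S S' where wit: "0 \<notin> fst ` set n_as" "similar_mat_wit (cmat F.C) (jordan_matrix n_as) S S'"
    by (auto simp: jordan_nf_def similar_mat_def)
  have pos: "rho k d u A > 0"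
    "u \<bullet> (((mat_total k d A - A 0) * rotation k d u A h * limit_mat k d u A) *\<^sub>v v) > 0"
    using assms(5,6) by (auto simp: nondegenerate_rep_def)
  \<comment> \<open>In dimension 0 the scalar product in the nondegeneracy condition is an empty sum
    and cannot be positive.\<close>
  have "d > 0"
  proof (rule ccontr)
    assume "\<not> d > 0"
    then show False using pos(2) uA(3)[of 0] assms(1) by (auto simp: scalar_prod_def)
  qed
  then interpret F: growing_family k d u A S S' n_as
    using Cc wit pos by unfold_locales
  obtain s where s: "filterlim s at_top sequentially" and h: "\<And>z. (\<lambda>j. F.ph z ^ s j) \<longlonglongrightarrow> h z"
    using F.phase_group_sequence[OF assms(6)] by blast
  note rh = F.rotation_spectral_fun(1)[OF F.phase_limit_properties[OF h]]
  have rL: "F.rot h * F.L \<in> carrier_mat d d" using rh by (auto intro!: mult_carrier_mat[of _ d d])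
  define y0 where "y0 = (F.rot h * F.L) *\<^sub>v v"
  have y0: "y0 \<in> carrier_vec d" unfolding y0_def using rL uA(2) by auto
  \<comment> \<open>The value made positive by nondegeneracy at h. Dividing \<open>y0\<close> by it
    makes the sum over the leading digits, hence the block sum at level 0, equal to 1.\<close>
  define K where "K = u \<bullet> ((F.T - A 0) *\<^sub>v y0)"
  have A0: "F.T - A 0 \<in> carrier_mat d d" using uA(3)[of 0] assms(1) by auto
  have "(F.T - A 0) * F.rot h * F.L *\<^sub>v v = (F.T - A 0) *\<^sub>v y0"
    unfolding y0_def using A0 rh rL uA(2)
    by (simp add: assoc_mult_mat[of _ d d _ d _ d] assoc_mult_mat_vec[of _ d d _ d])
  then have K: "K > 0" using pos(2) by (simp add: K_def)
  define y where "y = (1 / K) \<cdot>\<^sub>v y0"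
  have RC: "F.R * F.C \<in> carrier_mat d d" by (auto intro!: mult_carrier_mat[of _ d d])
  have "(F.R * F.C) *\<^sub>v y0 = (F.R * F.C * F.rot h * F.L) *\<^sub>v v"
    unfolding y0_def using RC rh rL uA(2)
    by (simp add: assoc_mult_mat[of "F.R * F.C" d d _ d _ d] assoc_mult_mat_vec[of _ d d _ d])
  also have "F.R * F.C * F.rot h * F.L = F.rot h * (F.R * F.C * F.L)"
    unfolding F.rotation_R_C_commute[OF h] using RC rh
    by (intro assoc_mult_mat[of _ d d _ d _ d]) auto
  also have "F.rot h * (F.R * F.C * F.L) = F.\<rho> \<cdot>\<^sub>m (F.rot h * F.L)"
    unfolding F.R_C_limit_mat using rh by (intro mult_smult_distrib[of _ d d _ d]) auto
  also have "(F.\<rho> \<cdot>\<^sub>m (F.rot h * F.L)) *\<^sub>v v = F.\<rho> \<cdot>\<^sub>v y0"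
    unfolding y0_def using rL uA(2) by (rule smult_mat_mult_vec)
  finally have "(F.R * F.C) *\<^sub>v y = F.\<rho> \<cdot>\<^sub>v y"
    unfolding y_def using mult_mat_vec[OF RC y0] by (simp add: smult_smult_assoc mult.commute)
  then interpret G: rotated_family k d u A S S' n_as y
    using y0 assms(8) by unfold_locales (auto simp: y_def)
  have mass: "(\<lambda>j. block_mass k f (s j) l n) \<longlonglongrightarrow> G.g n / F.\<rho> ^ l" if "k ^ l \<le> n" "n < k ^ (l + 1)" for l n
  proof -
    have "n \<ge> 1" using that(1) assms(1) by (metis le_trans one_le_power Suc_1 Suc_leD One_nat_def)
    then show ?thesis
      unfolding G.g_eq[OF that]
      by (rule F.block_mass_tendsto[OF s h rep]) (use K in \<open>auto simp: K_def y_def y0_def\<close>)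
  qed
  have "(\<lambda>j. F.c (s j) * block_sum k f (s j)) \<longlonglongrightarrow> K"
    using F.scaled_block_sum_tendsto[OF s h rep] by (simp add: K_def y0_def)
  then have "\<forall>\<^sub>F j in sequentially. F.c (s j) * block_sum k f (s j) > 0"
    using K by (rule order_tendstoD)
  then obtain N where N: "\<And>j. j \<ge> N \<Longrightarrow> block_sum k f (s j) \<noteq> 0"
    by (force simp: eventually_sequentially)
  \<comment> \<open>A finite initial part is dropped, since \<open>ghost_measure_at\<close> speaks
    only of sequences along which no block sum vanishes.\<close>
  define t where "t j = s (j + N)" for j
  have shift: "filterlim (\<lambda>j. j + N) sequentially sequentially" by (rule filterlim_add_const_nat_at_top)
  have t: "filterlim t at_top sequentially" unfolding t_def by (rule filterlim_compose[OF s shift])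
  have tnz: "block_sum k f (t j) \<noteq> 0" for j unfolding t_def by (rule N) simp
  \<comment> \<open>Convergence in the space of functions on the complex numbers is pointwise
    convergence, which is all that the choice of \<open>s\<close> provides.\<close>
  have "(\<lambda>j. (\<lambda>z. F.ph z ^ t j)) \<longlonglongrightarrow> h"
    unfolding t_def by (intro tendsto_fun_pointwise filterlim_compose[OF h shift])
  then have weak: "weak_conv_torus (\<lambda>j. block_measure k f (t j)) \<mu>"
    using assms(7) t tnz unfolding ghost_measure_at_def by blast
  have massT: "(\<lambda>j. block_mass k f (t j) l n) \<longlonglongrightarrow> G.g n / F.\<rho> ^ l" if "k ^ l \<le> n" "n < k ^ (l + 1)" for l n
    unfolding t_def by (rule filterlim_compose[OF mass[OF that] shift])
  have f0: "\<And>n. f n \<ge> 0" using assms(2) by simp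
  note G_limit = weak_limit_from_masses[OF assms(1) f0 t tnz weak F.rho_pos massT G.g_zero]
  have "block_sum k G.g l \<noteq> 0" for l using G_limit(2)[of l] F.rho_pos by simp
  from unique_ghost_measure[OF this G_limit(3)]
  have ghost: "ghost_measure k G.g \<nu> \<longleftrightarrow> \<nu> = \<mu>" for \<nu> .
  have "reduced_rep k G.g (d + d) G.w G.B G.x"
    using G_limit(2) by (rule G.reduced_rep_g) (auto simp: ghost)
  moreover have "k_regular k G.g" by (rule G.Q.linear_rep_k_regular[OF G.linear_rep_g])
  ultimately show ?thesis using G_limit(1) ghost by blast
qed

end
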